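(* Let $\mathbf{G}$ be a Carnot group with horizontal vector fields $X_1,\dots,X_m$, and let $\Omega\subset\mathbf{G}$ be a bounded domain. Let $F\in C(\mathbb{R}\times\mathbb{R}^m\times\mathcal{S}(m))$ and consider the equation $$F(w,\nabla_h w,\nabla_h^2 w)=0\quad\text{in }\Omega .$$ Suppose that $u\in C(\bar\Omega)$ is a viscosity subsolution and $v\in C(\bar\Omega)$ is a viscosity supersolution of this equation in $\Omega$. Assume that either (i) $F$ is degenerate subelliptic and decreasing, or (ii) $F$ is uniformly subelliptic and nonincreasing. Then $$\sup_{\Omega}(u-v)^+\le \sup_{\partial\Omega}(u-v)^+ .$$
   Context: A Carnot group $\mathbf{G}$ of step $r$ is a connected, simply connected nilpotent Lie group whose Lie algebra $\mathfrak{g}$ admits a decomposition $\mathfrak{g}=V_1\oplus\cdots\oplus V_r$ with $[V_1,V_j]=V_{j+1}$ for $1\le j\le r-1$ and $[V_j,V_r]=0$. Fix an inner product on $\mathfrak g$ making the $V_j$ mutually orthogonal, and let $X_1,\dots,X_m$ be an orthonormal basis of $V_1$ ($m=\dim V_1$), viewed as left-invariant vector fields on $\mathbf G$; via the exponential map, $\mathbf G$ is identified with $\mathbb{R}^n$, $n=\dim\mathfrak g$. For a function $w$, $\nabla_h w=(X_1w,\dots,X_mw)$ and $\nabla_h^2 w=\big(\tfrac12(X_iX_j+X_jX_i)w\big)_{1\le i,j\le m}$. $\mathcal S(m)$ denotes the real symmetric $m\times m$ matrices, with $M\ge N$ meaning $M-N$ is positive semidefinite; $a^+=\max(a,0)$.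 Viscosity notions (test functions are Euclidean $C^2$): $w\in C(\Omega)$ is a viscosity subsolution if for every $x_0\in\Omega$ and $\phi\in C^2(\Omega)$ such that $w-\phi$ attains its maximum over $\Omega$ at $x_0$ we have $F(w(x_0),\nabla_h\phi(x_0),\nabla_h^2\phi(x_0))\ge 0$; $w$ is a viscosity supersolution if for every $x_0\in\Omega$ and $\phi\in C^2(\Omega)$ such that $w-\phi$ attains its minimum over $\Omega$ at $x_0$ we have $F(w(x_0),\nabla_h\phi(x_0),\nabla_h^2\phi(x_0))\le 0$. Structure conditions: $F$ is degenerate subelliptic if $F(r,p,M)\le F(r,p,N)$ whenever $M\le N$. $F$ is uniformly subelliptic if there are constants $\alpha_1,\alpha_2>0$ with $F(r,p,M)-F(r,q,N)\ge \alpha_1\,\mathrm{trace}(M-N)-\alpha_2|p-q|$ for all $M\ge N$ and all $r,p,q$. $F$ is nonincreasing if $F(r,p,M)\le F(s,p,M)$ whenever $r\ge s$. $F$ is decreasing if there is $\alpha_3>0$ with $F(r,p,M)-F(s,p,M)\le \alpha_3(s-r)$ whenever $r\ge s$. *)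

theory Defs
  imports "HOL-Analysis.Analysis"
begin

text \<open>The Lie algebra g is the euclidean space 'a (its inner product is the fixed
inner product on g); via the exponential map the group G is identified with 'a, so the
group law gm lives on 'a.  Real polynomial functions on a euclidean space:\<close>

inductive_set polyfun :: "('a::euclidean_space \<Rightarrow> real) set" where
  pf_const: "(\<lambda>_. c) \<in> polyfun"
| pf_coord: "b \<in> Basis \<Longrightarrow> (\<lambda>z. z \<bullet> b) \<in> polyfun"
| pf_add: "f \<in> polyfun \<Longrightarrow> g \<in> polyfun \<Longrightarrow> (\<lambda>z. f z + g z) \<in> polyfun"
| pf_mult: "f \<in> polyfun \<Longrightarrow> g \<in> polyfun \<Longrightarrow> (\<lambda>z. f z * g z) \<in> polyfun"

definition stratified_lie_algebra ::
  "('a::euclidean_space \<Rightarrow> 'a \<Rightarrow> 'a) \<Rightarrow> (nat \<Rightarrow> 'a set) \<Rightarrow> nat \<Rightarrow> bool" where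
  "stratified_lie_algebra br V r \<longleftrightarrow>
     (\<forall>x. linear (br x)) \<and> (\<forall>y. linear (\<lambda>x. br x y)) \<and>
     (\<forall>x. br x x = 0) \<and>
     (\<forall>x y z. br x (br y z) + br y (br z x) + br z (br x y) = 0) \<and>
     1 \<le> r \<and>
     (\<forall>j\<in>{1..r}. subspace (V j)) \<and>
     (\<forall>i\<in>{1..r}. \<forall>j\<in>{1..r}. i \<noteq> j \<longrightarrow> (\<forall>x\<in>V i. \<forall>y\<in>V j. x \<bullet> y = 0)) \<and>
     span (\<Union>j\<in>{1..r}. V j) = UNIV \<and>
     (\<forall>j. 1 \<le> j \<and> j < r \<longrightarrow> V (Suc j) = span {br x y | x y. x \<in> V 1 \<and> y \<in> V j}) \<and>
     (\<forall>j\<in>{1..r}. \<forall>x\<in>V j. \<forall>y\<in>V r. br x y = 0)"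

text \<open>gm is the group law of the connected, simply connected Lie group with Lie algebra
(g, br), written in exponential coordinates: it is an associative polynomial group law,
exp is the identity (t \<mapsto> t x are the one-parameter subgroups), and the Lie bracket is
recovered from the group commutator:
exp(tx) exp(ty) exp(-tx) exp(-ty) = exp(t^2 [x,y] + O(t^3)).\<close>
definition carnot_group ::
  "('a::euclidean_space \<Rightarrow> 'a \<Rightarrow> 'a) \<Rightarrow> ('a \<Rightarrow> 'a \<Rightarrow> 'a) \<Rightarrow> (nat \<Rightarrow> 'a set) \<Rightarrow> nat \<Rightarrow> bool" where
  "carnot_group gm br V r \<longleftrightarrow>
     stratified_lie_algebra br V r \<and>
     (\<forall>x y z. gm (gm x y) z = gm x (gm y z)) \<and>
     (\<forall>x s t. gm (s *\<^sub>R x) (t *\<^sub>R x) = (s + t) *\<^sub>R x) \<and>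
     (\<forall>b\<in>Basis. (\<lambda>z. gm (fst z) (snd z) \<bullet> b) \<in> polyfun) \<and>
     (\<forall>x y. ((\<lambda>t. (1 / t\<^sup>2) *\<^sub>R
               gm (gm (gm (t *\<^sub>R x) (t *\<^sub>R y)) (- (t *\<^sub>R x))) (- (t *\<^sub>R y)))
             \<longlongrightarrow> br x y) (at 0))"

definition horizontal_basis :: "(nat \<Rightarrow> 'a::euclidean_space set) \<Rightarrow> ('m::finite \<Rightarrow> 'a) \<Rightarrow> bool" where
  "horizontal_basis V X \<longleftrightarrow>
     (\<forall>i j. X i \<bullet> X j = (if i = j then 1 else 0)) \<and> span (range X) = V 1"

text \<open>The left-invariant vector field with value v at the identity:
(X_v w)(x) = d/dt w(x \<cdot> exp(t v)) at t = 0.\<close>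
definition Xfield :: "('a::euclidean_space \<Rightarrow> 'a \<Rightarrow> 'a) \<Rightarrow> 'a \<Rightarrow> ('a \<Rightarrow> real) \<Rightarrow> 'a \<Rightarrow> real" where
  "Xfield gm v w x = deriv (\<lambda>t. w (gm x (t *\<^sub>R v))) 0"

definition hgrad :: "('a::euclidean_space \<Rightarrow> 'a \<Rightarrow> 'a) \<Rightarrow> ('m::finite \<Rightarrow> 'a) \<Rightarrow> ('a \<Rightarrow> real) \<Rightarrow> 'a \<Rightarrow> real^'m" where
  "hgrad gm X w x = (\<chi> i. Xfield gm (X i) w x)"

definition hhess :: "('a::euclidean_space \<Rightarrow> 'a \<Rightarrow> 'a) \<Rightarrow> ('m::finite \<Rightarrow> 'a) \<Rightarrow> ('a \<Rightarrow> real) \<Rightarrow> 'a \<Rightarrow> real^'m^'m" where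
  "hhess gm X w x = (\<chi> i j. (Xfield gm (X i) (Xfield gm (X j) w) x
                              + Xfield gm (X j) (Xfield gm (X i) w) x) / 2)"

definition symmats :: "(real^'m^'m) set" where
  "symmats = {M. transpose M = M}"

definition mat_le :: "real^'m^'m \<Rightarrow> real^'m^'m \<Rightarrow> bool" where
  "mat_le M N \<longleftrightarrow> (\<forall>\<xi>. \<xi> \<bullet> ((N - M) *v \<xi>) \<ge> 0)"

definition C2_on :: "'a::euclidean_space set \<Rightarrow> ('a \<Rightarrow> real) \<Rightarrow> bool" where
  "C2_on S \<phi> \<longleftrightarrow> (\<exists>g H. (\<forall>x\<in>S. (\<phi> has_derivative (\<lambda>h. g x \<bullet> h)) (at x)) \<and>
                          (\<forall>x\<in>S. (g has_derivative H x) (at x)) \<and>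
                          (\<forall>b\<in>Basis. continuous_on S (\<lambda>x. H x b)))"

definition visc_sub ::
  "('a::euclidean_space \<Rightarrow> 'a \<Rightarrow> 'a) \<Rightarrow> ('m::finite \<Rightarrow> 'a) \<Rightarrow> (real \<Rightarrow> real^'m \<Rightarrow> real^'m^'m \<Rightarrow> real)
   \<Rightarrow> 'a set \<Rightarrow> ('a \<Rightarrow> real) \<Rightarrow> bool" where
  "visc_sub gm X F \<Omega> w \<longleftrightarrow> continuous_on \<Omega> w \<and>
     (\<forall>x0\<in>\<Omega>. \<forall>\<phi>. C2_on \<Omega> \<phi> \<and> (\<forall>x\<in>\<Omega>. w x - \<phi> x \<le> w x0 - \<phi> x0) \<longrightarrow>
        F (w x0) (hgrad gm X \<phi> x0) (hhess gm X \<phi> x0) \<ge> 0)"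

definition visc_super ::
  "('a::euclidean_space \<Rightarrow> 'a \<Rightarrow> 'a) \<Rightarrow> ('m::finite \<Rightarrow> 'a) \<Rightarrow> (real \<Rightarrow> real^'m \<Rightarrow> real^'m^'m \<Rightarrow> real)
   \<Rightarrow> 'a set \<Rightarrow> ('a \<Rightarrow> real) \<Rightarrow> bool" where
  "visc_super gm X F \<Omega> w \<longleftrightarrow> continuous_on \<Omega> w \<and>
     (\<forall>x0\<in>\<Omega>. \<forall>\<phi>. C2_on \<Omega> \<phi> \<and> (\<forall>x\<in>\<Omega>. w x - \<phi> x \<ge> w x0 - \<phi> x0) \<longrightarrow>
        F (w x0) (hgrad gm X \<phi> x0) (hhess gm X \<phi> x0) \<le> 0)"

definition degenerate_subelliptic :: "(real \<Rightarrow> real^'m \<Rightarrow> real^'m^'m \<Rightarrow> real) \<Rightarrow> bool" where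
  "degenerate_subelliptic F \<longleftrightarrow>
     (\<forall>r p M N. M \<in> symmats \<and> N \<in> symmats \<and> mat_le M N \<longrightarrow> F r p M \<le> F r p N)"

definition uniformly_subelliptic :: "(real \<Rightarrow> real^'m \<Rightarrow> real^'m^'m \<Rightarrow> real) \<Rightarrow> bool" where
  "uniformly_subelliptic F \<longleftrightarrow>
     (\<exists>\<alpha>1 \<alpha>2. \<alpha>1 > 0 \<and> \<alpha>2 > 0 \<and>
       (\<forall>r p q M N. M \<in> symmats \<and> N \<in> symmats \<and> mat_le N M \<longrightarrow>
          F r p M - F r q N \<ge> \<alpha>1 * trace (M - N) - \<alpha>2 * norm (p - q)))"

definition nonincreasing_F :: "(real \<Rightarrow> real^'m \<Rightarrow> real^'m^'m \<Rightarrow> real) \<Rightarrow> bool" where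
  "nonincreasing_F F \<longleftrightarrow>
     (\<forall>r s p M. M \<in> symmats \<and> r \<ge> s \<longrightarrow> F r p M \<le> F s p M)"

definition decreasing_F :: "(real \<Rightarrow> real^'m \<Rightarrow> real^'m^'m \<Rightarrow> real) \<Rightarrow> bool" where
  "decreasing_F F \<longleftrightarrow>
     (\<exists>\<alpha>3>0. \<forall>r s p M. M \<in> symmats \<and> r \<ge> s \<longrightarrow> F r p M - F s p M \<le> \<alpha>3 * (s - r))"

end

theory Submission
  imports Defs "HOL-Computational_Algebra.Polynomial"
begin

text \<open>
  Suppose \<open>u - v\<close> has an interior maximum above its boundary values.  Since \<open>F\<close> does not depend on the point and
  the horizontal fields are left-invariant, the sup-convolution \<open>U x = max\<^sub>y (u y - \<bar>y \<cdot> x\<inverse>\<bar>\<^sup>2 / \<epsilon>)\<close> of \<open>u\<close> by left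
  translations is again a subsolution, and it is semiconvex because the kernel is a polynomial; likewise for
  \<open>v\<close>.  By Jensen's lemma a small linear tilt moves the maximum of the difference to a point where
  both regularisations have a second order expansion.  There the horizontal Hessians are ordered, as one sees by
  differentiating twice along the curves \<open>t \<mapsto> x \<cdot> exp (t v)\<close>, and the structure conditions on \<open>F\<close> give a
  contradiction.  In the uniformly subelliptic case strictness comes from a barrier \<open>c (\<langle>X\<^sub>i, x\<rangle> + k)\<^sup>n\<close>, whose jet is
  explicit because \<open>x \<mapsto> \<langle>X\<^sub>i, x\<rangle>\<close> is a group homomorphism.

  The expansions come from Alexandrov's argument: gradients of semiconvex functions are inverses of
  Lipschitz maps, to which Rademacher's theorem applies.
\<close>

text \<open>A Euclidean displacement would be the wrong penalty: freezing it moves test functions by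
  Euclidean translations, along which the fields change. Freezing z = \<open>gm y (- x)\<close>
  means y = z . x, a left translation, so horizontal jets are carried over without any error term.

  The parameter of the convolution is therefore fixed once, just small enough to keep the maximisers
  inside \<Omega>. The jets then stay in a bounded set, while the tilt and a localising penalty tend
  to zero; uniform continuity of \<open>F\<close> on bounded jets absorbs what remains.

  The excess of u - v over its boundary values is a budget of 4 \<theta>: one \<theta> is reserved
  for the barrier, one for the tilt, and 2 \<theta> remain as the gap between the two values
  inserted in \<open>F\<close>. If \<open>F\<close> is decreasing, this gap is already
  contradictory; if it is only nonincreasing, the gap merely gives a sign, and strictness has to
  come from the second order term.

  The bracket is tied to the group law only by a commutator limit, so the homomorphism property of
  horizontal coordinates has to be extracted from that limit, through the adjoint action.\<close>

section \<open>Rademacher's theorem\<close>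

text \<open>The value of \<open>lim\<close> is unspecified where the difference quotients diverge; clamping keeps the
  function bounded there.\<close>

definition clamped_rderiv :: "real \<Rightarrow> (real \<Rightarrow> real) \<Rightarrow> real \<Rightarrow> real" where
  "clamped_rderiv L k s = max (- L) (min L (lim (\<lambda>m. (k (s + 1 / real (Suc m)) - k s) * real (Suc m))))"

section \<open>Fundamental theorem of calculus for Lipschitz functions of one variable\<close>

lemma clamped_rderiv_eq:
  assumes lip: "\<And>s t. \<bar>k s - k t\<bar> \<le> L * \<bar>s - t\<bar>"
    and "(\<lambda>m. (k (s + 1 / real (Suc m)) - k s) * real (Suc m)) \<longlonglongrightarrow> l"
  shows "clamped_rderiv L k s = l"
proof -
  have b: "\<bar>(k (s + 1 / real (Suc m)) - k s) * real (Suc m)\<bar> \<le> L" for m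
  proof -
    have "\<bar>k (s + 1 / real (Suc m)) - k s\<bar> \<le> L * (1 / real (Suc m))"
      using lip[of "s + 1 / real (Suc m)" s] by simp
    then have "\<bar>k (s + 1 / real (Suc m)) - k s\<bar> * real (Suc m) \<le> L * (1 / real (Suc m)) * real (Suc m)"
      by (rule mult_right_mono) simp
    then show ?thesis by (simp add: abs_mult del: of_nat_Suc)
  qed
  then have "\<bar>l\<bar> \<le> L"
    by (intro LIMSEQ_le_const2[OF tendsto_rabs[OF assms(2)]]) blast
  then show ?thesis
    unfolding clamped_rderiv_def limI[OF assms(2)] by auto
qed

text \<open>After adding a steep linear term, \<open>k\<close> becomes an increasing bi-Lipschitz
  bijection \<open>h\<close>. The measure that gives a set the length of its image under
  \<open>h\<close> has a Radon-Nikodym density, and Lebesgue differentiation identifies that density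
  almost everywhere with the right derivative.\<close>

lemma lipschitz_has_integral_clamped_rderiv:
  fixes k :: "real \<Rightarrow> real"
  assumes lip: "\<And>s t. \<bar>k s - k t\<bar> \<le> L * \<bar>s - t\<bar>" and "a \<le> b"
  shows "(clamped_rderiv L k has_integral (k b - k a)) {a..b}"
proof -
  have L0: "L \<ge> 0" using lip[of 0 1] by simp
  \<comment> \<open>Slopes of \<open>k\<close> are at least -L, so those of \<open>h\<close> are at
    least 1; injectivity and surjectivity both follow from this.\<close>
  define h where "h s = k s + (L + 1) * s" for s
  have h_ge: "h t - h s \<ge> t - s" if "s \<le> t" for s t
    using lip[of t s] that unfolding h_def by (simp add: algebra_simps abs_le_iff)
  have h_lip: "\<bar>h s - h t\<bar> \<le> (2 * L + 1) * \<bar>s - t\<bar>" for s t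
  proof -
    have "\<bar>h s - h t\<bar> \<le> \<bar>k s - k t\<bar> + \<bar>(L + 1) * (s - t)\<bar>"
      unfolding h_def by (simp add: algebra_simps)
    also have "\<dots> \<le> L * \<bar>s - t\<bar> + (L + 1) * \<bar>s - t\<bar>"
      using lip[of s t] L0 by (simp add: abs_mult)
    finally show ?thesis by (simp add: algebra_simps)
  qed
  have h_strict: "h s < h t" if "s < t" for s t
    using h_ge[of s t] that by simp
  have h_le: "h s \<le> h t \<longleftrightarrow> s \<le> t" for s t
    using h_strict[of s t] h_strict[of t s] by (cases s t rule: linorder_cases) auto
  have inj: "inj h"
    by (rule injI) (metis h_le order_antisym order_refl)
  have cont: "continuous_on UNIV h"
  proof (rule lipschitz_on_continuous_on)
    show "(2 * L + 1)-lipschitz_on UNIV h"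
      using h_lip L0 by (auto simp: lipschitz_on_def dist_real_def)
  qed
  have surj: "\<exists>s. h s = y" for y
  proof -
    define c where "c = \<bar>y - h 0\<bar>"
    have "h (- c) \<le> y" "y \<le> h c"
      using h_ge[of "- c" 0] h_ge[of 0 c] unfolding c_def by auto
    moreover have "continuous_on {- c..c} h"
      using cont continuous_on_subset by blast
    moreover have "- c \<le> c" unfolding c_def by simp
    ultimately show ?thesis
      using IVT'[of h "- c" y c] by blast
  qed
  define g where "g = inv h"
  have gh: "g (h s) = s" for s unfolding g_def using inj by simp
  have hg: "h (g y) = y" for y unfolding g_def using surj by (metis surj_f_inv_f surj_def)
  have "mono g"
    by (rule monoI) (metis h_le hg)
  then have gm[measurable]: "g \<in> borel_measurable borel"
    by (rule borel_measurable_mono)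
  \<comment> \<open>The Stieltjes measure of \<open>h\<close>, obtained by pushing Lebesgue measure
    forward along the inverse of \<open>h\<close>.\<close>
  define N where "N = distr lborel borel g"
  have vim: "g -` A = h ` A" for A
    by (auto simp: image_iff) (metis hg, metis gh)
  have emN: "emeasure N A = emeasure lborel (h ` A)" if "A \<in> sets borel" for A
    unfolding N_def using that by (simp add: emeasure_distr vim)
  have setsN: "sets N = sets lborel" unfolding N_def by simp
  \<comment> \<open>Lipschitz images of null sets are null.\<close>
  have ac: "absolutely_continuous lborel N"
  proof (unfold absolutely_continuous_def, rule subsetI)
    fix A :: "real set" assume A: "A \<in> null_sets lborel"
    then have "negligible A"
      by (simp add: negligible_iff_null_sets null_sets_completionI)
    then have "negligible (h ` A)"
      by (intro negligible_locally_Lipschitz_image)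
        (auto intro!: exI[of _ UNIV] exI[of _ "2 * L + 1"] h_lip)
    moreover have "h ` A \<in> sets borel"
      using A measurable_sets[OF gm, of A] by (simp add: vim null_sets_def)
    ultimately have "emeasure lborel (h ` A) = 0"
      by (simp add: negligible_iff_emeasure0)
    then show "A \<in> null_sets N"
      using A by (simp add: null_sets_def emN setsN)
  qed
  obtain f where f: "f \<in> borel_measurable lborel" "density lborel f = N"
    using sigma_finite_measure.Radon_Nikodym[OF sigma_finite_lborel ac setsN] by blast
  have hIcc: "h ` {c..d} = {h c..h d}" for c d
  proof (intro equalityI subsetI)
    fix y assume "y \<in> {h c..h d}"
    then have "g y \<in> {c..d}" "y = h (g y)"
      using h_le[of c "g y"] h_le[of "g y" d] by (auto simp: hg)
    then show "y \<in> h ` {c..d}" by blast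
  qed (auto simp: h_le)
  have int: "(\<integral>\<^sup>+x. f x * indicator {c..d} x \<partial>lborel) = ennreal (h d - h c)" if "c \<le> d" for c d
  proof -
    have "(\<integral>\<^sup>+x. f x * indicator {c..d} x \<partial>lborel) = emeasure N {c..d}"
      using f by (simp add: emeasure_density flip: f(2))
    also have "\<dots> = ennreal (h d - h c)"
      using that by (simp add: emN hIcc h_le)
    finally show ?thesis .
  qed
  \<comment> \<open>The density takes values in \<open>ennreal\<close>. Its integrals over [-n, n]
    are finite, so the value \<infinity> occurs only on a null set.\<close>
  have fin: "AE x in lborel. f x \<noteq> \<infinity>"
  proof -
    have "AE x in lborel. f x * indicator {- real n..real n} x \<noteq> \<infinity>" for n
      using f(1) by (intro nn_integral_PInf_AE) (auto simp: int)
    then have "AE x in lborel. \<forall>n. f x * indicator {- real n..real n} x \<noteq> \<infinity>"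
      by (simp add: AE_all_countable)
    then show ?thesis
    proof eventually_elim
      case (elim x)
      obtain n where "\<bar>x\<bar> \<le> real n" using real_arch_simple by blast
      then have "indicator {- real n..real n} x = (1 :: ennreal)" by (auto simp: indicator_def)
      then show ?case using elim[rule_format, of n] by simp
    qed
  qed
  define \<phi> where "\<phi> x = enn2real (f x)" for x
  have \<phi>m[measurable]: "\<phi> \<in> borel_measurable borel" unfolding \<phi>_def using f(1) by simp
  have \<phi>int: "(\<phi> has_integral (h d - h c)) {c..d}" if "c \<le> d" for c d
  proof -
    have "(\<integral>\<^sup>+x. ennreal (\<phi> x * indicator {c..d} x) \<partial>lborel) = ennreal (h d - h c)"
    proof -
      have "(\<integral>\<^sup>+x. ennreal (\<phi> x * indicator {c..d} x) \<partial>lborel) = (\<integral>\<^sup>+x. f x * indicator {c..d} x \<partial>lborel)"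
        using fin by (intro nn_integral_cong_AE) (auto simp: \<phi>_def indicator_def top.not_eq_extremum)
      then show ?thesis using int[OF that] by simp
    qed
    moreover have "(\<lambda>x. \<phi> x * indicator {c..d} x) \<in> borel_measurable lborel" by simp
    moreover have "0 \<le> \<phi> x * indicator {c..d} x" for x by (simp add: \<phi>_def)
    moreover have "0 \<le> h d - h c" using that by (simp add: h_le)
    ultimately have "((\<lambda>x. \<phi> x * indicator {c..d} x) has_integral (h d - h c)) UNIV"
      by (intro nn_integral_has_integral) auto
    then show ?thesis
      by (subst has_integral_restrict_UNIV[symmetric])
        (auto elim!: has_integral_eq[rotated] simp: indicator_def)
  qed
  have "\<phi> integrable_on cbox c d" for c d
    using \<phi>int[of c d] by (cases "c \<le> d") auto
  \<comment> \<open>Lebesgue differentiation over cubes with lower corner \<open>x\<close>; on the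
    line these are the intervals [x, x + t], which fit right difference quotients.\<close>
  then obtain Z where Z: "negligible Z"
    "\<And>x e. x \<notin> Z \<Longrightarrow> 0 < e \<Longrightarrow> \<exists>d>0. \<forall>t. 0 < t \<and> t < d \<longrightarrow>
        norm (integral (cbox x (x + t *\<^sub>R One)) \<phi> /\<^sub>R t ^ DIM(real) - \<phi> x) < e"
    using integrable_ccontinuous_explicit[of \<phi>] by metis
  have eq: "clamped_rderiv L k x = \<phi> x - (L + 1)" if xZ: "x \<notin> Z" for x
  proof (rule clamped_rderiv_eq[OF lip])
    have "(\<lambda>m. (h (x + 1 / real (Suc m)) - h x) * real (Suc m)) \<longlonglongrightarrow> \<phi> x"
    proof (rule LIMSEQ_I)
      fix e :: real assume "0 < e"
      then obtain d where d: "d > 0" "\<And>t. 0 < t \<and> t < d \<Longrightarrow>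
         norm (integral (cbox x (x + t *\<^sub>R One)) \<phi> /\<^sub>R t ^ DIM(real) - \<phi> x) < e"
        using Z(2)[OF xZ] by blast
      obtain n where n: "inverse (real (Suc n)) < d"
        using reals_Archimedean[OF d(1)] by auto
      show "\<exists>no. \<forall>n\<ge>no. norm ((h (x + 1 / real (Suc n)) - h x) * real (Suc n) - \<phi> x) < e"
      proof (intro exI[of _ n] allI impI)
        fix m assume "n \<le> m"
        then have "1 / real (Suc m) \<le> inverse (real (Suc n))" by (simp add: field_simps)
        then have "0 < 1 / real (Suc m)" "1 / real (Suc m) < d" using n by auto
        moreover have eqI: "integral (cbox x (x + (1 / real (Suc m)) *\<^sub>R One)) \<phi> = h (x + 1 / real (Suc m)) - h x"
          using \<phi>int[of x "x + 1 / real (Suc m)"] by (simp add: integral_unique)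
        ultimately show "norm ((h (x + 1 / real (Suc m)) - h x) * real (Suc m) - \<phi> x) < e"
          using d(2)[of "1 / real (Suc m)"] unfolding eqI by (simp add: mult.commute del: of_nat_Suc)
      qed
    qed
    then have "(\<lambda>m. (h (x + 1 / real (Suc m)) - h x) * real (Suc m) - (L + 1)) \<longlonglongrightarrow> \<phi> x - (L + 1)"
      by (intro tendsto_diff tendsto_const)
    moreover have "(h (x + 1 / real (Suc m)) - h x) * real (Suc m) - (L + 1) = (k (x + 1 / real (Suc m)) - k x) * real (Suc m)" for m
      unfolding h_def by (simp add: field_simps)
    ultimately show "(\<lambda>m. (k (x + 1 / real (Suc m)) - k x) * real (Suc m)) \<longlonglongrightarrow> \<phi> x - (L + 1)" by simp
  qed
  have "((\<lambda>x. \<phi> x - (L + 1)) has_integral (h b - h a - (L + 1) * (b - a))) {a..b}"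
    using has_integral_diff[OF \<phi>int[OF assms(2)] has_integral_const_real[of "L + 1" a b]] assms(2)
    by (simp add: mult.commute)
  then have "((\<lambda>x. \<phi> x - (L + 1)) has_integral (k b - k a)) {a..b}"
    unfolding h_def by (simp add: algebra_simps)
  then show ?thesis
    by (rule has_integral_spike[OF Z(1), rotated]) (use eq in auto)
qed

text \<open>In several dimensions the line through \<open>a\<close> is a null set, so a bound on the
  integral over \<open>B\<close> says nothing about \<open>D\<close> on it. Averaging over base
  points in a small cube at \<open>a\<close> repairs this by Fubini; returning from a good base
  point to \<open>a\<close> costs a Lipschitz error proportional to the side \<eta>.\<close>

lemma average_increment_bound:
  fixes g :: "'a::euclidean_space \<Rightarrow> real" and L t \<eta> c I :: real
  assumes lip: "\<And>x y. \<bar>g x - g y\<bar> \<le> L * norm (x - y)"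
    and Dm[measurable]: "D \<in> borel_measurable borel" and Db: "\<And>x. \<bar>D x\<bar> \<le> L"
    and ftc: "\<And>y t. t \<ge> 0 \<Longrightarrow> ((\<lambda>s. D (y + s *\<^sub>R b)) has_integral (g (y + t *\<^sub>R b) - g y)) {0..t}"
    and "t \<ge> 0" "\<eta> > 0"
    and sub: "\<And>y s. y \<in> cbox a (a + \<eta> *\<^sub>R One) \<Longrightarrow> 0 \<le> s \<Longrightarrow> s \<le> t \<Longrightarrow> y + s *\<^sub>R b \<in> B"
    and B[measurable]: "B \<in> sets borel"
    and I: "(\<integral>\<^sup>+y. indicator B y * ennreal \<bar>D y - c\<bar> \<partial>lborel) \<le> ennreal I" and "I \<ge> 0"
  shows "\<bar>g (a + t *\<^sub>R b) - g a - t * c\<bar> \<le> t * I / \<eta> ^ DIM('a) + 2 * L * (DIM('a) * \<eta>)"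
proof -
  define Q where "Q = cbox a (a + \<eta> *\<^sub>R One)"
  have L0: "L \<ge> 0" using Db[of 0] by linarith
  have lipon: "L-lipschitz_on UNIV g"
    using lip L0 by (auto simp: lipschitz_on_def dist_norm)
  then have [measurable]: "g \<in> borel_measurable borel"
    by (intro borel_measurable_continuous_onI lipschitz_on_continuous_on)
  have [measurable]: "Q \<in> sets borel" unfolding Q_def by simp
  have pw: "ennreal \<bar>g (y + t *\<^sub>R b) - g y - t * c\<bar> \<le>
      (\<integral>\<^sup>+s. indicator {0..t} s * ennreal \<bar>D (y + s *\<^sub>R b) - c\<bar> \<partial>lborel)" for y
  proof -
    define G where "G s = indicator {0..t} s *\<^sub>R (D (y + s *\<^sub>R b) - c)" for s
    have int: "integrable lborel G"
      unfolding G_def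
    proof (rule Bochner_Integration.integrable_bound[where f = "\<lambda>s. indicator {0..t} s *\<^sub>R (L + \<bar>c\<bar>)"])
      show "integrable lborel (\<lambda>s. indicator {0..t} s *\<^sub>R (L + \<bar>c\<bar>))"
        by (intro integrable_scaleR_left integrable_real_indicator) (auto simp: emeasure_lborel_Icc_eq)
      show "AE s in lborel. norm (indicator {0..t} s *\<^sub>R (D (y + s *\<^sub>R b) - c))
          \<le> norm (indicator {0..t} s *\<^sub>R (L + \<bar>c\<bar>))"
      proof (rule AE_I2)
        fix s
        show "norm (indicator {0..t} s *\<^sub>R (D (y + s *\<^sub>R b) - c)) \<le> norm (indicator {0..t} s *\<^sub>R (L + \<bar>c\<bar>))"
          using Db[of "y + s *\<^sub>R b"] by (auto simp: indicator_def)
      qed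
    qed simp
    have "((\<lambda>s. D (y + s *\<^sub>R b) - c) has_integral (g (y + t *\<^sub>R b) - g y - t * c)) {0..t}"
      using has_integral_diff[OF ftc[OF \<open>t \<ge> 0\<close>, of y] has_integral_const_real[of c 0 t]] \<open>t \<ge> 0\<close> by simp
    then have "(G has_integral (g (y + t *\<^sub>R b) - g y - t * c)) UNIV"
      unfolding G_def by (subst (asm) has_integral_restrict_UNIV[symmetric])
        (auto elim!: has_integral_eq[rotated] simp: indicator_def)
    then have "g (y + t *\<^sub>R b) - g y - t * c = integral\<^sup>L lborel G"
      using has_integral_integral_lborel[OF int] has_integral_unique by blast
    then have "ennreal \<bar>g (y + t *\<^sub>R b) - g y - t * c\<bar> \<le> (\<integral>\<^sup>+s. norm (G s) \<partial>lborel)"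
      using integral_norm_bound_ennreal[OF int] by simp
    also have "\<dots> = (\<integral>\<^sup>+s. indicator {0..t} s * ennreal \<bar>D (y + s *\<^sub>R b) - c\<bar> \<partial>lborel)"
      by (intro nn_integral_cong) (auto simp: G_def indicator_def)
    finally show ?thesis .
  qed
  have main: "(\<integral>\<^sup>+y. indicator Q y * ennreal \<bar>g (y + t *\<^sub>R b) - g y - t * c\<bar> \<partial>lborel) \<le> ennreal (t * I)"
  proof -
    have "(\<integral>\<^sup>+y. indicator Q y * ennreal \<bar>g (y + t *\<^sub>R b) - g y - t * c\<bar> \<partial>lborel)
      \<le> (\<integral>\<^sup>+y. indicator Q y * (\<integral>\<^sup>+s. indicator {0..t} s * ennreal \<bar>D (y + s *\<^sub>R b) - c\<bar> \<partial>lborel) \<partial>lborel)"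
      by (intro nn_integral_mono mult_left_mono pw) simp
    also have "\<dots> = (\<integral>\<^sup>+y. (\<integral>\<^sup>+s. indicator Q y * (indicator {0..t} s * ennreal \<bar>D (y + s *\<^sub>R b) - c\<bar>) \<partial>lborel) \<partial>lborel)"
      by (simp add: nn_integral_cmult)
    \<comment> \<open>After the swap the inner integral, for each fixed \<open>s\<close>, is a
      translate of the integral of |D - c| over a set that \<open>sub\<close> places inside
      \<open>B\<close>, hence at most \<open>I\<close>.\<close>
    also have "\<dots> = (\<integral>\<^sup>+s. (\<integral>\<^sup>+y. indicator Q y * (indicator {0..t} s * ennreal \<bar>D (y + s *\<^sub>R b) - c\<bar>) \<partial>lborel) \<partial>lborel)"
      by (intro lborel_pair.Fubini'[symmetric]) simp
    also have "\<dots> \<le> (\<integral>\<^sup>+s. indicator {0..t} s * ennreal I \<partial>lborel)"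
    proof (intro nn_integral_mono)
      fix s :: real
      show "(\<integral>\<^sup>+y. indicator Q y * (indicator {0..t} s * ennreal \<bar>D (y + s *\<^sub>R b) - c\<bar>) \<partial>lborel)
          \<le> indicator {0..t} s * ennreal I"
      proof (cases "s \<in> {0..t}")
        case True
        have "(\<integral>\<^sup>+y. indicator Q y * (indicator {0..t} s * ennreal \<bar>D (y + s *\<^sub>R b) - c\<bar>) \<partial>lborel)
          \<le> (\<integral>\<^sup>+y. indicator B (s *\<^sub>R b + y) * ennreal \<bar>D (s *\<^sub>R b + y) - c\<bar> \<partial>lborel)"
          using True sub by (intro nn_integral_mono) (auto simp: indicator_def Q_def add.commute)
        also have "\<dots> = (\<integral>\<^sup>+y. indicator B y * ennreal \<bar>D y - c\<bar> \<partial>distr lborel borel ((+) (s *\<^sub>R b)))"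
          by (subst nn_integral_distr) simp_all
        also have "\<dots> \<le> ennreal I" using I by (simp add: lborel_distr_plus)
        finally show ?thesis using True by simp
      qed simp
    qed
    also have "\<dots> = ennreal (t * I)"
      using \<open>t \<ge> 0\<close> \<open>I \<ge> 0\<close> by (simp add: nn_integral_multc ennreal_mult)
    finally show ?thesis .
  qed
  have volQ: "emeasure lborel Q = ennreal (\<eta> ^ DIM('a))"
    unfolding Q_def using \<open>\<eta> > 0\<close> by (subst emeasure_lborel_cbox) (auto simp: inner_add_left inner_simps)
  show ?thesis
  proof (rule field_le_epsilon)
    fix e :: real assume "e > 0"
    \<comment> \<open>The slack \<open>e\<close> exceeds the average strictly, so the bound \<rho>
      cannot fail at every point of the cube.\<close>
    define \<rho> where "\<rho> = t * I / \<eta> ^ DIM('a) + e"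
    have "\<rho> \<ge> 0" unfolding \<rho>_def using \<open>t \<ge> 0\<close> \<open>I \<ge> 0\<close> \<open>\<eta> > 0\<close> \<open>e > 0\<close> by simp
    have "\<exists>y\<in>Q. \<bar>g (y + t *\<^sub>R b) - g y - t * c\<bar> \<le> \<rho>"
    proof (rule ccontr)
      assume "\<not> ?thesis"
      then have "indicator Q y * ennreal \<rho> \<le> indicator Q y * ennreal \<bar>g (y + t *\<^sub>R b) - g y - t * c\<bar>" for y
        by (cases "y \<in> Q") (auto intro!: ennreal_leI simp: not_le less_imp_le)
      then have "(\<integral>\<^sup>+y. indicator Q y * ennreal \<rho> \<partial>lborel) \<le> ennreal (t * I)"
        by (intro order_trans[OF nn_integral_mono main])
      then have "ennreal (\<eta> ^ DIM('a) * \<rho>) \<le> ennreal (t * I)"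
        using \<open>\<eta> > 0\<close> \<open>\<rho> \<ge> 0\<close> by (simp add: nn_integral_multc volQ ennreal_mult)
      then have "\<eta> ^ DIM('a) * \<rho> \<le> t * I"
        using \<open>t \<ge> 0\<close> \<open>I \<ge> 0\<close> by (subst (asm) ennreal_le_iff) auto
      moreover have "\<eta> ^ DIM('a) * \<rho> = t * I + \<eta> ^ DIM('a) * e"
        unfolding \<rho>_def using \<open>\<eta> > 0\<close> by (simp add: field_simps)
      ultimately show False
        using \<open>e > 0\<close> zero_less_power[OF \<open>\<eta> > 0\<close>, of "DIM('a)"] by (simp add: mult_le_0_iff)
    qed
    then obtain y where y: "y \<in> Q" "\<bar>g (y + t *\<^sub>R b) - g y - t * c\<bar> \<le> \<rho>" by blast
    have "norm (y - a) \<le> (\<Sum>i\<in>Basis. \<bar>(y - a) \<bullet> i\<bar>)" by (rule norm_le_l1)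
    also have "\<dots> \<le> (\<Sum>i\<in>(Basis::'a set). \<eta>)"
      using y(1) by (intro sum_mono) (auto simp: Q_def mem_box inner_simps)
    finally have ny: "norm (y - a) \<le> DIM('a) * \<eta>" by simp
    have "\<bar>g (a + t *\<^sub>R b) - g (y + t *\<^sub>R b)\<bar> \<le> L * norm (y - a)" "\<bar>g y - g a\<bar> \<le> L * norm (y - a)"
      using lip[of "a + t *\<^sub>R b" "y + t *\<^sub>R b"] lip[of y a] by (simp_all add: norm_minus_commute)
    moreover have "L * norm (y - a) \<le> L * (DIM('a) * \<eta>)"
      using ny L0 by (rule mult_left_mono)
    ultimately have "\<bar>g (a + t *\<^sub>R b) - g a - t * c\<bar> \<le> \<rho> + 2 * (L * (DIM('a) * \<eta>))"
      using y(2) by linarith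
    then show "\<bar>g (a + t *\<^sub>R b) - g a - t * c\<bar> \<le> t * I / \<eta> ^ DIM('a) + 2 * L * (DIM('a) * \<eta>) + e"
      unfolding \<rho>_def by simp
  qed
qed

text \<open>Lebesgue differentiation treats one fixed function, but the subtracted value
  \<open>D b x\<close> moves with the point. It is applied to |D b - c| for every rational
  \<open>c\<close>, countably many functions, and \<open>D b x\<close> is approximated by such a
  \<open>c\<close>.\<close>

lemma AE_strong_Lebesgue_point:
  fixes D :: "'b \<Rightarrow> 'a::euclidean_space \<Rightarrow> real" and L :: real
  assumes Dm: "\<And>b. b \<in> I \<Longrightarrow> D b \<in> borel_measurable borel" and Db: "\<And>b x. \<bar>D b x\<bar> \<le> L"
    and "countable I"
  obtains N where "negligible N"
    "\<And>x b e. x \<notin> N \<Longrightarrow> b \<in> I \<Longrightarrow> 0 < e \<Longrightarrow>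
      \<forall>\<^sub>F h in at_right 0. (\<integral>\<^sup>+y. indicator (cbox x (x + h *\<^sub>R One)) y * ennreal \<bar>D b y - D b x\<bar> \<partial>lborel)
          \<le> ennreal (e * h ^ DIM('a))"
proof -
  define f where "f p y = \<bar>D (fst p) y - snd p\<bar>" for p :: "'b \<times> real" and y
  have fm: "f p \<in> borel_measurable borel" if "p \<in> I \<times> \<rat>" for p
    unfolding f_def using that Dm by auto
  have setint: "set_integrable lborel (cbox a b) (f p)" if "p \<in> I \<times> \<rat>" for p and a b :: 'a
    unfolding set_integrable_def
  proof (rule Bochner_Integration.integrable_bound[where f = "\<lambda>s. indicator (cbox a b) s *\<^sub>R (L + \<bar>snd p\<bar>)"])
    show "integrable lborel (\<lambda>s. indicator (cbox a b) s *\<^sub>R (L + \<bar>snd p\<bar>))"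
      by (intro integrable_scaleR_left integrable_real_indicator) (auto simp: emeasure_lborel_cbox_eq)
    show "(\<lambda>x. indicat_real (cbox a b) x *\<^sub>R f p x) \<in> borel_measurable lborel"
      using fm[OF that] by simp
    show "AE s in lborel. norm (indicator (cbox a b) s *\<^sub>R f p s) \<le> norm (indicator (cbox a b) s *\<^sub>R (L + \<bar>snd p\<bar>))"
    proof (rule AE_I2)
      fix s
      show "norm (indicator (cbox a b) s *\<^sub>R f p s) \<le> norm (indicator (cbox a b) s *\<^sub>R (L + \<bar>snd p\<bar>))"
        using Db[of "fst p" s] by (auto simp: indicator_def f_def)
    qed
  qed
  have "\<exists>N. negligible N \<and> (\<forall>x e. x \<notin> N \<longrightarrow> 0 < e \<longrightarrow> (\<exists>d>0. \<forall>h. 0 < h \<and> h < d \<longrightarrow>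
         norm (integral (cbox x (x + h *\<^sub>R One)) (f p) /\<^sub>R h ^ DIM('a) - f p x) < e))"
    if "p \<in> I \<times> \<rat>" for p
  proof -
    have "f p integrable_on cbox a b" for a b
      using set_borel_integral_eq_integral(1)[OF setint[OF that]] .
    from integrable_ccontinuous_explicit[OF this] show ?thesis by metis
  qed
  then obtain NN where NN: "\<And>p. p \<in> I \<times> \<rat> \<Longrightarrow> negligible (NN p)"
    "\<And>p x e. p \<in> I \<times> \<rat> \<Longrightarrow> x \<notin> NN p \<Longrightarrow> 0 < e \<Longrightarrow> \<exists>d>0. \<forall>h. 0 < h \<and> h < d \<longrightarrow>
         norm (integral (cbox x (x + h *\<^sub>R One)) (f p) /\<^sub>R h ^ DIM('a) - f p x) < e"
    by metis
  define N where "N = \<Union> (NN ` (I \<times> \<rat>))"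
  show thesis
  proof
    show "negligible N"
      unfolding N_def using NN(1) \<open>countable I\<close>
      by (intro negligible_countable_Union countable_image countable_SIGMA) (auto simp: countable_rat)
    fix x b and e :: real assume x: "x \<notin> N" and b: "b \<in> I" and "0 < e"
    \<comment> \<open>Three thirds of \<open>e\<close>: the distance from \<open>c\<close> to
      \<open>D b x\<close> and the differentiation error bound the average of |D b - c|; the last
      third replaces \<open>c\<close> by \<open>D b x\<close> again.\<close>
    obtain c where c: "c \<in> \<rat>" "D b x - e / 3 < c" "c < D b x + e / 3"
      using Rats_dense_in_real[of "D b x - e / 3" "D b x + e / 3"] \<open>0 < e\<close> by auto
    then have cD: "\<bar>D b x - c\<bar> < e / 3" unfolding abs_less_iff by linarith
    have p: "(b, c) \<in> I \<times> \<rat>" using b c by auto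
    then have "x \<notin> NN (b, c)" using x N_def by blast
    from NN(2)[OF p this, of "e / 3"] \<open>0 < e\<close> obtain d where d: "d > 0"
      "\<And>h. 0 < h \<Longrightarrow> h < d \<Longrightarrow>
         norm (integral (cbox x (x + h *\<^sub>R One)) (f (b, c)) /\<^sub>R h ^ DIM('a) - f (b, c) x) < e / 3"
      by auto
    show "\<forall>\<^sub>F h in at_right 0. (\<integral>\<^sup>+y. indicator (cbox x (x + h *\<^sub>R One)) y * ennreal \<bar>D b y - D b x\<bar> \<partial>lborel)
          \<le> ennreal (e * h ^ DIM('a))"
      unfolding eventually_at_right_field
    proof (intro exI[of _ d] conjI allI impI d(1))
      fix h :: real assume h: "0 < h" "h < d"
      define Q where "Q = cbox x (x + h *\<^sub>R One)"
      have Qm[measurable]: "Q \<in> sets borel" unfolding Q_def by simp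
      have volQ: "emeasure lborel Q = ennreal (h ^ DIM('a))"
        unfolding Q_def using \<open>h > 0\<close> by (subst emeasure_lborel_cbox) (auto simp: inner_simps)
      have fQ: "set_integrable lborel Q (f (b, c))" unfolding Q_def by (rule setint[OF p])
      have fm'[measurable]: "f (b, c) \<in> borel_measurable borel" by (rule fm[OF p])
      have "(\<integral>\<^sup>+y. indicator Q y * ennreal \<bar>D b y - D b x\<bar> \<partial>lborel)
          \<le> (\<integral>\<^sup>+y. ennreal (indicator Q y *\<^sub>R f (b, c) y) + indicator Q y * ennreal (e / 3) \<partial>lborel)"
      proof (intro nn_integral_mono)
        fix y
        have "ennreal \<bar>D b y - D b x\<bar> \<le> ennreal (\<bar>D b y - c\<bar> + e / 3)"
          using cD by (intro ennreal_leI) linarith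
        then show "indicator Q y * ennreal \<bar>D b y - D b x\<bar>
            \<le> ennreal (indicator Q y *\<^sub>R f (b, c) y) + indicator Q y * ennreal (e / 3)"
          using \<open>0 < e\<close> by (cases "y \<in> Q") (auto simp: f_def)
      qed
      also have "\<dots> = (\<integral>\<^sup>+y. ennreal (indicator Q y *\<^sub>R f (b, c) y) \<partial>lborel) + ennreal (h ^ DIM('a)) * ennreal (e / 3)"
        by (simp add: nn_integral_add nn_integral_multc volQ)
      also have "(\<integral>\<^sup>+y. ennreal (indicator Q y *\<^sub>R f (b, c) y) \<partial>lborel) = ennreal (integral Q (f (b, c)))"
        using nn_integral_eq_integral[OF fQ[unfolded set_integrable_def]]
          set_borel_integral_eq_integral(2)[OF fQ]
        by (simp add: set_lebesgue_integral_def f_def)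
      also have "ennreal (integral Q (f (b, c))) + ennreal (h ^ DIM('a)) * ennreal (e / 3)
          \<le> ennreal (e * h ^ DIM('a))"
      proof -
        have "integral Q (f (b, c)) / h ^ DIM('a) < 2 * e / 3"
        proof -
          have "integral Q (f (b, c)) /\<^sub>R h ^ DIM('a) = integral Q (f (b, c)) / h ^ DIM('a)"
            by (simp add: divide_inverse mult.commute)
          moreover have "f (b, c) x = \<bar>D b x - c\<bar>" by (simp add: f_def)
          ultimately have "\<bar>integral Q (f (b, c)) / h ^ DIM('a) - \<bar>D b x - c\<bar>\<bar> < e / 3"
            using d(2)[OF h] unfolding Q_def[symmetric] by simp
          then show ?thesis using cD by linarith
        qed
        then have "integral Q (f (b, c)) \<le> 2 * e / 3 * h ^ DIM('a)"
          using h by (simp add: pos_divide_less_eq)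
        then have "integral Q (f (b, c)) + h ^ DIM('a) * (e / 3) \<le> e * h ^ DIM('a)"
          by (simp add: field_simps)
        moreover have "integral Q (f (b, c)) \<ge> 0"
          using set_borel_integral_eq_integral(1)[OF fQ] by (intro integral_nonneg) (auto simp: f_def)
        ultimately show ?thesis
          using h \<open>e > 0\<close> by (simp flip: ennreal_mult ennreal_plus add: ennreal_leI)
      qed
      finally show "(\<integral>\<^sup>+y. indicator (cbox x (x + h *\<^sub>R One)) y * ennreal \<bar>D b y - D b x\<bar> \<partial>lborel)
          \<le> ennreal (e * h ^ DIM('a))" unfolding Q_def .
    qed
  qed
qed

text \<open>The increment is built one coordinate at a time, each step being compared with the
  partial derivative at \<open>x\<close> itself. All intermediate points must lie in a cube with
  lower corner \<open>x\<close>, the shape supplied by the Lebesgue points; hence the restriction of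
  \<open>v\<close> to the positive orthant.\<close>

lemma one_sided_differentiable_AE:
  fixes g :: "'a::euclidean_space \<Rightarrow> real" and D :: "'a \<Rightarrow> 'a \<Rightarrow> real" and L :: real
  assumes lip: "\<And>x y. \<bar>g x - g y\<bar> \<le> L * norm (x - y)"
    and Dm: "\<And>b. b \<in> Basis \<Longrightarrow> D b \<in> borel_measurable borel" and Db: "\<And>b x. \<bar>D b x\<bar> \<le> L"
    and ftc: "\<And>b y t. b \<in> Basis \<Longrightarrow> t \<ge> 0 \<Longrightarrow>
      ((\<lambda>s. D b (y + s *\<^sub>R b)) has_integral (g (y + t *\<^sub>R b) - g y)) {0..t}"
  obtains N where "negligible N"
    "\<And>x e. x \<notin> N \<Longrightarrow> 0 < e \<Longrightarrow> \<exists>d>0. \<forall>v. (\<forall>b\<in>Basis. 0 \<le> v \<bullet> b) \<and> norm v < d \<longrightarrow>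
        \<bar>g (x + v) - g x - (\<Sum>b\<in>Basis. D b x * (v \<bullet> b))\<bar> \<le> e * norm v"
proof -
  have L0: "L \<ge> 0" using Db[of undefined 0] by linarith
  obtain N where N: "negligible N"
    "\<And>x b e. x \<notin> N \<Longrightarrow> b \<in> Basis \<Longrightarrow> 0 < e \<Longrightarrow>
      \<forall>\<^sub>F h in at_right 0. (\<integral>\<^sup>+y. indicator (cbox x (x + h *\<^sub>R One)) y * ennreal \<bar>D b y - D b x\<bar> \<partial>lborel)
          \<le> ennreal (e * h ^ DIM('a))"
    using AE_strong_Lebesgue_point[of Basis D L] Dm Db by (auto simp: countable_finite)
  show thesis
  proof
    show "negligible N" by fact
    fix x and \<epsilon> :: real assume x: "x \<notin> N" and "0 < \<epsilon>"
    define n where "n = real DIM('a)"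
    have n1: "n \<ge> 1" unfolding n_def using DIM_positive[where 'a='a] by linarith
    \<comment> \<open>The averaging cube will have side \<delta> |v|. This \<delta> keeps its
      Lipschitz error 2 L n \<delta> |v| within half of the share \<epsilon> |v| / n of one
      coordinate step.\<close>
    define \<delta> where "\<delta> = min 1 (\<epsilon> / (4 * (L + 1) * n\<^sup>2))"
    have \<delta>: "0 < \<delta>" "\<delta> \<le> 1"
      unfolding \<delta>_def using \<open>0 < \<epsilon>\<close> L0 n1 by (auto intro!: divide_pos_pos mult_pos_pos)
    have \<delta>2: "2 * L * (n * \<delta>) \<le> \<epsilon> / (2 * n)"
    proof -
      have "\<delta> * (4 * (L + 1) * n\<^sup>2) \<le> \<epsilon>"
        using L0 n1 unfolding \<delta>_def by (simp flip: pos_le_divide_eq)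
      moreover have "\<delta> * (4 * L * n\<^sup>2) \<le> \<delta> * (4 * (L + 1) * n\<^sup>2)"
        using \<delta> n1 by (intro mult_left_mono mult_right_mono) auto
      ultimately show ?thesis
        using n1 by (simp add: pos_le_divide_eq power2_eq_square algebra_simps)
    qed
    \<comment> \<open>The power of \<delta> / 2 cancels the volume ratio between the surrounding
      cube of side 2 |v| and the averaging cube, which leaves the other half of the share.\<close>
    define e where "e = \<epsilon> / (2 * n) * (\<delta> / 2) ^ DIM('a)"
    have "e > 0" unfolding e_def using \<open>0 < \<epsilon>\<close> n1 \<delta> by simp
    have "\<forall>\<^sub>F h in at_right 0. \<forall>b\<in>Basis. (\<integral>\<^sup>+y. indicator (cbox x (x + h *\<^sub>R One)) y * ennreal \<bar>D b y - D b x\<bar> \<partial>lborel)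
          \<le> ennreal (e * h ^ DIM('a))"
      using N(2)[OF x _ \<open>e > 0\<close>] by (intro eventually_ball_finite) auto
    then obtain d where d: "d > 0" "\<And>h b. 0 < h \<Longrightarrow> h < d \<Longrightarrow> b \<in> Basis \<Longrightarrow>
        (\<integral>\<^sup>+y. indicator (cbox x (x + h *\<^sub>R One)) y * ennreal \<bar>D b y - D b x\<bar> \<partial>lborel) \<le> ennreal (e * h ^ DIM('a))"
      unfolding eventually_at_right_field by auto
    show "\<exists>d>0. \<forall>v. (\<forall>b\<in>Basis. 0 \<le> v \<bullet> b) \<and> norm v < d \<longrightarrow>
        \<bar>g (x + v) - g x - (\<Sum>b\<in>Basis. D b x * (v \<bullet> b))\<bar> \<le> \<epsilon> * norm v"
    proof (intro exI[of _ "d / 2"] conjI allI impI)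
      show "d / 2 > 0" using d by simp
      fix v :: 'a assume v: "(\<forall>b\<in>Basis. 0 \<le> v \<bullet> b) \<and> norm v < d / 2"
      show "\<bar>g (x + v) - g x - (\<Sum>b\<in>Basis. D b x * (v \<bullet> b))\<bar> \<le> \<epsilon> * norm v"
      proof (cases "v = 0")
        case False
        define \<rho> where "\<rho> = norm v"
        have \<rho>: "\<rho> > 0" "2 * \<rho> < d" using False v unfolding \<rho>_def by auto
        have vb: "0 \<le> v \<bullet> b" "v \<bullet> b \<le> \<rho>" if "b \<in> Basis" for b
          using v that Basis_le_norm[OF that, of v] unfolding \<rho>_def by auto
        have step: "\<bar>g (a + (v \<bullet> b) *\<^sub>R b) - g a - (v \<bullet> b) * D b x\<bar> \<le> \<epsilon> / n * \<rho>"
          if b: "b \<in> Basis" and S: "S \<subseteq> Basis" "b \<notin> S" and a: "a = x + (\<Sum>i\<in>S. (v \<bullet> i) *\<^sub>R i)" for a b S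
        proof -
          have ai: "a \<bullet> i = x \<bullet> i + (if i \<in> S then v \<bullet> i else 0)" if "i \<in> Basis" for i
          proof -
            have "(\<Sum>j\<in>S. (v \<bullet> j) * (j \<bullet> i)) = (\<Sum>j\<in>S. if j = i then v \<bullet> i else 0)"
              using S that by (intro sum.cong) (auto simp: inner_Basis)
            also have "\<dots> = (if i \<in> S then v \<bullet> i else 0)"
              using finite_subset[OF S(1) finite_Basis] by (simp add: sum.delta)
            finally show ?thesis unfolding a by (simp add: inner_add_left inner_sum_left)
          qed
          have "\<bar>g (a + (v \<bullet> b) *\<^sub>R b) - g a - (v \<bullet> b) * D b x\<bar>
             \<le> (v \<bullet> b) * (e * (2 * \<rho>) ^ DIM('a)) / (\<delta> * \<rho>) ^ DIM('a) + 2 * L * (DIM('a) * (\<delta> * \<rho>))"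
          proof (rule average_increment_bound[where D = "D b" and B = "cbox x (x + (2 * \<rho>) *\<^sub>R One)", OF lip Dm[OF b] Db ftc[OF b]])
            show "0 \<le> v \<bullet> b" using vb b by blast
            show "0 < \<delta> * \<rho>" using \<delta> \<rho> by simp
            show "0 \<le> e * (2 * \<rho>) ^ DIM('a)" using \<open>e > 0\<close> \<rho> by simp
            show "(\<integral>\<^sup>+y. indicator (cbox x (x + (2 * \<rho>) *\<^sub>R One)) y * ennreal \<bar>D b y - D b x\<bar> \<partial>lborel)
              \<le> ennreal (e * (2 * \<rho>) ^ DIM('a))"
              using d(2)[of "2 * \<rho>" b] \<rho> b by simp
            fix y s assume y: "y \<in> cbox a (a + (\<delta> * \<rho>) *\<^sub>R One)" and s: "0 \<le> s" "s \<le> v \<bullet> b"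
            show "y + s *\<^sub>R b \<in> cbox x (x + (2 * \<rho>) *\<^sub>R One)"
              unfolding mem_box
            proof (intro ballI conjI)
              fix i :: 'a assume i: "i \<in> Basis"
              have yi: "a \<bullet> i \<le> y \<bullet> i" "y \<bullet> i \<le> a \<bullet> i + \<delta> * \<rho>"
                using y i by (auto simp: mem_box inner_simps)
              have "\<delta> * \<rho> \<le> \<rho>" using \<delta> \<rho> by simp
              moreover have "0 \<le> (if i \<in> S then v \<bullet> i else 0) + s * (b \<bullet> i)"
                "(if i \<in> S then v \<bullet> i else 0) + s * (b \<bullet> i) \<le> \<rho>"
                using vb[OF i] vb[OF b] s S(2) by (auto simp: inner_Basis b i)
              ultimately show "x \<bullet> i \<le> (y + s *\<^sub>R b) \<bullet> i" "(y + s *\<^sub>R b) \<bullet> i \<le> (x + (2 * \<rho>) *\<^sub>R One) \<bullet> i"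
                using yi i by (auto simp: ai[OF i] inner_add_left)
            qed
          qed auto
          also have "(v \<bullet> b) * (e * (2 * \<rho>) ^ DIM('a)) / (\<delta> * \<rho>) ^ DIM('a) = (v \<bullet> b) * (\<epsilon> / (2 * n))"
            unfolding e_def using \<delta> \<rho> by (simp add: power_mult_distrib power_divide)
          also have "\<dots> \<le> \<rho> * (\<epsilon> / (2 * n))"
            using vb[OF b] \<open>\<epsilon> > 0\<close> n1 by (intro mult_right_mono) auto
          also have "2 * L * (DIM('a) * (\<delta> * \<rho>)) = \<rho> * (2 * L * (n * \<delta>))"
            by (simp add: n_def)
          also have "\<dots> \<le> \<rho> * (\<epsilon> / (2 * n))"
            using \<delta>2 \<rho> by (intro mult_left_mono) auto
          finally show ?thesis using n1 by (simp add: field_simps)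
        qed
        \<comment> \<open>Induction over the set \<open>S\<close> of coordinates already
          moved.\<close>
        have "\<bar>g (x + (\<Sum>i\<in>S. (v \<bullet> i) *\<^sub>R i)) - g x - (\<Sum>b\<in>S. D b x * (v \<bullet> b))\<bar> \<le> card S * (\<epsilon> / n * \<rho>)"
          if "S \<subseteq> Basis" for S
          using finite_subset[OF that finite_Basis] that
        proof (induction S rule: finite_induct)
          case (insert b S)
          have "\<bar>g (x + (\<Sum>i\<in>S. (v \<bullet> i) *\<^sub>R i) + (v \<bullet> b) *\<^sub>R b) - g (x + (\<Sum>i\<in>S. (v \<bullet> i) *\<^sub>R i)) - (v \<bullet> b) * D b x\<bar> \<le> \<epsilon> / n * \<rho>"
            by (rule step[of b S]) (use insert in auto)
          moreover have eqs: "x + (\<Sum>i\<in>insert b S. (v \<bullet> i) *\<^sub>R i) = x + (\<Sum>i\<in>S. (v \<bullet> i) *\<^sub>R i) + (v \<bullet> b) *\<^sub>R b"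
            "(\<Sum>i\<in>insert b S. D i x * (v \<bullet> i)) = (\<Sum>i\<in>S. D i x * (v \<bullet> i)) + (v \<bullet> b) * D b x"
            "real (card (insert b S)) * (\<epsilon> / n * \<rho>) = real (card S) * (\<epsilon> / n * \<rho>) + \<epsilon> / n * \<rho>"
            using insert.hyps by (simp_all add: ac_simps add_divide_distrib distrib_left)
          moreover have "\<bar>g (x + (\<Sum>i\<in>S. (v \<bullet> i) *\<^sub>R i)) - g x - (\<Sum>b\<in>S. D b x * (v \<bullet> b))\<bar> \<le> card S * (\<epsilon> / n * \<rho>)"
            using insert by simp
          ultimately show ?case unfolding eqs by linarith
        qed simp
        from this[of Basis] show ?thesis
          using n1 unfolding \<rho>_def n_def by (simp add: euclidean_representation)
      qed simp
    qed
  qed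
qed

text \<open>The candidate partial derivatives \<open>D\<close> are the same for all orthants.
  Reflections turn each of the finitely many orthants into the positive one, and the union of the
  exceptional sets is still negligible.\<close>

theorem Rademacher_real:
  fixes g :: "'a::euclidean_space \<Rightarrow> real" and L :: real
  assumes lip: "\<And>x y. \<bar>g x - g y\<bar> \<le> L * norm (x - y)"
  obtains N where "negligible N" "\<And>x. x \<notin> N \<Longrightarrow> g differentiable (at x)"
proof -
  define D where "D b x = clamped_rderiv L (\<lambda>s. g (x + s *\<^sub>R b)) 0" for b x :: 'a
  have L0: "L \<ge> 0"
  proof -
    obtain b :: 'a where "b \<in> Basis" using nonempty_Basis by blast
    then show ?thesis using lip[of b 0] by simp
  qed
  have lipon: "L-lipschitz_on UNIV g"
    using lip L0 by (auto simp: lipschitz_on_def dist_norm)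
  then have [measurable]: "g \<in> borel_measurable borel"
    by (intro borel_measurable_continuous_onI lipschitz_on_continuous_on)
  \<comment> \<open>The clamped limit is an everywhere defined formula in countably many translates
    of \<open>g\<close>, so measurability does not depend on where the derivative exists.\<close>
  have Dm[measurable]: "D b \<in> borel_measurable borel" for b
    unfolding D_def clamped_rderiv_def by measurable
  have Db: "\<bar>D b x\<bar> \<le> L" for b x
    unfolding D_def clamped_rderiv_def using L0 by auto
  have ftc: "((\<lambda>s. D b (y + s *\<^sub>R b)) has_integral (g (y + t *\<^sub>R b) - g (y + r *\<^sub>R b))) {r..t}"
    if "b \<in> Basis" "r \<le> t" for b y r t
  proof -
    have "D b (y + s *\<^sub>R b) = clamped_rderiv L (\<lambda>s. g (y + s *\<^sub>R b)) s" for s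
      unfolding D_def clamped_rderiv_def by (simp add: algebra_simps)
    moreover have "\<bar>g (y + s *\<^sub>R b) - g (y + s' *\<^sub>R b)\<bar> \<le> L * \<bar>s - s'\<bar>" for s s'
      using lip[of "y + s *\<^sub>R b" "y + s' *\<^sub>R b"] that by (simp flip: scaleR_diff_left)
    ultimately show ?thesis
      using lipschitz_has_integral_clamped_rderiv[of "\<lambda>s. g (y + s *\<^sub>R b)" L r t] that by simp
  qed
  define R where "R \<sigma> x = (\<Sum>b\<in>Basis. ((if b \<in> \<sigma> then 1 else - 1) * (x \<bullet> b)) *\<^sub>R b)" for \<sigma> :: "'a set" and x :: 'a
  have Rb: "R \<sigma> x \<bullet> b = (if b \<in> \<sigma> then 1 else - 1) * (x \<bullet> b)" if "b \<in> Basis" for \<sigma> x b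
    unfolding R_def using that by (simp add: inner_sum_left_Basis)
  have RR: "R \<sigma> (R \<sigma> x) = x" for \<sigma> x
    by (rule euclidean_eqI) (simp add: Rb)
  have linR: "linear (R \<sigma>)" for \<sigma>
    by (rule linearI; rule euclidean_eqI) (simp_all add: Rb inner_add_left)
  have nR: "norm (R \<sigma> x) = norm x" for \<sigma> x
  proof -
    have "R \<sigma> x \<bullet> R \<sigma> x = (\<Sum>b\<in>Basis. (R \<sigma> x \<bullet> b) * (R \<sigma> x \<bullet> b))" by (rule euclidean_inner)
    also have "\<dots> = (\<Sum>b\<in>Basis. (x \<bullet> b) * (x \<bullet> b))" by (intro sum.cong) (auto simp: Rb)
    also have "\<dots> = x \<bullet> x" by (rule euclidean_inner[symmetric])
    finally show ?thesis by (simp add: norm_eq_sqrt_inner)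
  qed
  define good where "good \<sigma> x e d \<longleftrightarrow> (\<forall>v. (\<forall>b\<in>Basis. 0 \<le> R \<sigma> v \<bullet> b) \<and> norm v < d \<longrightarrow>
        \<bar>g (x + v) - g x - (\<Sum>b\<in>Basis. D b x * (v \<bullet> b))\<bar> \<le> e * norm v)" for \<sigma> x and e d :: real
  have "\<exists>N. negligible N \<and> (\<forall>x e. x \<notin> N \<longrightarrow> 0 < e \<longrightarrow> (\<exists>d>0. good \<sigma> x e d))" for \<sigma>
  proof -
    \<comment> \<open>In a flipped coordinate the reflected line runs backwards, so the derivative
      changes sign.\<close>
    define D' where "D' b y = (if b \<in> \<sigma> then 1 else - 1) * D b (R \<sigma> y)" for b y
    have 1: "\<bar>g (R \<sigma> x) - g (R \<sigma> y)\<bar> \<le> L * norm (x - y)" for x y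
      using lip[of "R \<sigma> x" "R \<sigma> y"] by (simp add: nR flip: linear_diff[OF linR])
    have 2: "D' b \<in> borel_measurable borel" for b
    proof -
      have [measurable]: "R \<sigma> \<in> borel_measurable borel"
        using linR by (intro borel_measurable_continuous_onI linear_continuous_on) (simp add: linear_conv_bounded_linear)
      show ?thesis unfolding D'_def by measurable
    qed
    have 3: "\<bar>D' b x\<bar> \<le> L" for b x unfolding D'_def using Db by (auto simp: abs_mult)
    have 4: "((\<lambda>s. D' b (y + s *\<^sub>R b)) has_integral (g (R \<sigma> (y + t *\<^sub>R b)) - g (R \<sigma> y))) {0..t}"
      if b: "b \<in> Basis" "0 \<le> t" for b y t
    proof -
      have Rv: "R \<sigma> (y + s *\<^sub>R b) = R \<sigma> y + (if b \<in> \<sigma> then s else - s) *\<^sub>R b" for s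
        using b by - (rule euclidean_eqI, auto simp: Rb inner_simps inner_Basis)
      show ?thesis
      proof (cases "b \<in> \<sigma>")
        case True
        then show ?thesis using ftc[OF b, of "R \<sigma> y"] by (simp add: D'_def Rv)
      next
        case False
        have "((\<lambda>s. D b (R \<sigma> y + (- s) *\<^sub>R b)) has_integral (g (R \<sigma> y) - g (R \<sigma> y - t *\<^sub>R b))) {0..t}"
          using ftc[OF b(1), of "- t" 0 "R \<sigma> y"] b(2) has_integral_reflect_real[of "\<lambda>s. D b (R \<sigma> y + s *\<^sub>R b)" _ 0 "- t"]
          by simp
        from has_integral_neg[OF this] False show ?thesis by (simp add: D'_def Rv)
      qed
    qed
    have "\<exists>N. negligible N \<and> (\<forall>x e. x \<notin> N \<longrightarrow> 0 < e \<longrightarrow>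
        (\<exists>d>0. \<forall>v. (\<forall>b\<in>Basis. 0 \<le> v \<bullet> b) \<and> norm v < d \<longrightarrow>
        \<bar>g (R \<sigma> (x + v)) - g (R \<sigma> x) - (\<Sum>b\<in>Basis. D' b x * (v \<bullet> b))\<bar> \<le> e * norm v))"
      (is "\<exists>N. ?P N")
    proof (rule one_sided_differentiable_AE[of "\<lambda>x. g (R \<sigma> x)" L D'])
      fix N assume "negligible N" "\<And>x e. x \<notin> N \<Longrightarrow> 0 < e \<Longrightarrow> \<exists>d>0. \<forall>v. (\<forall>b\<in>Basis. 0 \<le> v \<bullet> b) \<and> norm v < d \<longrightarrow>
        \<bar>g (R \<sigma> (x + v)) - g (R \<sigma> x) - (\<Sum>b\<in>Basis. D' b x * (v \<bullet> b))\<bar> \<le> e * norm v"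
      then show ?thesis by (intro exI[of ?P N] conjI allI impI)
    qed (rule 1 2 3 4; assumption)+
    then obtain N where N: "?P N" by (rule exE)
    show ?thesis
    proof (intro exI[of _ "R \<sigma> ` N"] conjI allI impI)
      show "negligible (R \<sigma> ` N)"
        using conjunct1[OF N]
        by (intro negligible_locally_Lipschitz_image)
          (auto intro!: exI[of _ UNIV] exI[of _ 1] simp: nR simp flip: linear_diff[OF linR])
      fix x and e :: real assume "x \<notin> R \<sigma> ` N" "0 < e"
      then have "R \<sigma> x \<notin> N" by (metis RR image_eqI)
      from conjunct2[OF N, THEN spec, THEN spec, THEN mp, THEN mp, OF this \<open>0 < e\<close>]
      obtain d where d: "d > 0"
        "\<forall>v. (\<forall>b\<in>Basis. 0 \<le> v \<bullet> b) \<and> norm v < d \<longrightarrow>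
        \<bar>g (R \<sigma> (R \<sigma> x + v)) - g (R \<sigma> (R \<sigma> x)) - (\<Sum>b\<in>Basis. D' b (R \<sigma> x) * (v \<bullet> b))\<bar> \<le> e * norm v"
        by (elim exE conjE)
      show "\<exists>d>0. good \<sigma> x e d"
        unfolding good_def
      proof (intro exI[of _ d] conjI allI impI d(1))
        fix v assume v: "(\<forall>b\<in>Basis. 0 \<le> R \<sigma> v \<bullet> b) \<and> norm v < d"
        have "(\<Sum>b\<in>Basis. D' b (R \<sigma> x) * (R \<sigma> v \<bullet> b)) = (\<Sum>b\<in>Basis. D b x * (v \<bullet> b))"
          by (intro sum.cong) (auto simp: D'_def RR Rb)
        moreover have "R \<sigma> (R \<sigma> x + R \<sigma> v) = x + v"
          by (simp add: linear_add[OF linR] RR)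
        ultimately show "\<bar>g (x + v) - g x - (\<Sum>b\<in>Basis. D b x * (v \<bullet> b))\<bar> \<le> e * norm v"
          using d(2)[THEN spec, of "R \<sigma> v"] v by (simp add: nR RR)
      qed
    qed
  qed
  then obtain N where N: "\<And>\<sigma>. negligible (N \<sigma>)"
    "\<And>\<sigma> x e. x \<notin> N \<sigma> \<Longrightarrow> 0 < e \<Longrightarrow> \<exists>d>0. good \<sigma> x e d"
    by metis
  show thesis
  proof
    show "negligible (\<Union> (N ` Pow Basis))"
      using N(1) by (intro negligible_Union) auto
    fix x assume x: "x \<notin> \<Union> (N ` Pow Basis)"
    have lin: "bounded_linear (\<lambda>v. \<Sum>b\<in>Basis. D b x * (v \<bullet> b))"
      by (intro bounded_linear_sum bounded_linear_const_mult bounded_linear_inner_left)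
    have "(g has_derivative (\<lambda>v. \<Sum>b\<in>Basis. D b x * (v \<bullet> b))) (at x)"
      unfolding has_derivative_at_alt
    proof (intro conjI lin allI impI)
      fix e :: real assume "0 < e"
      then have "\<forall>\<sigma>\<in>Pow Basis. \<exists>d>0. good \<sigma> x e d"
        using N(2) x by blast
      then obtain d where d: "\<And>\<sigma>. \<sigma> \<in> Pow Basis \<Longrightarrow> d \<sigma> > 0" "\<And>\<sigma>. \<sigma> \<in> Pow Basis \<Longrightarrow> good \<sigma> x e (d \<sigma>)"
        by metis
      define m where "m = Min (d ` Pow Basis)"
      have m: "m > 0" "\<And>\<sigma>. \<sigma> \<in> Pow Basis \<Longrightarrow> m \<le> d \<sigma>"
        unfolding m_def using d(1) by (subst Min_gr_iff) auto
      show "\<exists>d>0. \<forall>y. norm (y - x) < d \<longrightarrow>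
          norm (g y - g x - (\<Sum>b\<in>Basis. D b x * ((y - x) \<bullet> b))) \<le> e * norm (y - x)"
      proof (intro exI[of _ m] conjI allI impI m(1))
        fix y assume y: "norm (y - x) < m"
        define \<sigma> where "\<sigma> = {b \<in> Basis. 0 \<le> (y - x) \<bullet> b}"
        have "\<sigma> \<in> Pow Basis" unfolding \<sigma>_def by auto
        moreover have "\<forall>b\<in>Basis. 0 \<le> R \<sigma> (y - x) \<bullet> b"
          by (auto simp: Rb) (auto simp: \<sigma>_def)
        ultimately show "norm (g y - g x - (\<Sum>b\<in>Basis. D b x * ((y - x) \<bullet> b))) \<le> e * norm (y - x)"
          using d(2)[of \<sigma>] m(2)[of \<sigma>] y unfolding good_def by (auto dest!: spec[of _ "y - x"])
      qed
    qed
    then show "g differentiable (at x)" unfolding differentiable_def by blast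
  qed
qed

section \<open>Semiconvex functions: Alexandrov's theorem at contact points and Jensen's lemma\<close>

text \<open>Equivalently, q + 2 C x is an ordinary subgradient at \<open>x\<close> of f + C |.|^2
  relative to \<open>S\<close>; having such a \<open>q\<close> at every point is
  semiconvexity.\<close>

definition semi_subgrad :: "real \<Rightarrow> 'a::euclidean_space set \<Rightarrow> ('a \<Rightarrow> real) \<Rightarrow> 'a \<Rightarrow> 'a \<Rightarrow> bool" where
  "semi_subgrad C S f x q \<longleftrightarrow> (\<forall>y\<in>S. f x + q \<bullet> (y - x) - C * (norm (y - x))\<^sup>2 \<le> f y)"

definition semi_supergrad :: "real \<Rightarrow> 'a::euclidean_space set \<Rightarrow> ('a \<Rightarrow> real) \<Rightarrow> 'a \<Rightarrow> 'a \<Rightarrow> bool" where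
  "semi_supergrad C S f x q \<longleftrightarrow> (\<forall>y\<in>S. f y \<le> f x + q \<bullet> (y - x) + C * (norm (y - x))\<^sup>2)"

text \<open>A pointwise expansion that does not presuppose a gradient at nearby points. Only the
  form \<open>A h \<bullet> h\<close> enters, so \<open>A\<close> carries no symmetry
  condition.\<close>

definition second_order_at :: "('a::euclidean_space \<Rightarrow> real) \<Rightarrow> 'a \<Rightarrow> 'a \<Rightarrow> ('a \<Rightarrow> 'a) \<Rightarrow> bool" where
  "second_order_at f x q A \<longleftrightarrow> linear A \<and> (\<forall>e>0. \<exists>d>0. \<forall>y. norm (y - x) < d \<longrightarrow>
     \<bar>f y - f x - q \<bullet> (y - x) - A (y - x) \<bullet> (y - x) / 2\<bar> \<le> e * (norm (y - x))\<^sup>2)"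

text \<open>McShane's extension, an infimum of cones.\<close>

lemma lipschitz_extension_real:
  fixes f :: "'a::real_normed_vector \<Rightarrow> real"
  assumes lip: "\<And>x y. x \<in> S \<Longrightarrow> y \<in> S \<Longrightarrow> \<bar>f x - f y\<bar> \<le> norm (x - y)"
  obtains g where "\<And>x. x \<in> S \<Longrightarrow> g x = f x" "\<And>x y. \<bar>g x - g y\<bar> \<le> norm (x - y)"
proof (cases "S = {}")
  case True
  then show thesis using that[of "\<lambda>_. 0"] by simp
next
  case False
  then obtain a where a: "a \<in> S" by blast
  define g where "g x = (INF y\<in>S. f y + norm (x - y))" for x
  have lower: "f a - norm (x - a) \<le> f y + norm (x - y)" if "y \<in> S" for x y
    using lip[OF a that] norm_triangle_ineq[of "x - y" "a - x"] by (simp add: norm_minus_commute)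
  have bdd: "bdd_below ((\<lambda>y. f y + norm (x - y)) ` S)" for x
    using lower by (intro bdd_belowI2) blast
  have le: "g x \<le> g y + norm (x - y)" for x y
  proof -
    have "g x - norm (x - y) \<le> f z + norm (y - z)" if "z \<in> S" for z
    proof -
      have "g x \<le> f z + norm (x - z)" unfolding g_def using bdd that by (rule cINF_lower)
      also have "norm (x - z) \<le> norm (x - y) + norm (y - z)"
        using norm_triangle_ineq[of "x - y" "y - z"] by simp
      finally show ?thesis by simp
    qed
    then have "g x - norm (x - y) \<le> g y" unfolding g_def[of y] by (intro cINF_greatest[OF False])
    then show ?thesis by simp
  qed
  show thesis
  proof
    fix x assume x: "x \<in> S"
    have "g x \<le> f x + norm (x - x)" unfolding g_def using bdd x by (rule cINF_lower)
    moreover have "f x \<le> g x"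
      unfolding g_def
    proof (rule cINF_greatest[OF False])
      fix y assume "y \<in> S"
      then show "f x \<le> f y + norm (x - y)" using lip[OF x, of y] by linarith
    qed
    ultimately show "g x = f x" by simp
  next
    fix x y show "\<bar>g x - g y\<bar> \<le> norm (x - y)"
      using le[of x y] le[of y x] by (simp add: norm_minus_commute abs_le_iff)
  qed
qed

text \<open>Over n equal pieces the linear errors sum to \<open>a\<close>, the quadratic ones only
  to c / n.\<close>

lemma increment_le_of_quadratic_error:
  fixes \<psi> :: "real \<Rightarrow> real"
  assumes "\<And>s t. s \<in> {0..1} \<Longrightarrow> t \<in> {0..1} \<Longrightarrow> \<bar>\<psi> t - \<psi> s\<bar> \<le> a * \<bar>t - s\<bar> + c * (t - s)\<^sup>2"
  shows "\<bar>\<psi> 1 - \<psi> 0\<bar> \<le> a"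
proof -
  have N: "\<bar>\<psi> 1 - \<psi> 0\<bar> \<le> a + c * (1 / real (Suc n))" for n
  proof -
    define N where "N = Suc n"
    have "\<psi> 1 - \<psi> 0 = (\<Sum>i<N. \<psi> (real (Suc i) / N) - \<psi> (real i / N))"
      by (subst sum_lessThan_telescope[of "\<lambda>i. \<psi> (real i / N)"]) (simp add: N_def)
    also have "\<bar>\<dots>\<bar> \<le> (\<Sum>i<N. \<bar>\<psi> (real (Suc i) / N) - \<psi> (real i / N)\<bar>)"
      by (rule sum_abs)
    also have "\<dots> \<le> (\<Sum>i<N. a * (1 / N) + c * (1 / N)\<^sup>2)"
    proof (rule sum_mono)
      fix i assume "i \<in> {..<N}"
      then have i: "i < N" by simp
      then have "real (Suc i) / N \<in> {0..1}" "real i / N \<in> {0..1}"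
        by (auto simp: field_simps)
      moreover have "real (Suc i) / N - real i / N = 1 / N" by (simp add: diff_divide_distrib[symmetric])
      ultimately show "\<bar>\<psi> (real (Suc i) / N) - \<psi> (real i / N)\<bar> \<le> a * (1 / N) + c * (1 / N)\<^sup>2"
        using assms[of "real i / N" "real (Suc i) / N"] by simp
    qed
    also have "\<dots> = a + c * (1 / N)"
      unfolding N_def by (simp add: power2_eq_square field_simps del: of_nat_Suc)
    finally show ?thesis unfolding N_def .
  qed
  have "(\<lambda>n. a + c * (1 / real (Suc n))) \<longlonglongrightarrow> a + c * 0"
    by (intro tendsto_intros LIMSEQ_Suc[OF lim_1_over_n])
  then show ?thesis
    using N by (intro LIMSEQ_le_const) auto
qed

text \<open>Minty's observation: adding the two subgradient inequalities shows that \<open>q\<close>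
  is monotone in \<open>x\<close> up to -2 C |x - x'|^2, so adding 2 C + 1 times the identity makes
  it strongly monotone with constant 1.\<close>

lemma semi_subgrad_contraction:
  assumes "semi_subgrad C S f x q" "semi_subgrad C S f x' q'" "x \<in> S" "x' \<in> S"
  shows "norm (x - x') \<le> norm ((q + (2 * C + 1) *\<^sub>R x) - (q' + (2 * C + 1) *\<^sub>R x'))"
proof -
  let ?z = "(q + (2 * C + 1) *\<^sub>R x) - (q' + (2 * C + 1) *\<^sub>R x')"
  have "f x + q \<bullet> (x' - x) - C * (norm (x' - x))\<^sup>2 \<le> f x'"
    "f x' + q' \<bullet> (x - x') - C * (norm (x - x'))\<^sup>2 \<le> f x"
    using assms unfolding semi_subgrad_def by auto
  then have "(norm (x - x'))\<^sup>2 \<le> ?z \<bullet> (x - x')"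
    by (simp add: power2_norm_eq_inner norm_minus_commute[of x' x] inner_simps inner_commute algebra_simps)
  also have "\<dots> \<le> norm ?z * norm (x - x')" by (rule norm_cauchy_schwarz)
  finally show ?thesis
    by (cases "x = x'") (auto simp: power2_eq_square)
qed

text \<open>If q' were far from \<open>q\<close>, a step of length \<tau> from x' in the direction
  q' - q would lift \<open>f\<close> above the paraboloid touching it from above at
  \<open>x\<close>. The constant 6 is 4 + 1 + 1, from the distances 2 \<tau>, \<tau> and \<tau> in
  the three inequalities used.\<close>

lemma semi_subgrad_lipschitz_at_contact:
  assumes "C \<ge> 0" and sub: "semi_subgrad C S f x q" and sup: "semi_supergrad C S f x q"
    and sub': "semi_subgrad C S f x' q'" and "x' \<in> S"
    and ball: "ball x r \<subseteq> S" and "2 * norm (x' - x) < r"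
  shows "norm (q' - q) \<le> 6 * C * norm (x' - x)"
proof -
  \<comment> \<open>The step length \<tau> is kept apart from |x' - x| so that x' = x is reached by
    letting \<tau> tend to 0.\<close>
  have *: "norm (q' - q) \<le> 6 * C * \<tau>" if \<tau>: "norm (x' - x) \<le> \<tau>" "0 < \<tau>" "2 * \<tau> < r" for \<tau>
  proof (cases "q' = q")
    case False
    define n where "n = (q' - q) /\<^sub>R norm (q' - q)"
    have n: "norm n = 1" "(q' - q) \<bullet> n = norm (q' - q)"
      using False unfolding n_def by (auto simp: power2_norm_eq_inner[symmetric] power2_eq_square)
    define y where "y = x' + \<tau> *\<^sub>R n"
    have yx': "norm (y - x') = \<tau>" unfolding y_def using n \<tau> by simp
    have yx: "norm (y - x) \<le> 2 * \<tau>"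
      using norm_triangle_ineq[of "y - x'" "x' - x"] yx' \<tau> by simp
    then have "y \<in> S" using ball \<tau> by (auto simp: subset_eq dist_norm norm_minus_commute)
    then have 1: "f x' + q' \<bullet> (y - x') - C * (norm (y - x'))\<^sup>2 \<le> f y"
      "f y \<le> f x + q \<bullet> (y - x) + C * (norm (y - x))\<^sup>2"
      using sub' sup unfolding semi_subgrad_def semi_supergrad_def by auto
    have 2: "f x + q \<bullet> (x' - x) - C * (norm (x' - x))\<^sup>2 \<le> f x'"
      using sub \<open>x' \<in> S\<close> unfolding semi_subgrad_def by auto
    have "(q' - q) \<bullet> (y - x') \<le> C * (norm (y - x))\<^sup>2 + C * (norm (y - x'))\<^sup>2 + C * (norm (x' - x))\<^sup>2"
      using 1 2 by (simp add: inner_simps)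
    also have "\<dots> \<le> C * (2 * \<tau>)\<^sup>2 + C * \<tau>\<^sup>2 + C * \<tau>\<^sup>2"
      using yx yx' \<tau> \<open>C \<ge> 0\<close> by (intro add_mono mult_left_mono power_mono) auto
    also have "(q' - q) \<bullet> (y - x') = \<tau> * norm (q' - q)"
      unfolding y_def using n by simp
    finally have "\<tau> * norm (q' - q) \<le> \<tau> * (6 * C * \<tau>)" by (simp add: power2_eq_square algebra_simps)
    then show ?thesis using \<tau> by simp
  qed (use \<open>C \<ge> 0\<close> \<tau> in simp)
  show ?thesis
  proof (cases "x' = x")
    case True
    have r: "r > 0" using assms(7) by (smt (verit) norm_ge_zero)
    have "norm (q' - q) \<le> e" if "e > 0" for e
    proof -
      define \<tau> where "\<tau> = min (r / 4) (e / (6 * C + 1))"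
      have \<tau>: "\<tau> > 0" "2 * \<tau> < r" unfolding \<tau>_def using r that \<open>C \<ge> 0\<close> by auto
      have "6 * C * \<tau> \<le> (6 * C + 1) * (e / (6 * C + 1))"
        using \<open>C \<ge> 0\<close> \<tau> unfolding \<tau>_def by (intro mult_mono) auto
      then show ?thesis using *[of \<tau>] \<tau> True \<open>C \<ge> 0\<close> by simp
    qed
    then have "norm (q' - q) \<le> 0" by - (rule field_le_epsilon, simp)
    then show ?thesis using True by simp
  qed (use *[of "norm (x' - x)"] assms(7) in simp)
qed

text \<open>Along the segment from \<open>x\<close> only subgradients are available, so the gradient
  expansion cannot be integrated directly. Subgradient inequalities between two points of the
  segment give increments up to a quadratic error, and this error disappears under
  subdivision.\<close>

lemma second_order_at_of_gradient_expansion: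
  assumes "C \<ge> 0" "linear A" and sub: "\<And>y. y \<in> S \<Longrightarrow> \<exists>p. semi_subgrad C S f y p"
    and ball: "ball x r \<subseteq> S" "r > 0"
    and exp: "\<And>e. e > 0 \<Longrightarrow> \<exists>d>0. \<forall>y p. y \<in> S \<longrightarrow> norm (y - x) < d \<longrightarrow> semi_subgrad C S f y p \<longrightarrow>
        norm (p - q - A (y - x)) \<le> e * norm (y - x)"
  shows "second_order_at f x q A"
  unfolding second_order_at_def
proof (intro conjI allI impI \<open>linear A\<close>)
  fix e :: real assume "e > 0"
  from exp[OF this] obtain d where d: "d > 0"
    "\<And>y p. y \<in> S \<Longrightarrow> norm (y - x) < d \<Longrightarrow> semi_subgrad C S f y p \<Longrightarrow> norm (p - q - A (y - x)) \<le> e * norm (y - x)"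
    by blast
  show "\<exists>d>0. \<forall>y. norm (y - x) < d \<longrightarrow>
     \<bar>f y - f x - q \<bullet> (y - x) - A (y - x) \<bullet> (y - x) / 2\<bar> \<le> e * (norm (y - x))\<^sup>2"
  proof (intro exI[of _ "min d r"] conjI allI impI)
    show "min d r > 0" using d ball by simp
    fix y assume y: "norm (y - x) < min d r"
    define h where "h = y - x"
    define \<psi> where "\<psi> t = f (x + t *\<^sub>R h) - t * (q \<bullet> h) - t\<^sup>2 / 2 * (A h \<bullet> h)" for t
    define c where "c = C * (norm h)\<^sup>2 + A h \<bullet> h / 2"
    have mem: "x + t *\<^sub>R h \<in> S" "norm (x + t *\<^sub>R h - x) < d" if "t \<in> {0..1}" for t
    proof -
      have "norm (t *\<^sub>R h) \<le> norm h" using that by (simp add: mult_left_le_one_le)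
      then show "x + t *\<^sub>R h \<in> S" "norm (x + t *\<^sub>R h - x) < d"
        using y ball(1) by (auto simp: h_def subset_eq dist_norm)
    qed
    \<comment> \<open>The subgradient at \<open>s\<close> yields only a lower bound; exchanging
      \<open>s\<close> and \<open>t\<close> gives the upper one below.\<close>
    have one: "\<psi> t - \<psi> s \<ge> - (e * (norm h)\<^sup>2 * \<bar>t - s\<bar> + c * (t - s)\<^sup>2)"
      if s: "s \<in> {0..1}" and t: "t \<in> {0..1}" for s t
    proof -
      obtain p where p: "semi_subgrad C S f (x + s *\<^sub>R h) p" using sub mem(1)[OF s] by blast
      have eq: "x + t *\<^sub>R h - (x + s *\<^sub>R h) = (t - s) *\<^sub>R h" by (simp add: algebra_simps)
      have 1: "f (x + s *\<^sub>R h) + (t - s) * (p \<bullet> h) - C * ((t - s)\<^sup>2 * (norm h)\<^sup>2) \<le> f (x + t *\<^sub>R h)"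
        using p[unfolded semi_subgrad_def, rule_format, OF mem(1)[OF t]] unfolding eq
        by (simp add: power_mult_distrib)
      define err where "err = p - q - s *\<^sub>R A h"
      have "norm err \<le> e * norm (s *\<^sub>R h)"
        using d(2)[OF mem[OF s] p] unfolding err_def by (simp add: linear_scale[OF \<open>linear A\<close>])
      also have "\<dots> \<le> e * norm h"
        using s \<open>e > 0\<close> by (intro mult_left_mono) (auto simp: mult_left_le_one_le)
      finally have "\<bar>err \<bullet> h\<bar> \<le> e * norm h * norm h"
        by (intro order_trans[OF Cauchy_Schwarz_ineq2] mult_right_mono) auto
      then have "\<bar>(t - s) * (err \<bullet> h)\<bar> \<le> \<bar>t - s\<bar> * (e * (norm h)\<^sup>2)"
        unfolding abs_mult by (intro mult_left_mono) (auto simp: power2_eq_square)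
      then have 2: "(t - s) * (err \<bullet> h) \<ge> - (e * (norm h)\<^sup>2 * \<bar>t - s\<bar>)"
        by (simp add: abs_le_iff mult.commute)
      have ph: "p \<bullet> h = q \<bullet> h + s * (A h \<bullet> h) + err \<bullet> h"
        unfolding err_def by (simp add: inner_simps)
      have "\<psi> t - \<psi> s \<ge> (t - s) * (p \<bullet> h) - C * ((t - s)\<^sup>2 * (norm h)\<^sup>2)
          - (t - s) * (q \<bullet> h) - (t\<^sup>2 - s\<^sup>2) / 2 * (A h \<bullet> h)"
        using 1 unfolding \<psi>_def by (simp add: algebra_simps diff_divide_distrib)
      also have "(t - s) * (p \<bullet> h) - C * ((t - s)\<^sup>2 * (norm h)\<^sup>2)
          - (t - s) * (q \<bullet> h) - (t\<^sup>2 - s\<^sup>2) / 2 * (A h \<bullet> h) = (t - s) * (err \<bullet> h) - c * (t - s)\<^sup>2"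
        unfolding ph c_def by (simp add: power2_eq_square field_simps)
      finally show ?thesis using 2 by linarith
    qed
    have "\<bar>\<psi> 1 - \<psi> 0\<bar> \<le> e * (norm h)\<^sup>2"
    proof (rule increment_le_of_quadratic_error)
      fix s t :: real assume "s \<in> {0..1}" "t \<in> {0..1}"
      then show "\<bar>\<psi> t - \<psi> s\<bar> \<le> e * (norm h)\<^sup>2 * \<bar>t - s\<bar> + c * (t - s)\<^sup>2"
        using one[of s t] one[of t s] by (simp add: abs_minus_commute power2_commute abs_le_iff)
    qed
    then show "\<bar>f y - f x - q \<bullet> (y - x) - A (y - x) \<bullet> (y - x) / 2\<bar> \<le> e * (norm (y - x))\<^sup>2"
      unfolding \<psi>_def h_def by (simp add: algebra_simps diff_divide_distrib)
  qed
qed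

text \<open>The inverse of \<open>x \<mapsto> q + (2 * C + 1) *\<^sub>R x\<close>, with \<open>q\<close> a subgradient at \<open>x\<close>, is a contraction, so
  Rademacher's theorem applies to it.  At a point that is also touched from above by a paraboloid its
  derivative is onto, and inverting it yields the Hessian.\<close>

lemma second_order_at_contact_AE:
  assumes "C \<ge> 0" and sub: "\<And>y. y \<in> S \<Longrightarrow> \<exists>p. semi_subgrad C S f y p"
  shows "\<exists>N. negligible N \<and> (\<forall>x q. x \<in> interior S \<and> semi_subgrad C S f x q \<and> semi_supergrad C S f x q \<and>
       q + (2 * C + 1) *\<^sub>R x \<notin> N \<longrightarrow> (\<exists>A. second_order_at f x q A))"
proof -
  define z where "z x q = q + (2 * C + 1) *\<^sub>R x" for x q :: 'a
  define Z where "Z = {z x q | x q. x \<in> S \<and> semi_subgrad C S f x q}"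
  define J0 where "J0 w = (SOME x. x \<in> S \<and> (\<exists>q. semi_subgrad C S f x q \<and> z x q = w))" for w
  have contr: "norm (x - x') \<le> norm (z x q - z x' q')"
    if "semi_subgrad C S f x q" "semi_subgrad C S f x' q'" "x \<in> S" "x' \<in> S" for x q x' q'
    using semi_subgrad_contraction[OF that] unfolding z_def .
  have J0: "J0 (z x q) = x" if "x \<in> S" "semi_subgrad C S f x q" for x q
    unfolding J0_def
  proof (rule some_equality)
    fix x' assume "x' \<in> S \<and> (\<exists>q'. semi_subgrad C S f x' q' \<and> z x' q' = z x q)"
    then obtain q' where "x' \<in> S" "semi_subgrad C S f x' q'" "z x' q' = z x q" by blast
    then have "norm (x' - x) \<le> 0" using contr[of x' q' x q] that by simp
    then show "x' = x" by simp
  qed (use that in blast)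
  \<comment> \<open>\<open>J0\<close> is Lipschitz on the set \<open>Z\<close> of attained values
    only, while Rademacher's theorem concerns functions on the whole space; hence an extension,
    coordinate by coordinate.\<close>
  have "\<exists>g. (\<forall>w\<in>Z. g w = J0 w \<bullet> b) \<and> (\<forall>w w'. \<bar>g w - g w'\<bar> \<le> norm (w - w'))" if b: "b \<in> Basis" for b
  proof -
    have "\<bar>J0 w \<bullet> b - J0 w' \<bullet> b\<bar> \<le> norm (w - w')" if w: "w \<in> Z" "w' \<in> Z" for w w'
    proof -
      obtain x q x' q' where *: "w = z x q" "w' = z x' q'" "x \<in> S" "x' \<in> S" "semi_subgrad C S f x q" "semi_subgrad C S f x' q'"
        using w unfolding Z_def by blast
      have "\<bar>(x - x') \<bullet> b\<bar> \<le> norm (x - x')" using b by (rule Basis_le_norm)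
      also have "\<dots> \<le> norm (w - w')" using contr[of x q x' q'] * by simp
      finally show ?thesis using * by (simp add: J0 inner_diff_left)
    qed
    then show ?thesis using lipschitz_extension_real[of Z "\<lambda>w. J0 w \<bullet> b"] by metis
  qed
  then obtain g where g: "\<And>b w. b \<in> Basis \<Longrightarrow> w \<in> Z \<Longrightarrow> g b w = J0 w \<bullet> b"
    "\<And>b w w'. b \<in> Basis \<Longrightarrow> \<bar>g b w - g b w'\<bar> \<le> norm (w - w')"
    by metis
  have "\<exists>N. negligible N \<and> (\<forall>w. w \<notin> N \<longrightarrow> g b differentiable (at w))" if "b \<in> Basis" for b
    using Rademacher_real[of "g b" 1] g(2)[OF that] by (metis mult_1)
  then obtain NN where NN: "\<And>b. b \<in> Basis \<Longrightarrow> negligible (NN b)"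
    "\<And>b w. b \<in> Basis \<Longrightarrow> w \<notin> NN b \<Longrightarrow> g b differentiable (at w)"
    by metis
  define J where "J w = (\<Sum>b\<in>Basis. g b w *\<^sub>R b)" for w
  have J: "J (z x q) = x" if "x \<in> S" "semi_subgrad C S f x q" for x q
  proof -
    have "z x q \<in> Z" using that unfolding Z_def by blast
    then have "J (z x q) = (\<Sum>b\<in>Basis. (x \<bullet> b) *\<^sub>R b)"
      unfolding J_def using that by (intro sum.cong) (auto simp: g J0)
    then show ?thesis by (simp add: euclidean_representation)
  qed
  show ?thesis
  proof (intro exI[of _ "\<Union> (NN ` Basis)"] conjI allI impI; (elim conjE)?)
    show "negligible (\<Union> (NN ` Basis))" using NN(1) by (intro negligible_Union) auto
    fix x q assume xS: "x \<in> interior S" and xq: "semi_subgrad C S f x q" and sup: "semi_supergrad C S f x q"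
      and "q + (2 * C + 1) *\<^sub>R x \<notin> \<Union> (NN ` Basis)"
    then have "g b differentiable (at (z x q))" if "b \<in> Basis" for b
      using NN(2)[OF that] that unfolding z_def by blast
    then have "J differentiable (at (z x q))"
      unfolding J_def by (intro differentiable_sum) (auto intro!: differentiable_scaleR)
    then obtain D where D: "(J has_derivative D) (at (z x q))" unfolding differentiable_def by blast
    then have linD: "linear D" by (simp add: has_derivative_linear)
    obtain r where r: "r > 0" "ball x r \<subseteq> S" using xS unfolding mem_interior by blast
    have xS': "x \<in> S" using r by auto
    \<comment> \<open>6 C from the subgradient estimate at a contact point, plus 2 C + 1 from the
      linear term of \<open>z\<close>.\<close>
    define K where "K = 8 * C + 1"
    have K: "K > 0" unfolding K_def using \<open>C \<ge> 0\<close> by simp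
    have zlip: "norm (z y p - z x q) \<le> K * norm (y - x)"
      if "2 * norm (y - x) < r" "y \<in> S" "semi_subgrad C S f y p" for y p
    proof -
      have "z y p - z x q = (p - q) + (2 * C + 1) *\<^sub>R (y - x)" unfolding z_def by (simp add: algebra_simps)
      then have "norm (z y p - z x q) \<le> norm (p - q) + (2 * C + 1) * norm (y - x)"
        using norm_triangle_ineq[of "p - q" "(2 * C + 1) *\<^sub>R (y - x)"] \<open>C \<ge> 0\<close> by simp
      also have "norm (p - q) \<le> 6 * C * norm (y - x)"
        using semi_subgrad_lipschitz_at_contact[OF \<open>C \<ge> 0\<close> xq sup that(3,2) r(2) that(1)] .
      finally show ?thesis unfolding K_def by (simp add: algebra_simps)
    qed
    \<comment> \<open>Differentiability of \<open>J\<close> read through J (z y p) = y. By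
      \<open>zlip\<close> the error is measured by |y - x|.\<close>
    have expD: "\<exists>d>0. \<forall>y p. y \<in> S \<longrightarrow> norm (y - x) < d \<longrightarrow> semi_subgrad C S f y p \<longrightarrow>
        norm (y - x - D (z y p - z x q)) \<le> e * norm (y - x)" if "e > 0" for e
    proof -
      have "e / K > 0" using that K by simp
      then obtain d where d: "d > 0" "\<And>w. norm (w - z x q) < d \<Longrightarrow>
          norm (J w - J (z x q) - D (w - z x q)) \<le> e / K * norm (w - z x q)"
        using D unfolding has_derivative_at_alt by blast
      show ?thesis
      proof (intro exI[of _ "min (r / 2) (d / K)"] conjI allI impI)
        show "min (r / 2) (d / K) > 0" using r d K by simp
        fix y p assume y: "y \<in> S" "norm (y - x) < min (r / 2) (d / K)" "semi_subgrad C S f y p"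
        have 1: "norm (z y p - z x q) \<le> K * norm (y - x)" using y by (intro zlip) auto
        also have "\<dots> < d" using y(2) K by (simp add: field_simps)
        finally have "norm (y - x - D (z y p - z x q)) \<le> e / K * norm (z y p - z x q)"
          using d(2)[of "z y p"] J[OF y(1,3)] J[OF xS' xq] by simp
        also have "\<dots> \<le> e / K * (K * norm (y - x))"
          using 1 that K by (intro mult_left_mono) auto
        finally show "norm (y - x - D (z y p - z x q)) \<le> e * norm (y - x)" using K by simp
      qed
    qed
    \<comment> \<open>For \<open>a\<close> orthogonal to the range and y - x a multiple of
      \<open>a\<close>, the linearisation cannot approximate y - x with an error below |y -
      x|.\<close>
    have "surj D"
    proof (rule ccontr)
      assume "\<not> surj D"
      then have "span (range D) \<noteq> UNIV"
        using linear_subspace_image[OF linD subspace_UNIV] by (metis span_eq_iff)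
      then obtain a where a: "a \<noteq> 0" "\<And>w. w \<in> span (range D) \<Longrightarrow> a \<bullet> w = 0"
        using span_not_UNIV_orthogonal by blast
      obtain d where d: "d > 0" "\<And>y p. y \<in> S \<Longrightarrow> norm (y - x) < d \<Longrightarrow> semi_subgrad C S f y p \<Longrightarrow>
        norm (y - x - D (z y p - z x q)) \<le> 1 / 2 * norm (y - x)"
        using expD[of "1 / 2"] by auto
      define t where "t = min (d / 2) (r / 2) / norm a"
      define y where "y = x + t *\<^sub>R a"
      have "t * norm a = min (d / 2) (r / 2)" unfolding t_def using a by simp
      then have t: "t > 0" "t * norm a < d" "t * norm a < r"
        using a d r unfolding t_def by auto
      then have yS: "y \<in> S" "norm (y - x) < d"
        using r(2) unfolding y_def by (auto simp: subset_eq dist_norm)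
      obtain p where p: "semi_subgrad C S f y p" using sub[OF yS(1)] by blast
      have "a \<bullet> D (z y p - z x q) = 0" by (intro a(2) span_base) auto
      then have "t * (norm a)\<^sup>2 = a \<bullet> (y - x - D (z y p - z x q))"
        unfolding y_def by (simp add: inner_diff_right power2_norm_eq_inner)
      also have "\<dots> \<le> norm a * norm (y - x - D (z y p - z x q))" by (rule norm_cauchy_schwarz)
      also have "\<dots> \<le> norm a * (1 / 2 * norm (y - x))"
        using d(2)[OF yS p] by (intro mult_left_mono) auto
      also have "\<dots> = t * (norm a)\<^sup>2 / 2" unfolding y_def using t by (simp add: power2_eq_square)
      finally show False using t a by simp
    qed
    then obtain M where M: "linear M" "\<And>v. M (D v) = v"
      using linear_surjective_isomorphism[OF linD] by blast
    obtain B where B: "B > 0" "\<And>v. norm (M v) \<le> B * norm v" using linear_bounded_pos[OF M(1)] by blast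
    \<comment> \<open>\<open>M\<close> inverts the derivative of \<open>J\<close>, hence linearises
      z = q + (2 C + 1) x; removing the linear term leaves the Hessian.\<close>
    define A where "A v = M v - (2 * C + 1) *\<^sub>R v" for v
    have linA: "linear A"
      unfolding A_def by (intro linear_compose_sub M(1) linear_scaleR)
    have "second_order_at f x q A"
    proof (rule second_order_at_of_gradient_expansion[OF \<open>C \<ge> 0\<close> linA sub r(2,1)])
      fix e :: real assume "e > 0"
      then have "e / B > 0" using B by simp
      from expD[OF this] obtain d where d: "d > 0" "\<And>y p. y \<in> S \<Longrightarrow> norm (y - x) < d \<Longrightarrow> semi_subgrad C S f y p \<Longrightarrow>
        norm (y - x - D (z y p - z x q)) \<le> e / B * norm (y - x)" by blast
      show "\<exists>d>0. \<forall>y p. y \<in> S \<longrightarrow> norm (y - x) < d \<longrightarrow> semi_subgrad C S f y p \<longrightarrow>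
        norm (p - q - A (y - x)) \<le> e * norm (y - x)"
      proof (intro exI[of _ d] conjI allI impI d(1))
        fix y p assume y: "y \<in> S" "norm (y - x) < d" "semi_subgrad C S f y p"
        have "p - q - A (y - x) = - M (y - x - D (z y p - z x q))"
          unfolding A_def linear_diff[OF M(1), of "y - x" "D _"] M(2) z_def by (simp add: algebra_simps)
        then have "norm (p - q - A (y - x)) \<le> B * norm (y - x - D (z y p - z x q))" using B(2) by simp
        also have "\<dots> \<le> B * (e / B * norm (y - x))" using d(2)[OF y] B(1) by (intro mult_left_mono) auto
        finally show "norm (p - q - A (y - x)) \<le> e * norm (y - x)" using B(1) by simp
      qed
    qed
    then show "\<exists>A. second_order_at f x q A" by blast
  qed
qed

lemma semi_subgrad_continuous_on:
  assumes "C \<ge> 0" and sub: "\<And>y. y \<in> S \<Longrightarrow> \<exists>p. norm p \<le> L \<and> semi_subgrad C S f y p"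
  shows "continuous_on S f"
proof -
  have le: "f x - f y \<le> L * norm (y - x) + C * (norm (y - x))\<^sup>2" if "x \<in> S" "y \<in> S" for x y
  proof -
    obtain p where p: "norm p \<le> L" "semi_subgrad C S f x p" using sub \<open>x \<in> S\<close> by blast
    have "- (p \<bullet> (y - x)) \<le> norm p * norm (y - x)"
      using Cauchy_Schwarz_ineq2[of p "y - x"] by (simp add: abs_le_iff)
    also have "\<dots> \<le> L * norm (y - x)" using p by (intro mult_right_mono) auto
    finally show ?thesis using p(2) that(2) unfolding semi_subgrad_def by fastforce
  qed
  show ?thesis
    unfolding continuous_on_def
  proof
    fix x assume "x \<in> S"
    have "((\<lambda>y. L * norm (y - x) + C * (norm (y - x))\<^sup>2) \<longlongrightarrow> L * norm (x - x) + C * (norm (x - x))\<^sup>2) (at x within S)"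
      by (intro tendsto_intros)
    then have lim: "((\<lambda>y. L * norm (y - x) + C * (norm (y - x))\<^sup>2) \<longlongrightarrow> 0) (at x within S)" by simp
    have "((\<lambda>y. f y - f x) \<longlongrightarrow> 0) (at x within S)"
    proof (rule Lim_null_comparison[OF _ lim])
      show "\<forall>\<^sub>F y in at x within S. norm (f y - f x) \<le> L * norm (y - x) + C * (norm (y - x))\<^sup>2"
        unfolding eventually_at_filter
      proof (intro always_eventually allI impI)
        fix y assume "y \<in> S"
        then show "norm (f y - f x) \<le> L * norm (y - x) + C * (norm (y - x))\<^sup>2"
          using le[OF \<open>x \<in> S\<close> \<open>y \<in> S\<close>] le[OF \<open>y \<in> S\<close> \<open>x \<in> S\<close>] by (simp add: abs_le_iff norm_minus_commute)
      qed
    qed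
    then show "(f \<longlongrightarrow> f x) (at x within S)" by (simp add: LIM_zero_iff)
  qed
qed

text \<open>Jensen's lemma: the tilts \<open>p\<close> whose contact point is exceptional for \<open>f\<close> form a locally Lipschitz
  image of the negligible exceptional set, and likewise for \<open>g\<close>; they cannot fill a ball.\<close>

lemma Jensen_contact:
  fixes f g :: "'a::euclidean_space \<Rightarrow> real"
  assumes "C \<ge> 0" "R > 0" "\<kappa> > 0" "\<delta> > 0"
    and subf: "\<And>y. y \<in> cball x0 R \<Longrightarrow> \<exists>p. norm p \<le> L \<and> semi_subgrad C (cball x0 R) f y p"
    and subg: "\<And>y. y \<in> cball x0 R \<Longrightarrow> \<exists>p. norm p \<le> L \<and> semi_subgrad C (cball x0 R) g y p"
    and strict: "\<And>y. y \<in> cball x0 R \<Longrightarrow> f y + g y \<le> f x0 + g x0 - \<kappa> * (norm (y - x0))\<^sup>2"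
  obtains x p q1 q2 A1 A2 where "x \<in> ball x0 R" "norm p < \<delta>" "q1 + q2 + p = 0"
    "norm q1 \<le> L" "norm q2 \<le> L"
    "\<forall>y\<in>cball x0 R. f y + g y + p \<bullet> y \<le> f x + g x + p \<bullet> x"
    "semi_subgrad C (cball x0 R) f x q1" "semi_subgrad C (cball x0 R) g x q2"
    "second_order_at f x q1 A1" "second_order_at g x q2 A2"
proof -
  define B where "B = cball x0 R"
  \<comment> \<open>A tilt below \<kappa> R cannot carry the maximum to the sphere of radius
    \<open>R\<close>, where \<open>strict\<close> costs \<kappa> R^2.\<close>
  define \<delta>' where "\<delta>' = min \<delta> (\<kappa> * R)"
  have \<delta>': "\<delta>' > 0" "\<delta>' \<le> \<delta>" "\<delta>' \<le> \<kappa> * R" unfolding \<delta>'_def using assms by auto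
  have subf': "\<exists>p. semi_subgrad C B f y p" and subg': "\<exists>p. semi_subgrad C B g y p" if "y \<in> B" for y
    using subf subg that unfolding B_def by blast+
  have "\<exists>Nf. negligible Nf \<and> (\<forall>x q. x \<in> interior B \<and> semi_subgrad C B f x q \<and> semi_supergrad C B f x q \<and>
       q + (2 * C + 1) *\<^sub>R x \<notin> Nf \<longrightarrow> (\<exists>A. second_order_at f x q A))"
    by (rule second_order_at_contact_AE[OF \<open>C \<ge> 0\<close>]) (rule subf')
  then obtain Nf where Nf: "negligible Nf" "(\<forall>x q. x \<in> interior B \<and> semi_subgrad C B f x q \<and> semi_supergrad C B f x q \<and>
       q + (2 * C + 1) *\<^sub>R x \<notin> Nf \<longrightarrow> (\<exists>A. second_order_at f x q A))"
    by (elim exE conjE)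
  have "\<exists>Ng. negligible Ng \<and> (\<forall>x q. x \<in> interior B \<and> semi_subgrad C B g x q \<and> semi_supergrad C B g x q \<and>
       q + (2 * C + 1) *\<^sub>R x \<notin> Ng \<longrightarrow> (\<exists>A. second_order_at g x q A))"
    by (rule second_order_at_contact_AE[OF \<open>C \<ge> 0\<close>]) (rule subg')
  then obtain Ng where Ng: "negligible Ng" "(\<forall>x q. x \<in> interior B \<and> semi_subgrad C B g x q \<and> semi_supergrad C B g x q \<and>
       q + (2 * C + 1) *\<^sub>R x \<notin> Ng \<longrightarrow> (\<exists>A. second_order_at g x q A))"
    by (elim exE conjE)
  have contf: "continuous_on B f" "continuous_on B g"
    unfolding B_def using subf subg by (auto intro!: semi_subgrad_continuous_on[OF \<open>C \<ge> 0\<close>])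
  define G where "G p x q1 q2 \<longleftrightarrow> x \<in> ball x0 R \<and> (\<forall>y\<in>B. f y + g y + p \<bullet> y \<le> f x + g x + p \<bullet> x) \<and>
    norm q1 \<le> L \<and> norm q2 \<le> L \<and> semi_subgrad C B f x q1 \<and> semi_subgrad C B g x q2 \<and>
    q1 + q2 + p = 0 \<and> semi_supergrad C B f x q1 \<and> semi_supergrad C B g x q2" for p x q1 q2
  have ex: "\<exists>x q1 q2. G p x q1 q2" if p: "p \<in> ball 0 \<delta>'" for p
  proof -
    have "continuous_on B (\<lambda>y. f y + g y + p \<bullet> y)" by (intro continuous_intros contf)
    then obtain x where x: "x \<in> B" "\<And>y. y \<in> B \<Longrightarrow> f y + g y + p \<bullet> y \<le> f x + g x + p \<bullet> x"
      using continuous_attains_sup[of B "\<lambda>y. f y + g y + p \<bullet> y"] \<open>R > 0\<close> unfolding B_def by auto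
    have xin: "x \<in> ball x0 R"
    proof (rule ccontr)
      assume "x \<notin> ball x0 R"
      then have nx: "norm (x - x0) = R" using x(1) unfolding B_def by (simp add: dist_norm norm_minus_commute)
      have "x0 \<in> B" unfolding B_def using \<open>R > 0\<close> by simp
      then have "\<kappa> * R\<^sup>2 \<le> p \<bullet> (x - x0)"
        using x(2)[of x0] strict[of x] x(1) nx unfolding B_def by (simp add: inner_diff_right)
      also have "\<dots> \<le> norm p * R" using norm_cauchy_schwarz[of p "x - x0"] nx by simp
      finally have "\<kappa> * R \<le> norm p" using \<open>R > 0\<close> by (simp add: power2_eq_square)
      then show False using p \<delta>' by simp
    qed
    obtain q1 where q1: "norm q1 \<le> L" "semi_subgrad C B f x q1" using subf x(1) B_def by blast
    obtain q2 where q2: "norm q2 \<le> L" "semi_subgrad C B g x q2" using subg x(1) B_def by blast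
    \<comment> \<open>\<open>w\<close> is a subgradient of the tilted sum up to a quadratic error.
      At an interior maximum it must vanish, which ties the two subgradients to the tilt.\<close>
    define w where "w = q1 + q2 + p"
    have below: "w \<bullet> (y - x) \<le> 2 * C * (norm (y - x))\<^sup>2" if "y \<in> B" for y
      using q1(2) q2(2) x(2)[OF that] that unfolding semi_subgrad_def w_def
      by (fastforce simp: inner_simps)
    have "w = 0"
    proof (rule ccontr)
      assume "w \<noteq> 0"
      define r where "r = R - norm (x - x0)"
      have r: "r > 0" unfolding r_def using xin by (simp add: dist_norm norm_minus_commute)
      define t where "t = min (r / norm w) (1 / (4 * C + 1))"
      have t: "t > 0" "t * norm w \<le> r" "t * (4 * C + 1) \<le> 1"
        unfolding t_def using r \<open>w \<noteq> 0\<close> \<open>C \<ge> 0\<close> by (auto simp: min_def field_simps)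
      have "norm (x + t *\<^sub>R w - x0) \<le> norm (x - x0) + t * norm w"
        using norm_triangle_ineq[of "x - x0" "t *\<^sub>R w"] t by (simp add: algebra_simps)
      then have "x + t *\<^sub>R w \<in> B" using t unfolding B_def r_def by (simp add: dist_norm norm_minus_commute)
      from below[OF this] have "t * (norm w)\<^sup>2 \<le> t * ((2 * C * t) * (norm w)\<^sup>2)"
        using t by (simp add: power_mult_distrib power2_eq_square[of t] dot_square_norm algebra_simps)
      then have "1 \<le> 2 * C * t" using t \<open>w \<noteq> 0\<close> by simp
      then show False using t(3) t(1) by (simp add: algebra_simps)
    qed
    then have qs: "q1 = - p - q2" "q2 = - p - q1"
      unfolding w_def by (metis add.assoc add.commute add_diff_cancel_left' diff_0 diff_diff_eq2 minus_diff_eq uminus_add_conv_diff)+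
    \<comment> \<open>The contact inequality turns a paraboloid below \<open>g\<close> into one
      above \<open>f\<close>, and symmetrically.\<close>
    have "semi_supergrad C B f x q1"
      unfolding semi_supergrad_def
    proof
      fix y assume y: "y \<in> B"
      then have "g x + q2 \<bullet> (y - x) - C * (norm (y - x))\<^sup>2 \<le> g y" using q2(2) unfolding semi_subgrad_def by blast
      with x(2)[OF y] show "f y \<le> f x + q1 \<bullet> (y - x) + C * (norm (y - x))\<^sup>2"
        unfolding qs(1) by (simp add: inner_simps)
    qed
    moreover have "semi_supergrad C B g x q2"
      unfolding semi_supergrad_def
    proof
      fix y assume y: "y \<in> B"
      then have "f x + q1 \<bullet> (y - x) - C * (norm (y - x))\<^sup>2 \<le> f y" using q1(2) unfolding semi_subgrad_def by blast
      with x(2)[OF y] show "g y \<le> g x + q2 \<bullet> (y - x) + C * (norm (y - x))\<^sup>2"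
        unfolding qs(2) by (simp add: inner_simps)
    qed
    ultimately have "G p x q1 q2"
      unfolding G_def using xin x(2) q1 q2 \<open>w = 0\<close> w_def by auto
    then show ?thesis by blast
  qed
  then obtain X Q1 Q2 where XQ: "\<And>p. p \<in> ball 0 \<delta>' \<Longrightarrow> G p (X p) (Q1 p) (Q2 p)" by metis
  \<comment> \<open>A tilt is minus the sum of two subgradients, each of which obeys the Lipschitz
    estimate at a contact point.\<close>
  have lip: "norm (p' - p) \<le> 12 * C * norm (X p' - X p)"
    if p: "p \<in> ball 0 \<delta>'" "p' \<in> ball 0 \<delta>'" "2 * norm (X p' - X p) < R - norm (X p - x0)" for p p'
  proof -
    note g = XQ[OF p(1), unfolded G_def] and g' = XQ[OF p(2), unfolded G_def]
    have sub: "ball (X p) (R - norm (X p - x0)) \<subseteq> B"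
    proof
      fix y assume "y \<in> ball (X p) (R - norm (X p - x0))"
      then show "y \<in> B" unfolding B_def
        using dist_triangle[of x0 y "X p"] by (simp add: dist_norm norm_minus_commute)
    qed
    have X'B: "X p' \<in> B" using g' unfolding B_def by auto
    have "norm (Q1 p' - Q1 p) \<le> 6 * C * norm (X p' - X p)"
      using g g' by (intro semi_subgrad_lipschitz_at_contact[OF \<open>C \<ge> 0\<close> _ _ _ X'B sub p(3)]) auto
    moreover have "norm (Q2 p' - Q2 p) \<le> 6 * C * norm (X p' - X p)"
      using g g' by (intro semi_subgrad_lipschitz_at_contact[OF \<open>C \<ge> 0\<close> _ _ _ X'B sub p(3)]) auto
    moreover have "norm (p' - p) = norm ((Q1 p' - Q1 p) + (Q2 p' - Q2 p))"
    proof -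
      have e: "p = - (Q1 p + Q2 p)" "p' = - (Q1 p' + Q2 p')"
        using g g' by (metis add_eq_0_iff)+
      have "p' - p = - (Q1 p' + Q2 p') - - (Q1 p + Q2 p)" by (rule arg_cong2[where f = minus, OF e(2) e(1)])
      then have "p' - p = - ((Q1 p' - Q1 p) + (Q2 p' - Q2 p))" by (simp add: algebra_simps)
      then show ?thesis by (metis norm_minus_cancel)
    qed
    ultimately show ?thesis
      using norm_triangle_ineq[of "Q1 p' - Q1 p" "Q2 p' - Q2 p"] by simp
  qed
  \<comment> \<open>\<open>Z\<close> controls the contact point and the contact point controls the
    tilt, so \<open>Z\<close> is injective on these tilts with a locally Lipschitz inverse; the
    inverse image of a null set is null.\<close>
  have neg: "negligible {p \<in> ball 0 \<delta>'. Z p \<in> N}"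
    if N: "negligible N" and Z: "\<And>p p'. p \<in> ball 0 \<delta>' \<Longrightarrow> p' \<in> ball 0 \<delta>' \<Longrightarrow> norm (X p' - X p) \<le> norm (Z p' - Z p)"
    for Z :: "'a \<Rightarrow> 'a" and N
  proof -
    define P where "P = {p \<in> ball 0 \<delta>'. Z p \<in> N}"
    define \<Phi> where "\<Phi> = inv_into P Z"
    have pos: "R - norm (X p - x0) > 0" if "p \<in> ball 0 \<delta>'" for p
      using XQ[OF that] unfolding G_def by (simp add: dist_norm norm_minus_commute)
    have inj: "inj_on Z P"
    proof (rule inj_onI)
      fix p p' assume pp: "p \<in> P" "p' \<in> P" "Z p = Z p'"
      have pB: "p \<in> ball 0 \<delta>'" "p' \<in> ball 0 \<delta>'" using pp unfolding P_def by blast+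
      have 0: "norm (X p' - X p) = 0"
        using Z[OF pB] pp(3) by (metis diff_self norm_le_zero_iff norm_zero)
      have "norm (p' - p) \<le> 12 * C * norm (X p' - X p)"
        by (rule lip[OF pB]) (use pos[OF pB(1)] in \<open>simp only: 0\<close>)
      then show "p = p'" unfolding 0 by simp
    qed
    have "negligible (\<Phi> ` (Z ` P))"
    proof (rule negligible_locally_Lipschitz_image)
      show "negligible (Z ` P)" using N by (rule negligible_subset) (auto simp: P_def)
      fix w assume "w \<in> Z ` P"
      then obtain p where p: "p \<in> P" "w = Z p" by blast
      define \<rho> where "\<rho> = (R - norm (X p - x0)) / 2"
      have \<rho>: "\<rho> > 0" unfolding \<rho>_def using pos[of p] p(1) P_def by auto
      show "\<exists>T B. open T \<and> w \<in> T \<and> (\<forall>y\<in>Z ` P \<inter> T. norm (\<Phi> y - \<Phi> w) \<le> B * norm (y - w))"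
      proof (intro exI[of _ "ball w \<rho>"] exI[of _ "12 * C"] conjI ballI)
        show "w \<in> ball w \<rho>" using \<rho> by simp
        fix y assume "y \<in> Z ` P \<inter> ball w \<rho>"
        then obtain p' where p': "p' \<in> P" "y = Z p'" "norm (Z p' - Z p) < \<rho>"
          using p by (auto simp: dist_norm norm_minus_commute)
        have X: "norm (X p' - X p) \<le> norm (Z p' - Z p)" using Z p p' P_def by auto
        then have "norm (p' - p) \<le> 12 * C * norm (X p' - X p)"
          using p p' unfolding P_def \<rho>_def by (intro lip) auto
        also have "\<dots> \<le> 12 * C * norm (Z p' - Z p)" using X \<open>C \<ge> 0\<close> by (intro mult_left_mono) auto
        finally show "norm (\<Phi> y - \<Phi> w) \<le> 12 * C * norm (y - w)"
          using p p' inj unfolding \<Phi>_def by simp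
      qed simp
    qed simp
    moreover have "\<Phi> ` (Z ` P) = P" unfolding \<Phi>_def using inj by (auto simp: image_image)
    ultimately show ?thesis unfolding P_def by simp
  qed
  have Xcontr: "norm (X p' - X p) \<le> norm (Q1 p' + (2 * C + 1) *\<^sub>R X p' - (Q1 p + (2 * C + 1) *\<^sub>R X p))"
    "norm (X p' - X p) \<le> norm (Q2 p' + (2 * C + 1) *\<^sub>R X p' - (Q2 p + (2 * C + 1) *\<^sub>R X p))"
    if "p \<in> ball 0 \<delta>'" "p' \<in> ball 0 \<delta>'" for p p'
    using XQ[OF that(1)] XQ[OF that(2)] unfolding G_def B_def
    by (auto intro!: semi_subgrad_contraction)
  have "negligible {p \<in> ball 0 \<delta>'. Q1 p + (2 * C + 1) *\<^sub>R X p \<in> Nf}"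
    using neg[OF Nf(1), of "\<lambda>p. Q1 p + (2 * C + 1) *\<^sub>R X p"] Xcontr(1) by simp
  moreover have "negligible {p \<in> ball 0 \<delta>'. Q2 p + (2 * C + 1) *\<^sub>R X p \<in> Ng}"
    using neg[OF Ng(1), of "\<lambda>p. Q2 p + (2 * C + 1) *\<^sub>R X p"] Xcontr(2) by simp
  ultimately have "negligible ({p \<in> ball 0 \<delta>'. Q1 p + (2 * C + 1) *\<^sub>R X p \<in> Nf} \<union> {p \<in> ball 0 \<delta>'. Q2 p + (2 * C + 1) *\<^sub>R X p \<in> Ng})"
    by (rule negligible_Un)
  moreover have "\<not> negligible (ball (0::'a) \<delta>')"
    using \<delta>' by (intro open_not_negligible) auto
  ultimately obtain p where p: "p \<in> ball 0 \<delta>'" "Q1 p + (2 * C + 1) *\<^sub>R X p \<notin> Nf" "Q2 p + (2 * C + 1) *\<^sub>R X p \<notin> Ng"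
    using negligible_subset by blast
  note g = XQ[OF p(1), unfolded G_def]
  have int: "X p \<in> interior B" using g unfolding B_def by simp
  obtain A1 where A1: "second_order_at f (X p) (Q1 p) A1" using Nf(2) int p(2) g by blast
  obtain A2 where A2: "second_order_at g (X p) (Q2 p) A2" using Ng(2) int p(3) g by blast
  show thesis
    by (rule that[of "X p" p "Q1 p" "Q2 p" A1 A2]) (use g A1 A2 p(1) \<delta>' in \<open>auto simp: B_def\<close>)
qed

section \<open>Polynomial maps\<close>

definition polymap :: "('a::euclidean_space \<Rightarrow> 'b::euclidean_space) \<Rightarrow> bool" where
  "polymap F \<longleftrightarrow> (\<forall>b\<in>Basis. (\<lambda>x. F x \<bullet> b) \<in> polyfun)"

lemma polyfun_cmult: "f \<in> polyfun \<Longrightarrow> (\<lambda>x. c * f x) \<in> polyfun"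
  by (rule pf_mult[OF pf_const])

lemma polyfun_uminus: "f \<in> polyfun \<Longrightarrow> (\<lambda>x. - f x) \<in> polyfun"
  using polyfun_cmult[of f "- 1"] by simp

lemma polyfun_diff: "f \<in> polyfun \<Longrightarrow> g \<in> polyfun \<Longrightarrow> (\<lambda>x. f x - g x) \<in> polyfun"
  using pf_add[OF _ polyfun_uminus, of f g] by simp

lemma polyfun_sum: "(\<And>i. i \<in> I \<Longrightarrow> f i \<in> polyfun) \<Longrightarrow> (\<lambda>x. \<Sum>i\<in>I. f i x) \<in> polyfun"
  by (induction I rule: infinite_finite_induct) (auto intro: pf_const pf_add)

lemma polyfun_power: "f \<in> polyfun \<Longrightarrow> (\<lambda>x. f x ^ n) \<in> polyfun"
  by (induction n) (auto intro: pf_const pf_mult)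

lemma polyfun_linear:
  assumes "linear f" shows "f \<in> polyfun"
proof -
  have "f x = (\<Sum>b\<in>Basis. f b * (x \<bullet> b))" for x
  proof -
    have "f x = f (\<Sum>b\<in>Basis. (x \<bullet> b) *\<^sub>R b)" by (simp add: euclidean_representation)
    also have "\<dots> = (\<Sum>b\<in>Basis. f b * (x \<bullet> b))"
      by (simp add: linear_sum[OF assms] linear_scale[OF assms] mult.commute)
    finally show ?thesis .
  qed
  then have "f = (\<lambda>x. \<Sum>b\<in>Basis. f b * (x \<bullet> b))" by blast
  moreover have "(\<lambda>x. \<Sum>b\<in>Basis. f b * (x \<bullet> b)) \<in> polyfun"
    by (intro polyfun_sum polyfun_cmult pf_coord)
  ultimately show ?thesis by simp
qed

lemma polymap_linear: "linear F \<Longrightarrow> polymap F"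
  unfolding polymap_def using linear_compose[OF _ bounded_linear.linear[OF bounded_linear_inner_left], of F]
  by (auto simp: o_def intro!: polyfun_linear)

lemma polyfun_compose:
  assumes "P \<in> polyfun" "polymap F"
  shows "(\<lambda>x. P (F x)) \<in> polyfun"
  using assms(1)
  by induction (use assms(2) in \<open>auto simp: polymap_def intro: pf_const pf_add pf_mult\<close>)

lemma polymap_compose: "polymap F \<Longrightarrow> polymap G \<Longrightarrow> polymap (\<lambda>x. F (G x))"
  unfolding polymap_def[of F] polymap_def[of "\<lambda>x. F (G x)"] by (auto intro: polyfun_compose)

lemma polymap_const: "polymap (\<lambda>x. c)"
  unfolding polymap_def by (auto intro: pf_const)

lemma polymap_ident: "polymap (\<lambda>x. x)"
  unfolding polymap_def by (auto intro: pf_coord)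

lemma polymap_add: "polymap F \<Longrightarrow> polymap G \<Longrightarrow> polymap (\<lambda>x. F x + G x)"
  unfolding polymap_def by (auto simp: inner_add_left intro: pf_add)

lemma polymap_scaleR: "s \<in> polyfun \<Longrightarrow> polymap G \<Longrightarrow> polymap (\<lambda>x. s x *\<^sub>R G x)"
  unfolding polymap_def by (auto intro: pf_mult)

lemma polymap_uminus: "polymap G \<Longrightarrow> polymap (\<lambda>x. - G x)"
  unfolding polymap_def by (auto intro: polyfun_uminus)

lemma polymap_diff: "polymap F \<Longrightarrow> polymap G \<Longrightarrow> polymap (\<lambda>x. F x - G x)"
  unfolding polymap_def by (auto simp: inner_diff_left intro: polyfun_diff)

lemma polymap_Pair: "polymap F \<Longrightarrow> polymap G \<Longrightarrow> polymap (\<lambda>x. (F x, G x))"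
  unfolding polymap_def Basis_prod_def by auto

lemma polymap_fst: "polymap fst"
  by (intro polymap_linear bounded_linear.linear bounded_linear_fst)

lemma polymap_snd: "polymap snd"
  by (intro polymap_linear bounded_linear.linear bounded_linear_snd)

lemma polymap_real: "polymap (f :: 'a::euclidean_space \<Rightarrow> real) \<longleftrightarrow> f \<in> polyfun"
  unfolding polymap_def by auto

lemma polyfun_inner:
  assumes "polymap F" "polymap G" shows "(\<lambda>x. F x \<bullet> G x) \<in> polyfun"
proof -
  have "(\<lambda>x. \<Sum>b\<in>Basis. (F x \<bullet> b) * (G x \<bullet> b)) \<in> polyfun"
    using assms unfolding polymap_def by (intro polyfun_sum pf_mult) auto
  then show ?thesis by (simp add: euclidean_inner[symmetric])
qed

lemma polyfun_norm_power2: "polymap F \<Longrightarrow> (\<lambda>x. (norm (F x))\<^sup>2) \<in> polyfun"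
  unfolding power2_norm_eq_inner by (rule polyfun_inner)

lemma polyfun_continuous_on: "f \<in> polyfun \<Longrightarrow> continuous_on S f"
  by (induction rule: polyfun.induct) (auto intro!: continuous_intros)

lemma polymap_continuous_on: "polymap F \<Longrightarrow> continuous_on S F"
  unfolding polymap_def using continuous_on_componentwise[of S F] polyfun_continuous_on by blast

lemma polymap_bounded_on:
  assumes "polymap F" "bounded K"
  obtains M where "\<And>x. x \<in> K \<Longrightarrow> norm (F x) \<le> M" "M \<ge> 0"
proof -
  have "compact (F ` closure K)"
    using assms by (intro compact_continuous_image polymap_continuous_on) auto
  then obtain M where M: "\<forall>y\<in>F ` closure K. norm y \<le> M"
    using compact_imp_bounded bounded_iff by blast
  show thesis
    by (rule that[of "max M 0"]) (use M closure_subset[of K] in \<open>auto simp: le_max_iff_disj\<close>)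
qed

text \<open>Gradients are again polynomial, which permits iteration. The Taylor bound on bounded
  sets stands in for a Hessian bound and later supplies the semiconvexity constants. It passes to
  products because the cross term (f y - f x) (g y - g x) is quadratic in y - x.\<close>

lemma polyfun_gradient:
  assumes "P \<in> polyfun"
  obtains g where "polymap g" "\<And>x. (P has_derivative (\<lambda>h. g x \<bullet> h)) (at x)"
    "\<And>K. bounded K \<Longrightarrow> \<exists>C\<ge>0. \<forall>x\<in>K. \<forall>y\<in>K. \<bar>P y - P x - g x \<bullet> (y - x)\<bar> \<le> C * (norm (y - x))\<^sup>2"
proof -
  have "\<exists>g. polymap g \<and> (\<forall>x. (P has_derivative (\<lambda>h. g x \<bullet> h)) (at x)) \<and>
    (\<forall>K. bounded K \<longrightarrow> (\<exists>C\<ge>0. \<forall>x\<in>K. \<forall>y\<in>K. \<bar>P y - P x - g x \<bullet> (y - x)\<bar> \<le> C * (norm (y - x))\<^sup>2))"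
    using assms
  proof induction
    case (pf_const c)
    show ?case
      by (rule exI[of _ "\<lambda>_. 0"]) (auto simp: polymap_const intro!: derivative_eq_intros exI[of _ 0])
  next
    case (pf_coord b)
    show ?case
      by (rule exI[of _ "\<lambda>_. b"])
        (auto simp: polymap_const inner_diff_right inner_commute intro!: derivative_eq_intros exI[of _ 0])
  next
    case (pf_add f g)
    then obtain df dg where *: "polymap df" "\<And>x. (f has_derivative (\<lambda>h. df x \<bullet> h)) (at x)"
      "\<And>K. bounded K \<Longrightarrow> \<exists>C\<ge>0. \<forall>x\<in>K. \<forall>y\<in>K. \<bar>f y - f x - df x \<bullet> (y - x)\<bar> \<le> C * (norm (y - x))\<^sup>2"
      "polymap dg" "\<And>x. (g has_derivative (\<lambda>h. dg x \<bullet> h)) (at x)"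
      "\<And>K. bounded K \<Longrightarrow> \<exists>C\<ge>0. \<forall>x\<in>K. \<forall>y\<in>K. \<bar>g y - g x - dg x \<bullet> (y - x)\<bar> \<le> C * (norm (y - x))\<^sup>2"
      by metis
    show ?case
    proof (intro exI[of _ "\<lambda>x. df x + dg x"] conjI allI impI)
      show "polymap (\<lambda>x. df x + dg x)" using * by (intro polymap_add)
      show "((\<lambda>z. f z + g z) has_derivative (\<lambda>h. (df x + dg x) \<bullet> h)) (at x)" for x
        using has_derivative_add[OF *(2)[of x] *(5)[of x]] by (simp add: inner_add_left)
      fix K :: "'a set" assume K: "bounded K"
      obtain C where C: "C \<ge> 0" "\<And>x y. x \<in> K \<Longrightarrow> y \<in> K \<Longrightarrow> \<bar>f y - f x - df x \<bullet> (y - x)\<bar> \<le> C * (norm (y - x))\<^sup>2"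
        using *(3)[OF K] by blast
      obtain C' where C': "C' \<ge> 0" "\<And>x y. x \<in> K \<Longrightarrow> y \<in> K \<Longrightarrow> \<bar>g y - g x - dg x \<bullet> (y - x)\<bar> \<le> C' * (norm (y - x))\<^sup>2"
        using *(6)[OF K] by blast
      show "\<exists>C\<ge>0. \<forall>x\<in>K. \<forall>y\<in>K. \<bar>f y + g y - (f x + g x) - (df x + dg x) \<bullet> (y - x)\<bar> \<le> C * (norm (y - x))\<^sup>2"
      proof (intro exI[of _ "C + C'"] conjI ballI)
        fix x y assume "x \<in> K" "y \<in> K"
        then show "\<bar>f y + g y - (f x + g x) - (df x + dg x) \<bullet> (y - x)\<bar> \<le> (C + C') * (norm (y - x))\<^sup>2"
          using C(2)[of x y] C'(2)[of x y] unfolding inner_add_left distrib_right by linarith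
      qed (use C C' in simp)
    qed
  next
    case (pf_mult f g)
    then obtain df dg where *: "polymap df" "\<And>x. (f has_derivative (\<lambda>h. df x \<bullet> h)) (at x)"
      "\<And>K. bounded K \<Longrightarrow> \<exists>C\<ge>0. \<forall>x\<in>K. \<forall>y\<in>K. \<bar>f y - f x - df x \<bullet> (y - x)\<bar> \<le> C * (norm (y - x))\<^sup>2"
      "polymap dg" "\<And>x. (g has_derivative (\<lambda>h. dg x \<bullet> h)) (at x)"
      "\<And>K. bounded K \<Longrightarrow> \<exists>C\<ge>0. \<forall>x\<in>K. \<forall>y\<in>K. \<bar>g y - g x - dg x \<bullet> (y - x)\<bar> \<le> C * (norm (y - x))\<^sup>2"
      by metis
    note fg = pf_mult.hyps
    show ?case
    proof (intro exI[of _ "\<lambda>x. g x *\<^sub>R df x + f x *\<^sub>R dg x"] conjI allI impI)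
      show "polymap (\<lambda>x. g x *\<^sub>R df x + f x *\<^sub>R dg x)" using * fg by (intro polymap_add polymap_scaleR)
      show "((\<lambda>z. f z * g z) has_derivative (\<lambda>h. (g x *\<^sub>R df x + f x *\<^sub>R dg x) \<bullet> h)) (at x)" for x
        using has_derivative_mult[OF *(2)[of x] *(5)[of x]] by (simp add: inner_add_left algebra_simps)
      fix K :: "'a set" assume K: "bounded K"
      obtain C where C: "C \<ge> 0" "\<And>x y. x \<in> K \<Longrightarrow> y \<in> K \<Longrightarrow> \<bar>f y - f x - df x \<bullet> (y - x)\<bar> \<le> C * (norm (y - x))\<^sup>2"
        using *(3)[OF K] by blast
      obtain C' where C': "C' \<ge> 0" "\<And>x y. x \<in> K \<Longrightarrow> y \<in> K \<Longrightarrow> \<bar>g y - g x - dg x \<bullet> (y - x)\<bar> \<le> C' * (norm (y - x))\<^sup>2"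
        using *(6)[OF K] by blast
      obtain Mf where Mf: "\<And>x. x \<in> K \<Longrightarrow> \<bar>f x\<bar> \<le> Mf" "Mf \<ge> 0"
        using polymap_bounded_on[OF fg(1)[folded polymap_real] K] by auto
      obtain Mg where Mg: "\<And>x. x \<in> K \<Longrightarrow> \<bar>g x\<bar> \<le> Mg" "Mg \<ge> 0"
        using polymap_bounded_on[OF fg(2)[folded polymap_real] K] by auto
      obtain Nf where Nf: "\<And>x. x \<in> K \<Longrightarrow> norm (df x) \<le> Nf" "Nf \<ge> 0"
        using polymap_bounded_on[OF *(1) K] by auto
      obtain Ng where Ng: "\<And>x. x \<in> K \<Longrightarrow> norm (dg x) \<le> Ng" "Ng \<ge> 0"
        using polymap_bounded_on[OF *(4) K] by auto
      obtain d where d: "\<And>x y. x \<in> K \<Longrightarrow> y \<in> K \<Longrightarrow> norm (y - x) \<le> d"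
        using K unfolding bounded_two_points dist_norm by (metis norm_minus_commute)
      define E where "E = (Nf + C * \<bar>d\<bar>) * (Ng + C' * \<bar>d\<bar>)"
      have lin: "\<bar>k y - k x\<bar> \<le> (N + B * \<bar>d\<bar>) * norm (y - x)"
        if "\<bar>k y - k x - dk x \<bullet> (y - x)\<bar> \<le> B * (norm (y - x))\<^sup>2" "norm (dk x) \<le> N" "x \<in> K" "y \<in> K" "B \<ge> 0"
        for k :: "'a \<Rightarrow> real" and dk x y N B
      proof -
        have "\<bar>dk x \<bullet> (y - x)\<bar> \<le> N * norm (y - x)"
          by (rule order_trans[OF Cauchy_Schwarz_ineq2]) (use that in \<open>simp add: mult_right_mono\<close>)
        moreover have "B * (norm (y - x))\<^sup>2 \<le> B * (\<bar>d\<bar> * norm (y - x))"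
          unfolding power2_eq_square using d[OF that(3,4)] that(5) by (intro mult_left_mono mult_right_mono) auto
        ultimately show ?thesis using that(1) unfolding distrib_right by (simp add: mult.assoc; linarith)
      qed
      show "\<exists>C\<ge>0. \<forall>x\<in>K. \<forall>y\<in>K. \<bar>f y * g y - f x * g x - (g x *\<^sub>R df x + f x *\<^sub>R dg x) \<bullet> (y - x)\<bar> \<le> C * (norm (y - x))\<^sup>2"
      proof (intro exI[of _ "Mg * C + Mf * C' + E"] conjI ballI)
        show "Mg * C + Mf * C' + E \<ge> 0" unfolding E_def using C C' Mf Mg Nf Ng by simp
        fix x y assume xy: "x \<in> K" "y \<in> K"
        have "f y * g y - f x * g x - (g x *\<^sub>R df x + f x *\<^sub>R dg x) \<bullet> (y - x)
          = g x * (f y - f x - df x \<bullet> (y - x)) + f x * (g y - g x - dg x \<bullet> (y - x)) + (f y - f x) * (g y - g x)"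
          by (simp add: inner_add_left algebra_simps)
        moreover have "\<bar>g x * (f y - f x - df x \<bullet> (y - x))\<bar> \<le> Mg * (C * (norm (y - x))\<^sup>2)"
          unfolding abs_mult using Mg xy C(2)[OF xy] by (intro mult_mono) auto
        moreover have "\<bar>f x * (g y - g x - dg x \<bullet> (y - x))\<bar> \<le> Mf * (C' * (norm (y - x))\<^sup>2)"
          unfolding abs_mult using Mf xy C'(2)[OF xy] by (intro mult_mono) auto
        moreover have "\<bar>(f y - f x) * (g y - g x)\<bar> \<le> ((Nf + C * \<bar>d\<bar>) * norm (y - x)) * ((Ng + C' * \<bar>d\<bar>) * norm (y - x))"
          unfolding abs_mult
          using lin[of f y x df C Nf] lin[of g y x dg C' Ng] xy C(1) C(2)[OF xy] C'(1) C'(2)[OF xy] Nf Ng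
          by (intro mult_mono) auto
        moreover have "\<dots> = E * (norm (y - x))\<^sup>2" unfolding E_def by (simp add: power2_eq_square)
        ultimately show "\<bar>f y * g y - f x * g x - (g x *\<^sub>R df x + f x *\<^sub>R dg x) \<bullet> (y - x)\<bar>
            \<le> (Mg * C + Mf * C' + E) * (norm (y - x))\<^sup>2"
          unfolding distrib_right by (simp add: mult.assoc; linarith)
      qed
    qed
  qed
  then show thesis using that by (elim exE conjE) simp
qed

lemma polymap_derivative:
  assumes "polymap F"
  shows "(F has_derivative frechet_derivative F (at x)) (at x)"
    and "polymap (\<lambda>x. frechet_derivative F (at x) h)"
proof -
  have "\<exists>g. polymap g \<and> (\<forall>x. ((\<lambda>x. F x \<bullet> b) has_derivative (\<lambda>h. g x \<bullet> h)) (at x))" if "b \<in> Basis" for b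
    using polyfun_gradient[of "\<lambda>x. F x \<bullet> b"] assms that unfolding polymap_def by metis
  then obtain g where g: "\<And>b. b \<in> Basis \<Longrightarrow> polymap (g b)"
    "\<And>b x. b \<in> Basis \<Longrightarrow> ((\<lambda>x. F x \<bullet> b) has_derivative (\<lambda>h. g b x \<bullet> h)) (at x)"
    by metis
  define D where "D x h = (\<Sum>b\<in>Basis. (g b x \<bullet> h) *\<^sub>R b)" for x h
  have D: "(F has_derivative D x) (at x)" for x
  proof -
    have "((\<lambda>x. \<Sum>b\<in>Basis. (F x \<bullet> b) *\<^sub>R b) has_derivative D x) (at x)"
      unfolding D_def using g(2) by (intro has_derivative_sum has_derivative_scaleR_left) auto
    then show ?thesis by (simp add: euclidean_representation)
  qed
  then have eq: "frechet_derivative F (at x) = D x" for x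
    using frechet_derivative_at by metis
  show "(F has_derivative frechet_derivative F (at x)) (at x)" unfolding eq by (rule D)
  have "(\<lambda>x. D x h \<bullet> b) = (\<lambda>x. g b x \<bullet> h)" if "b \<in> Basis" for b
    unfolding D_def using that by (simp add: inner_sum_left_Basis)
  moreover have "(\<lambda>x. g b x \<bullet> h) \<in> polyfun" if "b \<in> Basis" for b
    using g(1)[OF that] by (intro polyfun_inner polymap_const)
  ultimately show "polymap (\<lambda>x. frechet_derivative F (at x) h)"
    unfolding eq polymap_def by simp
qed

lemma polyfun_C2_on:
  assumes "P \<in> polyfun" shows "C2_on S P"
proof -
  obtain g where g: "polymap g" "\<And>x. (P has_derivative (\<lambda>h. g x \<bullet> h)) (at x)"
    using polyfun_gradient[OF assms] by metis
  show ?thesis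
    unfolding C2_on_def
    using g polymap_derivative[OF g(1)]
    by (intro exI[of _ g] exI[of _ "\<lambda>x. frechet_derivative g (at x)"]) (auto intro: polymap_continuous_on)
qed

lemma polyfun_real_poly:
  assumes "f \<in> polyfun" obtains p where "\<And>t::real. f t = poly p t"
proof -
  have "\<exists>p. \<forall>t. f t = poly p t"
    using assms
  proof induction
    case (pf_const c)
    show ?case by (rule exI[of _ "[:c:]"]) simp
  next
    case (pf_coord b)
    then show ?case by (intro exI[of _ "[:0, 1:]"]) simp
  next
    case (pf_add f g)
    then show ?case by (metis poly_add)
  next
    case (pf_mult f g)
    then show ?case by (metis poly_mult)
  qed
  then show thesis using that by blast
qed

section \<open>Horizontal derivatives on a Carnot group\<close>

lemma second_order_at_add:
  assumes "second_order_at f x p A" "second_order_at g x q B"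
  shows "second_order_at (\<lambda>y. f y + g y) x (p + q) (\<lambda>h. A h + B h)"
  unfolding second_order_at_def
proof (intro conjI allI impI)
  show "linear (\<lambda>h. A h + B h)" using assms unfolding second_order_at_def by (intro linear_compose_add) auto
  fix e :: real assume "e > 0"
  then have "e / 2 > 0" by simp
  then obtain d1 where d1: "d1 > 0"
    "\<And>y. norm (y - x) < d1 \<Longrightarrow> \<bar>f y - f x - p \<bullet> (y - x) - A (y - x) \<bullet> (y - x) / 2\<bar> \<le> e / 2 * (norm (y - x))\<^sup>2"
    using assms(1) unfolding second_order_at_def by meson
  from \<open>e / 2 > 0\<close> obtain d2 where d2: "d2 > 0"
    "\<And>y. norm (y - x) < d2 \<Longrightarrow> \<bar>g y - g x - q \<bullet> (y - x) - B (y - x) \<bullet> (y - x) / 2\<bar> \<le> e / 2 * (norm (y - x))\<^sup>2"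
    using assms(2) unfolding second_order_at_def by meson
  show "\<exists>d>0. \<forall>y. norm (y - x) < d \<longrightarrow> \<bar>f y + g y - (f x + g x) - (p + q) \<bullet> (y - x)
      - (A (y - x) + B (y - x)) \<bullet> (y - x) / 2\<bar> \<le> e * (norm (y - x))\<^sup>2"
  proof (intro exI[of _ "min d1 d2"] conjI allI impI)
    fix y assume "norm (y - x) < min d1 d2"
    then show "\<bar>f y + g y - (f x + g x) - (p + q) \<bullet> (y - x) - (A (y - x) + B (y - x)) \<bullet> (y - x) / 2\<bar> \<le> e * (norm (y - x))\<^sup>2"
      using d1(2)[of y] d2(2)[of y] unfolding inner_add_left add_divide_distrib by (simp; linarith)
  qed (use d1 d2 in simp)
qed

lemma second_order_at_uminus:
  assumes "second_order_at f x p A"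
  shows "second_order_at (\<lambda>y. - f y) x (- p) (\<lambda>h. - A h)"
proof -
  have "\<bar>- f y - - f x - - p \<bullet> (y - x) - - A (y - x) \<bullet> (y - x) / 2\<bar>
      = \<bar>f y - f x - p \<bullet> (y - x) - A (y - x) \<bullet> (y - x) / 2\<bar>" for y
    unfolding inner_minus_left by linarith
  then show ?thesis
    using assms unfolding second_order_at_def by (simp add: linear_compose_neg)
qed

text \<open>On y = x + t h the first order parts agree; dividing by t^2 compares the quadratic
  ones.\<close>

lemma second_order_at_le:
  assumes so: "second_order_at f x q A" and "\<rho> > 0"
    and le: "\<And>y. norm (y - x) < \<rho> \<Longrightarrow> f y \<le> f x + q \<bullet> (y - x) + C * (norm (y - x))\<^sup>2"
  shows "A h \<bullet> h \<le> 2 * C * (norm h)\<^sup>2"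
proof (cases "h = 0")
  case True
  then show ?thesis by simp
next
  case False
  have linA: "linear A" using so unfolding second_order_at_def by blast
  have "A h \<bullet> h / 2 \<le> C * (norm h)\<^sup>2 + e" if "e > 0" for e
  proof -
    have "e / (norm h)\<^sup>2 > 0" using that False by simp
    then obtain d where d: "d > 0"
      "\<And>y. norm (y - x) < d \<Longrightarrow> \<bar>f y - f x - q \<bullet> (y - x) - A (y - x) \<bullet> (y - x) / 2\<bar> \<le> e / (norm h)\<^sup>2 * (norm (y - x))\<^sup>2"
      using so unfolding second_order_at_def by meson
    define t where "t = min (d / 2) (\<rho> / 2) / norm h"
    have th: "t * norm h = min (d / 2) (\<rho> / 2)" unfolding t_def using False by simp
    have t: "t > 0" unfolding t_def using d \<open>\<rho> > 0\<close> False by simp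
    define y where "y = x + t *\<^sub>R h"
    have yx: "y - x = t *\<^sub>R h" unfolding y_def by simp
    have ny: "norm (y - x) < d" "norm (y - x) < \<rho>" using th t d \<open>\<rho> > 0\<close> by (auto simp: yx)
    have "t\<^sup>2 * (A h \<bullet> h / 2) = A (y - x) \<bullet> (y - x) / 2"
      unfolding yx linear_scale[OF linA] by (simp add: power2_eq_square)
    also have "\<dots> \<le> C * (norm (y - x))\<^sup>2 + e / (norm h)\<^sup>2 * (norm (y - x))\<^sup>2"
      using d(2)[OF ny(1)] le[OF ny(2)] by linarith
    also have "\<dots> = t\<^sup>2 * (C * (norm h)\<^sup>2 + e)"
      using False unfolding yx by (simp add: power_mult_distrib field_simps)
    finally show ?thesis using t by simp
  qed
  then have "A h \<bullet> h / 2 \<le> C * (norm h)\<^sup>2" by (rule field_le_epsilon)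
  then show ?thesis by simp
qed

lemma norm_matrix_vector_mult_le:
  fixes M :: "real^'n^'m::finite" shows "norm (M *v \<xi>) \<le> norm M * norm \<xi>"
proof -
  have "norm (M *v \<xi>) \<le> L2_set (\<lambda>i. norm (M $ i) * norm \<xi>) UNIV"
    unfolding norm_vec_def[of "M *v \<xi>"]
  proof (rule L2_set_mono)
    fix i
    have "(M *v \<xi>) $ i = M $ i \<bullet> \<xi>"
      by (simp add: matrix_vector_mult_def inner_vec_def)
    then show "norm ((M *v \<xi>) $ i) \<le> norm (M $ i) * norm \<xi>"
      using Cauchy_Schwarz_ineq2[of "M $ i" \<xi>] by simp
  qed simp
  also have "\<dots> = norm M * norm \<xi>" unfolding norm_vec_def[of M] by (simp add: L2_set_left_distrib)
  finally show ?thesis .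
qed

lemma abs_matrix_form_le:
  fixes M :: "real^'n::finite^'n" shows "\<bar>\<xi> \<bullet> (M *v \<xi>)\<bar> \<le> norm M * (norm \<xi>)\<^sup>2"
proof -
  have "\<bar>\<xi> \<bullet> (M *v \<xi>)\<bar> \<le> norm \<xi> * (norm M * norm \<xi>)"
    by (rule order_trans[OF Cauchy_Schwarz_ineq2]) (intro mult_left_mono norm_matrix_vector_mult_le norm_ge_zero)
  then show ?thesis by (simp add: power2_eq_square ac_simps)
qed

text \<open>Polarisation: for symmetric \<open>M\<close>, four times an entry is the difference of
  the form at e_i + e_j and at e_i - e_j, whose squared norms add up to 4. The estimates below are
  obtained for forms and have to be returned to matrices.\<close>

lemma norm_symmat_le:
  fixes M :: "real^'n::finite^'n" and K :: real
  assumes "M \<in> symmats" and b: "\<And>\<xi>. \<bar>\<xi> \<bullet> (M *v \<xi>)\<bar> \<le> K * (norm \<xi>)\<^sup>2"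
  shows "norm M \<le> real CARD('n) * real CARD('n) * K"
proof -
  have "\<bar>M $ i $ j\<bar> \<le> K" for i j
  proof -
    let ?p = "axis i 1 + axis j 1 :: real^'n" and ?m = "axis i 1 - axis j 1 :: real^'n"
    have e: "axis k 1 \<bullet> (M *v axis l 1) = M $ k $ l" for k l
      by (simp add: matrix_vector_mul_component inner_axis inner_commute[of _ "axis _ _"] inner_axis')
    have "M $ j $ i = M $ i $ j" using assms(1) unfolding symmats_def transpose_def by (metis (mono_tags, lifting) mem_Collect_eq vec_lambda_beta)
    then have "4 * M $ i $ j = ?p \<bullet> (M *v ?p) - ?m \<bullet> (M *v ?m)"
      by (simp add: matrix_vector_right_distrib matrix_vector_mult_diff_distrib inner_add_left inner_add_right inner_diff_left inner_diff_right e)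
    then have "4 * \<bar>M $ i $ j\<bar> \<le> K * (norm ?p)\<^sup>2 + K * (norm ?m)\<^sup>2"
      using b[of ?p] b[of ?m] by linarith
    also have "\<dots> = K * ((norm ?p)\<^sup>2 + (norm ?m)\<^sup>2)" by (simp add: distrib_left)
    also have "(norm ?p)\<^sup>2 + (norm ?m)\<^sup>2 = 4"
      by (simp add: power2_norm_eq_inner inner_add_left inner_add_right inner_diff_left inner_diff_right inner_axis_axis inner_commute)
    finally show ?thesis by simp
  qed
  then have "norm (M $ i) \<le> CARD('n) * K" for i
    using order_trans[OF norm_le_l1_cart sum_bounded_above[of UNIV "\<lambda>j. \<bar>M $ i $ j\<bar>" K]] by simp
  then have "(\<Sum>i\<in>UNIV. norm (M $ i)) \<le> CARD('n) * (CARD('n) * K)"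
    using sum_bounded_above[of UNIV "\<lambda>i. norm (M $ i)" "CARD('n) * K"] by simp
  moreover have "norm M \<le> (\<Sum>i\<in>UNIV. norm (M $ i))"
    unfolding norm_vec_def by (rule L2_set_le_sum) simp
  ultimately show ?thesis by simp
qed

text \<open>Pairing \<open>hgrad\<close> and \<open>hhess\<close> with \<xi> amounts to
  differentiating along this one left-invariant direction, so vector and matrix statements reduce to
  single curves.\<close>

definition horizontal_vec :: "('m::finite \<Rightarrow> 'a::euclidean_space) \<Rightarrow> real^'m \<Rightarrow> 'a" where
  "horizontal_vec X \<xi> = (\<Sum>i\<in>UNIV. \<xi> $ i *\<^sub>R X i)"

section \<open>The polynomial group law and derivatives along left-invariant fields\<close>

locale carnot =
  fixes gm br :: "'a::euclidean_space \<Rightarrow> 'a \<Rightarrow> 'a" and V r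
  assumes G: "carnot_group gm br V r"
begin

lemma gm_assoc: "gm (gm x y) z = gm x (gm y z)"
  using G unfolding carnot_group_def by blast

lemma gm_same_line: "gm (s *\<^sub>R x) (t *\<^sub>R x) = (s + t) *\<^sub>R x"
  using G unfolding carnot_group_def by blast

lemma gm_zero [simp]: "gm x 0 = x" "gm 0 x = x"
  using gm_same_line[of 1 x 0] gm_same_line[of 0 x 1] by auto

lemma gm_inverse [simp]: "gm x (- x) = 0" "gm (- x) x = 0"
  using gm_same_line[of 1 x "- 1"] gm_same_line[of "- 1" x 1] by auto

lemma gm_cancel [simp]: "gm x (gm (- x) y) = y" "gm (- x) (gm x y) = y"
  by (simp_all flip: gm_assoc)

lemma polymap_gm_pair: "polymap (\<lambda>z. gm (fst z) (snd z))"
  using G unfolding carnot_group_def polymap_def by blast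

lemma polymap_gm: "polymap F \<Longrightarrow> polymap H \<Longrightarrow> polymap (\<lambda>x. gm (F x) (H x))"
  using polymap_compose[OF polymap_gm_pair polymap_Pair, of F H] by simp

definition Dgm :: "'a \<Rightarrow> 'a \<Rightarrow> 'a \<times> 'a \<Rightarrow> 'a" where
  "Dgm x y = frechet_derivative (\<lambda>z. gm (fst z) (snd z)) (at (x, y))"

lemma Dgm: "((\<lambda>z. gm (fst z) (snd z)) has_derivative Dgm x y) (at (x, y))"
  unfolding Dgm_def by (rule polymap_derivative[OF polymap_gm_pair])

lemma linear_Dgm: "linear (Dgm x y)"
  using Dgm by (rule has_derivative_linear)

lemma polymap_Dgm: "polymap F \<Longrightarrow> polymap H \<Longrightarrow> polymap (\<lambda>x. Dgm (F x) (H x) w)"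
  using polymap_compose[OF polymap_derivative(2)[OF polymap_gm_pair, of w] polymap_Pair, of F H]
  unfolding Dgm_def by simp

lemma has_derivative_gm:
  assumes "(f has_derivative f') (at x)" "(g has_derivative g') (at x)"
  shows "((\<lambda>x. gm (f x) (g x)) has_derivative (\<lambda>h. Dgm (f x) (g x) (f' h, g' h))) (at x)"
  using diff_chain_at[OF has_derivative_Pair[OF assms] Dgm] by (simp add: o_def)

text \<open>The differential at the identity of left translation by \<open>x\<close>; thus
  \<open>L x v\<close> is the value at \<open>x\<close> of the left-invariant field of
  \<open>v\<close>.\<close>

definition L :: "'a \<Rightarrow> 'a \<Rightarrow> 'a" where "L x v = Dgm x 0 (0, v)"

lemma linear_L: "linear (L x)"
  unfolding L_def
  using linear_compose[of "\<lambda>v. (0::'a, v)" "Dgm x 0"] linear_Dgm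
  by (simp add: o_def linear_iff)

lemma polymap_L: "polymap (\<lambda>x. L x v)"
  unfolding L_def by (intro polymap_Dgm polymap_ident polymap_const)

lemma has_derivative_gm_right: "((\<lambda>y. gm x y) has_derivative L x) (at 0)"
  using has_derivative_gm[OF has_derivative_const[of x] has_derivative_ident, of 0]
  unfolding L_def by simp

lemma Xfield_eq:
  assumes "\<phi> \<in> polyfun"
  shows "Xfield gm v \<phi> x = frechet_derivative \<phi> (at x) (L x v)"
proof -
  have D: "(\<phi> has_derivative frechet_derivative \<phi> (at x)) (at x)"
    using polymap_derivative(1)[of \<phi> x] assms by (simp add: polymap_real)
  have "((\<lambda>t. t *\<^sub>R v) has_derivative (\<lambda>t. t *\<^sub>R v)) (at 0)"
    by (auto intro!: derivative_eq_intros)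
  from diff_chain_at[OF this, of "\<lambda>y. gm x y" "L x"] has_derivative_gm_right[of x]
  have "((\<lambda>t. gm x (t *\<^sub>R v)) has_derivative (\<lambda>t. L x (t *\<^sub>R v))) (at 0)" by (simp add: o_def)
  from diff_chain_at[OF this, of \<phi>] D
  have "((\<lambda>t. \<phi> (gm x (t *\<^sub>R v))) has_derivative (\<lambda>t. frechet_derivative \<phi> (at x) (L x (t *\<^sub>R v)))) (at 0)"
    by (simp add: o_def)
  moreover have "frechet_derivative \<phi> (at x) (L x (t *\<^sub>R v)) = frechet_derivative \<phi> (at x) (L x v) * t" for t
    using linear_scale[OF linear_L] linear_scale[OF has_derivative_linear[OF D]] by (simp add: mult.commute)
  ultimately have "((\<lambda>t. \<phi> (gm x (t *\<^sub>R v))) has_field_derivative frechet_derivative \<phi> (at x) (L x v)) (at 0)"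
    unfolding has_field_derivative_def by simp
  then show ?thesis unfolding Xfield_def by (rule DERIV_imp_deriv)
qed

lemma linear_Xfield:
  assumes "\<phi> \<in> polyfun" shows "linear (\<lambda>v. Xfield gm v \<phi> x)"
proof -
  have "linear (frechet_derivative \<phi> (at x))"
    using polymap_derivative(1)[of \<phi> x] assms by (simp add: polymap_real has_derivative_linear)
  from linear_compose[OF linear_L this] show ?thesis
    unfolding Xfield_eq[OF assms] by (simp add: o_def)
qed

lemma polyfun_Xfield:
  assumes "\<phi> \<in> polyfun" shows "Xfield gm v \<phi> \<in> polyfun"
proof -
  have lin: "linear (frechet_derivative \<phi> (at x))" for x
    using polymap_derivative(1)[of \<phi> x] assms by (simp add: polymap_real has_derivative_linear)
  have "Xfield gm v \<phi> x = (\<Sum>b\<in>Basis. (L x v \<bullet> b) * frechet_derivative \<phi> (at x) b)" for x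
  proof -
    have "frechet_derivative \<phi> (at x) (L x v) = frechet_derivative \<phi> (at x) (\<Sum>b\<in>Basis. (L x v \<bullet> b) *\<^sub>R b)"
      by (simp add: euclidean_representation)
    then show ?thesis unfolding Xfield_eq[OF assms] by (simp add: linear_sum[OF lin] linear_scale[OF lin])
  qed
  then have "Xfield gm v \<phi> = (\<lambda>x. \<Sum>b\<in>Basis. (L x v \<bullet> b) * frechet_derivative \<phi> (at x) b)" by blast
  moreover have "\<dots> \<in> polyfun"
    using polymap_L[of v] polymap_derivative(2)[of \<phi>] assms
    by (intro polyfun_sum pf_mult) (auto simp: polymap_def polymap_real)
  ultimately show ?thesis by simp
qed

lemma Xfield_add:
  assumes "\<phi> \<in> polyfun" "\<omega> \<in> polyfun"
  shows "Xfield gm v (\<lambda>x. \<phi> x + \<omega> x) = (\<lambda>x. Xfield gm v \<phi> x + Xfield gm v \<omega> x)"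
proof
  fix x
  have "(\<phi> has_derivative frechet_derivative \<phi> (at x)) (at x)" "(\<omega> has_derivative frechet_derivative \<omega> (at x)) (at x)"
    using polymap_derivative(1)[of \<phi> x] polymap_derivative(1)[of \<omega> x] assms by (simp_all add: polymap_real)
  from has_derivative_add[OF this]
  have "frechet_derivative (\<lambda>x. \<phi> x + \<omega> x) (at x) = (\<lambda>h. frechet_derivative \<phi> (at x) h + frechet_derivative \<omega> (at x) h)"
    using frechet_derivative_at by metis
  then show "Xfield gm v (\<lambda>x. \<phi> x + \<omega> x) x = Xfield gm v \<phi> x + Xfield gm v \<omega> x"
    using assms by (simp add: Xfield_eq pf_add)
qed

lemma Xfield_horizontal_vec:
  assumes "\<phi> \<in> polyfun"
  shows "Xfield gm (horizontal_vec X \<xi>) \<phi> x = (\<Sum>i\<in>UNIV. \<xi> $ i * Xfield gm (X i) \<phi> x)"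
  unfolding horizontal_vec_def
  by (simp add: linear_sum[OF linear_Xfield[OF assms]] linear_scale[OF linear_Xfield[OF assms]])

lemma hgrad_inner:
  assumes "\<phi> \<in> polyfun"
  shows "hgrad gm X \<phi> x \<bullet> \<xi> = Xfield gm (horizontal_vec X \<xi>) \<phi> x"
  unfolding Xfield_horizontal_vec[OF assms] hgrad_def inner_vec_def by (simp add: mult.commute)

text \<open>Symmetrising leaves a quadratic form unchanged, and linearity of \<open>Xfield\<close>
  in the direction collects the double sum into a repeated derivative along one field.\<close>

lemma hhess_form:
  assumes "\<phi> \<in> polyfun"
  shows "\<xi> \<bullet> (hhess gm X \<phi> x *v \<xi>) = Xfield gm (horizontal_vec X \<xi>) (Xfield gm (horizontal_vec X \<xi>) \<phi>) x"
proof -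
  let ?v = "horizontal_vec X \<xi>"
  have Y: "Xfield gm v \<phi> \<in> polyfun" for v using assms by (rule polyfun_Xfield)
  have add: "Xfield gm v (\<lambda>x. \<Sum>i\<in>I. \<xi> $ i * Xfield gm (X i) \<phi> x) x = (\<Sum>i\<in>I. \<xi> $ i * Xfield gm v (Xfield gm (X i) \<phi>) x)"
    if "finite I" for v x I
    using that
  proof (induction I arbitrary: x)
    case empty
    show ?case by (simp add: Xfield_def)
  next
    case (insert i I)
    have 1: "(\<lambda>x. \<xi> $ i * Xfield gm (X i) \<phi> x) \<in> polyfun" by (intro polyfun_cmult Y)
    have 2: "Xfield gm v (\<lambda>x. \<xi> $ i * Xfield gm (X i) \<phi> x) x = \<xi> $ i * Xfield gm v (Xfield gm (X i) \<phi>) x" for x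
    proof -
      have D: "(Xfield gm (X i) \<phi> has_derivative frechet_derivative (Xfield gm (X i) \<phi>) (at x)) (at x)"
        using polymap_derivative(1)[of "Xfield gm (X i) \<phi>" x] Y by (simp add: polymap_real)
      have "frechet_derivative (\<lambda>x. \<xi> $ i * Xfield gm (X i) \<phi> x) (at x) =
          (\<lambda>h. \<xi> $ i * frechet_derivative (Xfield gm (X i) \<phi>) (at x) h)"
        using has_derivative_mult_right[OF D, of "\<xi> $ i"] frechet_derivative_at by metis
      then show ?thesis by (simp add: Xfield_eq[OF 1] Xfield_eq[OF Y])
    qed
    have 3: "(\<lambda>x. \<Sum>i\<in>I. \<xi> $ i * Xfield gm (X i) \<phi> x) \<in> polyfun" by (intro polyfun_sum polyfun_cmult Y)
    show ?case using insert by (simp add: Xfield_add[OF 1 3] 2)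
  qed
  have "Xfield gm ?v \<phi> = (\<lambda>x. \<Sum>i\<in>UNIV. \<xi> $ i * Xfield gm (X i) \<phi> x)"
    using Xfield_horizontal_vec[OF assms] by blast
  then have "Xfield gm ?v (Xfield gm ?v \<phi>) x = (\<Sum>j\<in>UNIV. \<xi> $ j * Xfield gm ?v (Xfield gm (X j) \<phi>) x)"
    using add[of UNIV ?v x] by simp
  also have "\<dots> = (\<Sum>j\<in>UNIV. \<Sum>i\<in>UNIV. \<xi> $ i * \<xi> $ j * Xfield gm (X i) (Xfield gm (X j) \<phi>) x)"
    by (simp add: Xfield_horizontal_vec[OF Y] sum_distrib_left ac_simps)
  finally have 1: "Xfield gm ?v (Xfield gm ?v \<phi>) x = (\<Sum>j\<in>UNIV. \<Sum>i\<in>UNIV. \<xi> $ i * \<xi> $ j * Xfield gm (X i) (Xfield gm (X j) \<phi>) x)" .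
  have 2: "\<dots> = (\<Sum>i\<in>UNIV. \<Sum>j\<in>UNIV. \<xi> $ i * \<xi> $ j * Xfield gm (X i) (Xfield gm (X j) \<phi>) x)"
    by (rule sum.swap)
  have "\<xi> \<bullet> (hhess gm X \<phi> x *v \<xi>) = (\<Sum>i\<in>UNIV. \<Sum>j\<in>UNIV. \<xi> $ i * \<xi> $ j * ((Xfield gm (X i) (Xfield gm (X j) \<phi>) x + Xfield gm (X j) (Xfield gm (X i) \<phi>) x) / 2))"
    by (simp add: inner_vec_def matrix_vector_mult_def hhess_def sum_distrib_left algebra_simps)
  also have "\<dots> = ((\<Sum>i\<in>UNIV. \<Sum>j\<in>UNIV. \<xi> $ i * \<xi> $ j * Xfield gm (X i) (Xfield gm (X j) \<phi>) x)
     + (\<Sum>i\<in>UNIV. \<Sum>j\<in>UNIV. \<xi> $ i * \<xi> $ j * Xfield gm (X j) (Xfield gm (X i) \<phi>) x)) / 2"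
    by (simp add: sum.distrib[symmetric] sum_divide_distrib algebra_simps add_divide_distrib)
  also have "(\<Sum>i\<in>UNIV. \<Sum>j\<in>UNIV. \<xi> $ i * \<xi> $ j * Xfield gm (X j) (Xfield gm (X i) \<phi>) x) = Xfield gm ?v (Xfield gm ?v \<phi>) x"
    unfolding 1 by (simp add: ac_simps)
  also have "(\<Sum>i\<in>UNIV. \<Sum>j\<in>UNIV. \<xi> $ i * \<xi> $ j * Xfield gm (X i) (Xfield gm (X j) \<phi>) x) = Xfield gm ?v (Xfield gm ?v \<phi>) x"
    using 1 2 by simp
  finally show ?thesis by simp
qed

lemma hhess_symmats: "hhess gm X \<phi> x \<in> symmats"
proof -
  have "transpose (hhess gm X \<phi> x) $ i $ j = hhess gm X \<phi> x $ i $ j" for i j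
    unfolding hhess_def transpose_def by (simp only: vec_lambda_beta add.commute)
  then show ?thesis unfolding symmats_def by (simp add: vec_eq_iff)
qed

text \<open>Moving by \<open>s *\<^sub>R v\<close> and then by \<open>t *\<^sub>R v\<close> is
  moving by the sum, so along this curve \<open>Xfield\<close> is ordinary differentiation of a
  polynomial in one variable.\<close>

lemma polyfun_along_line:
  assumes "\<phi> \<in> polyfun"
  obtains q where "\<And>t. \<phi> (gm x (t *\<^sub>R v)) = \<phi> x + t * Xfield gm v \<phi> x
      + t\<^sup>2 / 2 * Xfield gm v (Xfield gm v \<phi>) x + t ^ 3 * poly q t"
proof -
  have "polymap (\<lambda>t. gm x (t *\<^sub>R v))"
    by (intro polymap_gm polymap_const polymap_scaleR) (use polymap_ident[where 'a=real] in \<open>simp add: polymap_real\<close>)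
  then obtain p where p: "\<And>t. \<phi> (gm x (t *\<^sub>R v)) = poly p t"
    using polyfun_real_poly[OF polyfun_compose[OF assms]] by metis
  have X: "Xfield gm v \<phi> (gm x (s *\<^sub>R v)) = poly (pderiv p) s" for s
  proof -
    have "\<phi> (gm (gm x (s *\<^sub>R v)) (t *\<^sub>R v)) = poly p (s + t)" for t
      by (simp add: gm_assoc gm_same_line p)
    moreover have "((\<lambda>t. poly p (s + t)) has_field_derivative poly (pderiv p) s) (at 0)"
      using DERIV_shift[of "poly p" "poly (pderiv p) s" 0 s] poly_DERIV[of p s] by (simp add: add.commute)
    ultimately show ?thesis unfolding Xfield_def by (simp add: DERIV_imp_deriv)
  qed
  have XX: "Xfield gm v (Xfield gm v \<phi>) x = poly (pderiv (pderiv p)) 0"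
    unfolding Xfield_def[of gm v "Xfield gm v \<phi>"] X by (intro DERIV_imp_deriv poly_DERIV)
  obtain a0 p1 where p1: "p = pCons a0 p1" by (rule pCons_cases)
  obtain a1 p2 where p2: "p1 = pCons a1 p2" by (rule pCons_cases)
  obtain a2 q where q: "p2 = pCons a2 q" by (rule pCons_cases)
  have "\<phi> x = a0" using p[of 0] by (simp add: p1)
  show thesis
  proof
    fix t
    show "\<phi> (gm x (t *\<^sub>R v)) = \<phi> x + t * Xfield gm v \<phi> x
      + t\<^sup>2 / 2 * Xfield gm v (Xfield gm v \<phi>) x + t ^ 3 * poly q t"
      using X[of 0] unfolding XX p \<open>\<phi> x = a0\<close> p1 p2 q
      by (simp add: pderiv_pCons pderiv_add algebra_simps power2_eq_square power3_eq_cube)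
  qed
qed

text \<open>The curve t \<mapsto> \<open>gm x (t *\<^sub>R v)\<close> is in general bent in the
  ambient coordinates. \<open>curve1\<close> and \<open>curve2\<close> are its first and second
  Taylor coefficients, the latter including the factor 1/2.\<close>

definition curve1 :: "'a \<Rightarrow> 'a \<Rightarrow> 'a" where
  "curve1 x v = (\<Sum>b\<in>Basis. Xfield gm v (\<lambda>z. z \<bullet> b) x *\<^sub>R b)"

definition curve2 :: "'a \<Rightarrow> 'a \<Rightarrow> 'a" where
  "curve2 x v = (\<Sum>b\<in>Basis. (Xfield gm v (Xfield gm v (\<lambda>z. z \<bullet> b)) x / 2) *\<^sub>R b)"

lemma curve_expansion:
  "((\<lambda>t. (gm x (t *\<^sub>R v) - x - t *\<^sub>R curve1 x v) /\<^sub>R t\<^sup>2) \<longlongrightarrow> curve2 x v) (at 0)"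
  unfolding tendsto_componentwise_iff[of _ "curve2 x v"]
proof
  fix b :: 'a assume b: "b \<in> Basis"
  obtain q where q: "\<And>t. gm x (t *\<^sub>R v) \<bullet> b = x \<bullet> b + t * Xfield gm v (\<lambda>z. z \<bullet> b) x
      + t\<^sup>2 / 2 * Xfield gm v (Xfield gm v (\<lambda>z. z \<bullet> b)) x + t ^ 3 * poly q t"
    using polyfun_along_line[OF pf_coord[OF b], of x v] by blast
  have c1: "curve1 x v \<bullet> b = Xfield gm v (\<lambda>z. z \<bullet> b) x"
    and c2: "curve2 x v \<bullet> b = Xfield gm v (Xfield gm v (\<lambda>z. z \<bullet> b)) x / 2"
    unfolding curve1_def curve2_def using b by (simp_all add: inner_sum_left_Basis)
  have "((\<lambda>t. curve2 x v \<bullet> b + t * poly q t) \<longlongrightarrow> curve2 x v \<bullet> b + 0 * poly q 0) (at 0)"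
    by (intro tendsto_intros)
  then have "((\<lambda>t. curve2 x v \<bullet> b + t * poly q t) \<longlongrightarrow> curve2 x v \<bullet> b) (at 0)" by simp
  then show "((\<lambda>t. ((gm x (t *\<^sub>R v) - x - t *\<^sub>R curve1 x v) /\<^sub>R t\<^sup>2) \<bullet> b) \<longlongrightarrow> curve2 x v \<bullet> b) (at 0)"
  proof (rule Lim_transform_eventually)
    show "\<forall>\<^sub>F t in at 0. curve2 x v \<bullet> b + t * poly q t = ((gm x (t *\<^sub>R v) - x - t *\<^sub>R curve1 x v) /\<^sub>R t\<^sup>2) \<bullet> b"
      unfolding eventually_at_filter
    proof (intro always_eventually allI impI)
      fix t :: real assume "t \<noteq> 0"
      have "((gm x (t *\<^sub>R v) - x - t *\<^sub>R curve1 x v) /\<^sub>R t\<^sup>2) \<bullet> b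
          = (gm x (t *\<^sub>R v) \<bullet> b - x \<bullet> b - t * (curve1 x v \<bullet> b)) / t\<^sup>2"
        by (simp add: inner_diff_left divide_inverse mult.commute)
      also have "\<dots> = curve2 x v \<bullet> b + t * poly q t"
        using \<open>t \<noteq> 0\<close> unfolding q c1 c2 by (simp add: field_simps power2_eq_square power3_eq_cube)
      finally show "curve2 x v \<bullet> b + t * poly q t = ((gm x (t *\<^sub>R v) - x - t *\<^sub>R curve1 x v) /\<^sub>R t\<^sup>2) \<bullet> b" by simp
    qed
  qed
qed

text \<open>With a merely pointwise expansion, the second derivative along the curve has to be a
  limit of difference quotients. The bending of the curve brings the first order coefficient
  \<open>p\<close> into the second order term.\<close>

lemma second_order_at_along_curve:
  fixes v :: 'a
  assumes so: "second_order_at f x p A"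
  defines "c1 \<equiv> curve1 x v" and "c2 \<equiv> curve2 x v"
  shows "((\<lambda>t. (f (gm x (t *\<^sub>R v)) - f x - t * (p \<bullet> c1)) / t\<^sup>2) \<longlongrightarrow> p \<bullet> c2 + A c1 \<bullet> c1 / 2) (at 0)"
proof -
  have linA: "linear A" using so unfolding second_order_at_def by blast
  define h where "h t = gm x (t *\<^sub>R v) - x" for t
  have ht2: "((\<lambda>t. (h t - t *\<^sub>R c1) /\<^sub>R t\<^sup>2) \<longlongrightarrow> c2) (at 0)"
    using curve_expansion[of x v] unfolding h_def c1_def c2_def .
  have "((\<lambda>t. c1 + t *\<^sub>R ((h t - t *\<^sub>R c1) /\<^sub>R t\<^sup>2)) \<longlongrightarrow> c1 + 0 *\<^sub>R c2) (at 0)"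
    by (intro tendsto_intros ht2)
  then have "((\<lambda>t. c1 + t *\<^sub>R ((h t - t *\<^sub>R c1) /\<^sub>R t\<^sup>2)) \<longlongrightarrow> c1) (at 0)" by simp
  then have ht1: "((\<lambda>t. h t /\<^sub>R t) \<longlongrightarrow> c1) (at 0)"
  proof (rule Lim_transform_eventually)
    show "\<forall>\<^sub>F t in at 0. c1 + t *\<^sub>R ((h t - t *\<^sub>R c1) /\<^sub>R t\<^sup>2) = h t /\<^sub>R t"
      unfolding eventually_at_filter
    proof (intro always_eventually allI impI)
      fix t :: real assume "t \<noteq> 0"
      then have "t * inverse (t\<^sup>2) = inverse t" "t * (inverse (t\<^sup>2) * t) = 1"
        by (simp_all add: power2_eq_square field_simps)
      then show "c1 + t *\<^sub>R ((h t - t *\<^sub>R c1) /\<^sub>R t\<^sup>2) = h t /\<^sub>R t"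
        unfolding scaleR_scaleR scaleR_diff_right by (simp only: scaleR_scaleR) simp
    qed
  qed
  have "((\<lambda>t. t *\<^sub>R (h t /\<^sub>R t)) \<longlongrightarrow> 0 *\<^sub>R c1) (at 0)"
    by (rule tendsto_scaleR[OF tendsto_ident_at ht1])
  then have h0: "(h \<longlongrightarrow> 0) (at 0)"
    unfolding scaleR_zero_left
  proof (rule Lim_transform_eventually)
    show "\<forall>\<^sub>F t in at 0. t *\<^sub>R (h t /\<^sub>R t) = h t"
      unfolding eventually_at_filter by (intro always_eventually allI impI) simp
  qed
  define E where "E t = f (x + h t) - f x - p \<bullet> h t - A (h t) \<bullet> h t / 2" for t
  have E0: "((\<lambda>t. E t / t\<^sup>2) \<longlongrightarrow> 0) (at 0)"
  proof (rule tendstoI)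
    fix e :: real assume "e > 0"
    define e' where "e' = e / ((norm c1 + 1)\<^sup>2 + 1)"
    have pos: "(norm c1 + 1)\<^sup>2 + 1 > 0" by (smt (verit) zero_le_power2)
    have "e' > 0" unfolding e'_def using \<open>e > 0\<close> pos by simp
    then obtain d where d: "d > 0" "\<And>y. norm (y - x) < d \<Longrightarrow>
       \<bar>f y - f x - p \<bullet> (y - x) - A (y - x) \<bullet> (y - x) / 2\<bar> \<le> e' * (norm (y - x))\<^sup>2"
      using so unfolding second_order_at_def by meson
    have "\<forall>\<^sub>F t in at 0. norm (h t) < d"
      using tendstoD[OF h0 d(1)] by (simp add: dist_norm)
    moreover have "\<forall>\<^sub>F t in at 0. norm (h t /\<^sub>R t) < norm c1 + 1"
      using order_tendstoD(2)[OF tendsto_norm[OF ht1], of "norm c1 + 1"] by simp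
    moreover have "\<forall>\<^sub>F t::real in at 0. t \<noteq> 0" by (simp add: eventually_at_filter)
    ultimately show "\<forall>\<^sub>F t in at 0. dist (E t / t\<^sup>2) 0 < e"
    proof eventually_elim
      case (elim t)
      have "\<bar>E t\<bar> \<le> e' * (norm (h t))\<^sup>2" using d(2)[of "x + h t"] elim unfolding E_def by simp
      then have "\<bar>E t\<bar> / t\<^sup>2 \<le> e' * (norm (h t))\<^sup>2 / t\<^sup>2" by (rule divide_right_mono) simp
      also have "\<dots> = e' * (norm (h t /\<^sub>R t))\<^sup>2"
        by (simp add: power_mult_distrib power_inverse divide_inverse mult.commute)
      also have "\<dots> \<le> e' * (norm c1 + 1)\<^sup>2"
        using elim \<open>e' > 0\<close> by (intro mult_left_mono power_mono) auto
      also have "\<dots> < e' * ((norm c1 + 1)\<^sup>2 + 1)" using \<open>e' > 0\<close> by simp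
      also have "\<dots> = e" unfolding e'_def using pos by simp
      finally show ?case by (simp add: abs_divide)
    qed
  qed
  have A1: "((\<lambda>t. A (h t /\<^sub>R t)) \<longlongrightarrow> A c1) (at 0)"
    using linA by (intro bounded_linear.tendsto[OF _ ht1]) (simp add: linear_conv_bounded_linear)
  have "((\<lambda>t. E t / t\<^sup>2 + p \<bullet> ((h t - t *\<^sub>R c1) /\<^sub>R t\<^sup>2) + A (h t /\<^sub>R t) \<bullet> (h t /\<^sub>R t) / 2)
      \<longlongrightarrow> 0 + p \<bullet> c2 + A c1 \<bullet> c1 / 2) (at 0)"
    by (rule tendsto_add[OF tendsto_add[OF E0 tendsto_inner[OF tendsto_const ht2]]
        tendsto_divide[OF tendsto_inner[OF A1 ht1] tendsto_const]]) simp
  then have "((\<lambda>t. E t / t\<^sup>2 + p \<bullet> ((h t - t *\<^sub>R c1) /\<^sub>R t\<^sup>2) + A (h t /\<^sub>R t) \<bullet> (h t /\<^sub>R t) / 2)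
      \<longlongrightarrow> p \<bullet> c2 + A c1 \<bullet> c1 / 2) (at 0)" by simp
  then show ?thesis
  proof (rule Lim_transform_eventually)
    show "\<forall>\<^sub>F t in at 0. E t / t\<^sup>2 + p \<bullet> ((h t - t *\<^sub>R c1) /\<^sub>R t\<^sup>2) + A (h t /\<^sub>R t) \<bullet> (h t /\<^sub>R t) / 2
       = (f (gm x (t *\<^sub>R v)) - f x - t * (p \<bullet> c1)) / t\<^sup>2"
      unfolding eventually_at_filter
    proof (intro always_eventually allI impI)
      fix t :: real assume "t \<noteq> 0"
      have "A (h t /\<^sub>R t) \<bullet> (h t /\<^sub>R t) = inverse t * (inverse t * (A (h t) \<bullet> h t))"
        by (simp only: linear_scale[OF linA] inner_scaleR_left inner_scaleR_right)
      also have "\<dots> = (A (h t) \<bullet> h t) / t\<^sup>2"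
        by (simp only: divide_inverse power2_eq_square inverse_mult_distrib ac_simps)
      finally have 1: "A (h t /\<^sub>R t) \<bullet> (h t /\<^sub>R t) / 2 = (A (h t) \<bullet> h t / 2) / t\<^sup>2" by simp
      have 2: "p \<bullet> ((h t - t *\<^sub>R c1) /\<^sub>R t\<^sup>2) = (p \<bullet> h t - t * (p \<bullet> c1)) / t\<^sup>2"
        by (simp only: inner_scaleR_right inner_diff_right divide_inverse mult.commute)
      have 3: "f (gm x (t *\<^sub>R v)) - f x - t * (p \<bullet> c1) = E t + (p \<bullet> h t - t * (p \<bullet> c1)) + A (h t) \<bullet> h t / 2"
        unfolding E_def h_def by simp
      show "E t / t\<^sup>2 + p \<bullet> ((h t - t *\<^sub>R c1) /\<^sub>R t\<^sup>2) + A (h t /\<^sub>R t) \<bullet> (h t /\<^sub>R t) / 2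
       = (f (gm x (t *\<^sub>R v)) - f x - t * (p \<bullet> c1)) / t\<^sup>2"
        unfolding 1 2 3 by (simp only: add_divide_distrib)
    qed
  qed
qed

text \<open>A polynomial has its exact expansion along the curve and the one inherited from
  \<open>p\<close> and \<open>A\<close>; uniqueness of limits equates first the linear, then the
  quadratic coefficients. This transfers Euclidean expansions to horizontal jets.\<close>

lemma Xfield_second_order:
  assumes "\<phi> \<in> polyfun" and so: "second_order_at \<phi> x p A"
  shows "Xfield gm v \<phi> x = p \<bullet> curve1 x v"
    and "Xfield gm v (Xfield gm v \<phi>) x = 2 * (p \<bullet> curve2 x v) + A (curve1 x v) \<bullet> curve1 x v"
proof -
  let ?a = "Xfield gm v \<phi> x" and ?b = "Xfield gm v (Xfield gm v \<phi>) x"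
  let ?p = "p \<bullet> curve1 x v"
  let ?l = "p \<bullet> curve2 x v + A (curve1 x v) \<bullet> curve1 x v / 2"
  obtain q where q: "\<And>t. \<phi> (gm x (t *\<^sub>R v)) = \<phi> x + t * ?a + t\<^sup>2 / 2 * ?b + t ^ 3 * poly q t"
    using polyfun_along_line[OF assms(1)] by blast
  note lim = second_order_at_along_curve[OF so, of v]
  have "((\<lambda>t. t * ((\<phi> (gm x (t *\<^sub>R v)) - \<phi> x - t * ?p) / t\<^sup>2) - t / 2 * ?b - t\<^sup>2 * poly q t) \<longlongrightarrow> 0 * ?l - 0 / 2 * ?b - 0\<^sup>2 * poly q 0) (at 0)"
    by (intro tendsto_intros lim) simp_all
  moreover have "\<forall>\<^sub>F t in at 0. t * ((\<phi> (gm x (t *\<^sub>R v)) - \<phi> x - t * ?p) / t\<^sup>2) - t / 2 * ?b - t\<^sup>2 * poly q t = ?a - ?p"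
    unfolding eventually_at_filter q
    by (intro always_eventually allI impI) (simp add: field_simps power2_eq_square power3_eq_cube)
  ultimately have "((\<lambda>t::real. ?a - ?p) \<longlongrightarrow> 0 * ?l - 0 / 2 * ?b - 0\<^sup>2 * poly q 0) (at 0)"
    by (rule Lim_transform_eventually)
  then show a: "?a = ?p" by (simp add: tendsto_const_iff)
  have "((\<lambda>t. (\<phi> (gm x (t *\<^sub>R v)) - \<phi> x - t * ?p) / t\<^sup>2 - t * poly q t) \<longlongrightarrow> ?l - 0 * poly q 0) (at 0)"
    by (intro tendsto_intros lim)
  moreover have "\<forall>\<^sub>F t in at 0. (\<phi> (gm x (t *\<^sub>R v)) - \<phi> x - t * ?p) / t\<^sup>2 - t * poly q t = ?b / 2"
    unfolding eventually_at_filter q a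
    by (intro always_eventually allI impI) (simp add: field_simps power2_eq_square power3_eq_cube)
  ultimately have "((\<lambda>t::real. ?b / 2) \<longlongrightarrow> ?l - 0 * poly q 0) (at 0)"
    by (rule Lim_transform_eventually)
  then have "?b / 2 = ?l" by (simp add: tendsto_const_iff)
  then show "?b = 2 * (p \<bullet> curve2 x v) + A (curve1 x v) \<bullet> curve1 x v" by (simp add: field_simps)
qed

lemma polymap_hgrad:
  assumes "\<phi> \<in> polyfun" shows "polymap (hgrad gm X \<phi>)"
  unfolding polymap_def
proof
  fix b :: "real^'b" assume "b \<in> Basis"
  then obtain i where "b = axis i 1" unfolding Basis_vec_def by auto
  then have "(\<lambda>x. hgrad gm X \<phi> x \<bullet> b) = Xfield gm (X i) \<phi>"
    by (simp add: hgrad_def inner_axis)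
  then show "(\<lambda>x. hgrad gm X \<phi> x \<bullet> b) \<in> polyfun" using polyfun_Xfield[OF assms] by simp
qed

lemma polymap_hhess:
  assumes "\<phi> \<in> polyfun" shows "polymap (hhess gm X \<phi>)"
  unfolding polymap_def
proof
  fix b :: "real^'b^'b" assume "b \<in> Basis"
  then obtain i j where "b = axis i (axis j 1)" unfolding Basis_vec_def by auto
  then have eq: "(\<lambda>x. hhess gm X \<phi> x \<bullet> b) = (\<lambda>x. 1 / 2 *
      (Xfield gm (X i) (Xfield gm (X j) \<phi>) x + Xfield gm (X j) (Xfield gm (X i) \<phi>) x))"
    by (simp add: hhess_def inner_axis)
  show "(\<lambda>x. hhess gm X \<phi> x \<bullet> b) \<in> polyfun"
    unfolding eq by (intro polyfun_cmult pf_add polyfun_Xfield assms)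
qed

text \<open>Tested with a basis vector, \<open>curve1\<close> is the horizontal gradient and
  \<open>curve2\<close> half the horizontal Hessian form of a coordinate function, both polynomial
  in \<open>x\<close>.\<close>

lemma curve_bounds:
  fixes X :: "'m::finite \<Rightarrow> 'a"
  assumes "bounded K"
  obtains \<Gamma> where "\<Gamma> \<ge> 0" "\<And>x \<xi>. x \<in> K \<Longrightarrow> norm (curve1 x (horizontal_vec X \<xi>)) \<le> \<Gamma> * norm \<xi>"
    "\<And>x \<xi>. x \<in> K \<Longrightarrow> norm (curve2 x (horizontal_vec X \<xi>)) \<le> \<Gamma> * (norm \<xi>)\<^sup>2"
proof -
  have "\<exists>M. M \<ge> 0 \<and> (\<forall>x\<in>K. norm (hgrad gm X (\<lambda>z. z \<bullet> b) x) \<le> M)" if "b \<in> Basis" for b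
    using polymap_bounded_on[OF polymap_hgrad[OF pf_coord[OF that]] assms] by metis
  then obtain M where M: "\<And>b. b \<in> Basis \<Longrightarrow> M b \<ge> 0"
    "\<And>b x. b \<in> Basis \<Longrightarrow> x \<in> K \<Longrightarrow> norm (hgrad gm X (\<lambda>z. z \<bullet> b) x) \<le> M b" by metis
  have "\<exists>M. M \<ge> 0 \<and> (\<forall>x\<in>K. norm (hhess gm X (\<lambda>z. z \<bullet> b) x) \<le> M)" if "b \<in> Basis" for b
    using polymap_bounded_on[OF polymap_hhess[OF pf_coord[OF that]] assms] by metis
  then obtain N where N: "\<And>b. b \<in> Basis \<Longrightarrow> N b \<ge> 0"
    "\<And>b x. b \<in> Basis \<Longrightarrow> x \<in> K \<Longrightarrow> norm (hhess gm X (\<lambda>z. z \<bullet> b) x) \<le> N b" by metis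
  have sM: "sum M Basis \<ge> 0" and sN: "sum N Basis \<ge> 0" using M N by (auto intro: sum_nonneg)
  show thesis
  proof
    show "sum M Basis + sum N Basis \<ge> 0" using sM sN by simp
    fix x \<xi> assume x: "x \<in> K"
    let ?v = "horizontal_vec X \<xi>"
    have "norm (curve1 x ?v) \<le> (\<Sum>b\<in>Basis. \<bar>curve1 x ?v \<bullet> b\<bar>)" by (rule norm_le_l1)
    also have "\<dots> \<le> (\<Sum>b\<in>Basis. M b * norm \<xi>)"
    proof (rule sum_mono)
      fix b :: 'a assume b: "b \<in> Basis"
      have "curve1 x ?v \<bullet> b = hgrad gm X (\<lambda>z. z \<bullet> b) x \<bullet> \<xi>"
        unfolding curve1_def hgrad_inner[OF pf_coord[OF b]] using b by (simp add: inner_sum_left_Basis)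
      also have "\<bar>\<dots>\<bar> \<le> norm (hgrad gm X (\<lambda>z. z \<bullet> b) x) * norm \<xi>" by (rule Cauchy_Schwarz_ineq2)
      also have "\<dots> \<le> M b * norm \<xi>" using M b x by (intro mult_right_mono) auto
      finally show "\<bar>curve1 x ?v \<bullet> b\<bar> \<le> M b * norm \<xi>" .
    qed
    also have "\<dots> \<le> (sum M Basis + sum N Basis) * norm \<xi>"
      using sN by (simp add: sum_distrib_right[symmetric] mult_right_mono)
    finally show "norm (curve1 x ?v) \<le> (sum M Basis + sum N Basis) * norm \<xi>" .
    have "norm (curve2 x ?v) \<le> (\<Sum>b\<in>Basis. \<bar>curve2 x ?v \<bullet> b\<bar>)" by (rule norm_le_l1)
    also have "\<dots> \<le> (\<Sum>b\<in>Basis. N b * (norm \<xi>)\<^sup>2)"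
    proof (rule sum_mono)
      fix b :: 'a assume b: "b \<in> Basis"
      have "curve2 x ?v \<bullet> b = (\<xi> \<bullet> (hhess gm X (\<lambda>z. z \<bullet> b) x *v \<xi>)) / 2"
        unfolding curve2_def hhess_form[OF pf_coord[OF b]] using b by (simp add: inner_sum_left_Basis)
      then have "\<bar>curve2 x ?v \<bullet> b\<bar> \<le> \<bar>\<xi> \<bullet> (hhess gm X (\<lambda>z. z \<bullet> b) x *v \<xi>)\<bar>" by simp
      also have "\<dots> \<le> norm (hhess gm X (\<lambda>z. z \<bullet> b) x) * (norm \<xi>)\<^sup>2" by (rule abs_matrix_form_le)
      also have "\<dots> \<le> N b * (norm \<xi>)\<^sup>2" using N b x by (intro mult_right_mono) auto
      finally show "\<bar>curve2 x ?v \<bullet> b\<bar> \<le> N b * (norm \<xi>)\<^sup>2" .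
    qed
    also have "\<dots> \<le> (sum M Basis + sum N Basis) * (norm \<xi>)\<^sup>2"
      using sM by (simp add: sum_distrib_right[symmetric] mult_right_mono)
    finally show "norm (curve2 x ?v) \<le> (sum M Basis + sum N Basis) * (norm \<xi>)\<^sup>2" .
  qed
qed

end

section \<open>Horizontal coordinates are homomorphisms\<close>

text \<open>Brackets live in the layers above the first, which are orthogonal to it. For
  \<open>x\<close> in the first layer this is the grading itself; the Jacobi identity carries it
  from one layer of \<open>x\<close> to the next.\<close>

lemma stratified_bracket_orthogonal:
  assumes S: "stratified_lie_algebra br V r" and a: "a \<in> V 1"
  shows "a \<bullet> br x y = 0"
proof -
  have linr: "linear (br x)" and linl: "linear (\<lambda>x. br x y)" and alt: "br x x = 0"
    and jac: "br x (br y z) + br y (br z x) + br z (br x y) = 0" for x y z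
    using S unfolding stratified_lie_algebra_def by blast+
  have r: "1 \<le> r" and sp: "span (\<Union>j\<in>{1..r}. V j) = UNIV"
    and V: "\<And>j. 1 \<le> j \<Longrightarrow> j < r \<Longrightarrow> V (Suc j) = span {br x y | x y. x \<in> V 1 \<and> y \<in> V j}"
    and top: "\<And>j x y. j \<in> {1..r} \<Longrightarrow> x \<in> V j \<Longrightarrow> y \<in> V r \<Longrightarrow> br x y = 0"
    and orth: "\<And>i j x y. i \<in> {1..r} \<Longrightarrow> j \<in> {1..r} \<Longrightarrow> i \<noteq> j \<Longrightarrow> x \<in> V i \<Longrightarrow> y \<in> V j \<Longrightarrow> x \<bullet> y = 0"
    using S unfolding stratified_lie_algebra_def by blast+
  have anti: "br y x = - br x y" for x y
  proof -
    have "br (x + y) (x + y) = br x x + br y x + (br x y + br y y)"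
      by (simp add: linear_add[OF linr] linear_add[OF linl])
    then have "br y x + br x y = 0" by (simp add: alt)
    then show ?thesis by (simp add: eq_neg_iff_add_eq_0)
  qed
  have span_ind: "P x" if "subspace (Collect P)" "\<And>j x. j \<in> {1..r} \<Longrightarrow> x \<in> V j \<Longrightarrow> P x" for P :: "'a \<Rightarrow> bool" and x
  proof -
    have "span (\<Union>j\<in>{1..r}. V j) \<subseteq> Collect P" by (rule span_minimal) (use that in auto)
    then show ?thesis unfolding sp by blast
  qed
  have one: "a \<bullet> br x y = 0" if x: "x \<in> V 1" for x y
  proof (rule span_ind[of "\<lambda>y. a \<bullet> br x y = 0"])
    show "subspace {y. a \<bullet> br x y = 0}"
      unfolding subspace_def by (simp add: linear_0[OF linr] linear_add[OF linr] linear_scale[OF linr] inner_add_right)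
    fix j y assume j: "j \<in> {1..r}" and y: "y \<in> V j"
    show "a \<bullet> br x y = 0"
    proof (cases "j = r")
      case True
      then show ?thesis using top[of 1 x y] x y r by auto
    next
      case False
      then have "br x y \<in> V (Suc j)" using V[of j] j x y by (auto intro: span_base)
      then show ?thesis using orth[of 1 "Suc j" a "br x y"] False j a r by auto
    qed
  qed
  have "\<forall>x\<in>V (Suc i). \<forall>y. a \<bullet> br x y = 0" if "Suc i \<le> r" for i
    using that
  proof (induction i)
    case 0
    then show ?case using one by simp
  next
    case (Suc i)
    let ?U = "{x. \<forall>y. a \<bullet> br x y = 0}"
    have subU: "subspace ?U"
      unfolding subspace_def by (simp add: linear_0[OF linl] linear_add[OF linl] linear_scale[OF linl] inner_add_right)
    have baseU: "{br x y | x y. x \<in> V 1 \<and> y \<in> V (Suc i)} \<subseteq> ?U"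
    proof clarify
      fix x y z assume x: "x \<in> V 1" and y: "y \<in> V (Suc i)"
      \<comment> \<open>On the right, the first term brackets with \<open>x\<close> from the first
        layer and the second with \<open>y\<close> from the preceding layer, so \<open>one\<close>
        and the induction hypothesis apply.\<close>
      have "br (br x y) z = br x (br y z) + br y (br z x)"
        using jac[of x y z] anti[of "br x y" z] by (metis add_eq_0_iff add.commute minus_minus)
      moreover have "a \<bullet> br y (br z x) = 0" using Suc y by simp
      ultimately show "a \<bullet> br (br x y) z = 0" using one[OF x] by (simp add: inner_add_right)
    qed
    have "V (Suc (Suc i)) \<subseteq> ?U"
      using V[of "Suc i"] Suc.prems span_minimal[OF baseU subU] by simp
    then show ?case by blast
  qed
  then have all: "a \<bullet> br x y = 0" if "j \<in> {1..r}" "x \<in> V j" for j x y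
    using that by (cases j) auto
  show ?thesis
  proof (rule span_ind[of "\<lambda>x. a \<bullet> br x y = 0"])
    show "subspace {x. a \<bullet> br x y = 0}"
      unfolding subspace_def by (simp add: linear_0[OF linl] linear_add[OF linl] linear_scale[OF linl] inner_add_right)
  qed (use all in blast)
qed

text \<open>Monomials are sorted into pure powers of \<open>s\<close>, pure powers of
  \<open>t\<close> and mixed ones. A polynomial vanishing on both axes is thereby s t times a
  continuous function, the form needed for commutators.\<close>

lemma polyfun_real_prod_decomposition:
  assumes "P \<in> polyfun"
  obtains c \<alpha> \<beta> E where "continuous_on UNIV \<alpha>" "continuous_on UNIV \<beta>" "continuous_on UNIV E"
    "\<And>s t::real. P (s, t) = c + s * \<alpha> s + t * \<beta> t + s * t * E (s, t)"
proof -
  have "\<exists>c \<alpha> \<beta> E. continuous_on UNIV \<alpha> \<and> continuous_on UNIV \<beta> \<and> continuous_on UNIV E \<and>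
    (\<forall>s t::real. P (s, t) = c + s * \<alpha> s + t * \<beta> t + s * t * E (s, t))"
    using assms
  proof induction
    case (pf_const c)
    show ?case by (intro exI[of _ c] exI[of _ "\<lambda>_. 0"]) auto
  next
    case (pf_coord b)
    then have "b = (1, 0) \<or> b = (0, 1)" unfolding Basis_prod_def by auto
    then show ?case
    proof
      assume "b = (1, 0)"
      then show ?case by (intro exI[of _ 0] exI[of _ "\<lambda>_. 1"] exI[of _ "\<lambda>_. 0"]) auto
    next
      assume "b = (0, 1)"
      then show ?case by (intro exI[of _ 0] exI[of _ "\<lambda>_. 0"] exI[of _ "\<lambda>_. 1"]) auto
    qed
  next
    case (pf_add f g)
    then obtain c \<alpha> \<beta> E c' \<alpha>' \<beta>' E' where *: "continuous_on UNIV \<alpha>" "continuous_on UNIV \<beta>" "continuous_on UNIV E"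
      "continuous_on UNIV \<alpha>'" "continuous_on UNIV \<beta>'" "continuous_on UNIV E'"
      and f: "\<And>s t. f (s, t) = c + s * \<alpha> s + t * \<beta> t + s * t * E (s, t)"
      and g: "\<And>s t. g (s, t) = c' + s * \<alpha>' s + t * \<beta>' t + s * t * E' (s, t)"
      by blast
    show ?case
      by (intro exI[of _ "c + c'"] exI[of _ "\<lambda>s. \<alpha> s + \<alpha>' s"] exI[of _ "\<lambda>t. \<beta> t + \<beta>' t"] exI[of _ "\<lambda>z. E z + E' z"] conjI)
        (auto intro!: continuous_intros * simp: f g algebra_simps)
  next
    case (pf_mult f g)
    then obtain c \<alpha> \<beta> E c' \<alpha>' \<beta>' E' where *: "continuous_on UNIV \<alpha>" "continuous_on UNIV \<beta>" "continuous_on UNIV E"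
      "continuous_on UNIV \<alpha>'" "continuous_on UNIV \<beta>'" "continuous_on UNIV E'"
      and f: "\<And>s t. f (s, t) = c + s * \<alpha> s + t * \<beta> t + s * t * E (s, t)"
      and g: "\<And>s t. g (s, t) = c' + s * \<alpha>' s + t * \<beta>' t + s * t * E' (s, t)"
      by blast
    have comp: "continuous_on UNIV (\<lambda>z::real \<times> real. h (fst z))" "continuous_on UNIV (\<lambda>z::real \<times> real. h (snd z))"
      if "continuous_on UNIV h" for h :: "real \<Rightarrow> real"
      by - (rule continuous_on_compose2[OF that linear_continuous_on[OF bounded_linear_fst]], simp,
        rule continuous_on_compose2[OF that linear_continuous_on[OF bounded_linear_snd]], simp)
    show ?case
      by (intro exI[of _ "c * c'"] exI[of _ "\<lambda>s. c * \<alpha>' s + \<alpha> s * c' + s * \<alpha> s * \<alpha>' s"]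
          exI[of _ "\<lambda>t. c * \<beta>' t + \<beta> t * c' + t * \<beta> t * \<beta>' t"]
          exI[of _ "\<lambda>z. \<alpha> (fst z) * \<beta>' (snd z) + \<beta> (snd z) * \<alpha>' (fst z) + c * E' z + E z * c'
            + fst z * \<alpha> (fst z) * E' z + fst z * E z * \<alpha>' (fst z) + snd z * \<beta> (snd z) * E' z
            + snd z * E z * \<beta>' (snd z) + fst z * snd z * E z * E' z"] conjI)
        (auto intro!: continuous_intros * comp simp: f g algebra_simps)
  qed
  then show thesis using that by blast
qed

section \<open>Left and right translations and the adjoint action\<close>

context carnot
begin

definition R :: "'a \<Rightarrow> 'a \<Rightarrow> 'a" where "R x v = Dgm 0 x (v, 0)"

text \<open>The differential at the identity of conjugation by \<open>x\<close>, whose inverse is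
  \<open>- x\<close> in exponential coordinates.\<close>

definition Ad :: "'a \<Rightarrow> 'a \<Rightarrow> 'a" where "Ad x z = Dgm x (- x) (L x z, 0)"

lemma has_derivative_gm_left: "((\<lambda>y. gm y x) has_derivative R x) (at 0)"
  using has_derivative_gm[OF has_derivative_ident has_derivative_const[of x], of 0]
  unfolding R_def by simp

lemma L_zero: "L 0 v = v" and R_zero: "R 0 v = v"
proof -
  have "((\<lambda>y. y) has_derivative L 0) (at 0)" "((\<lambda>y. y) has_derivative R 0) (at 0)"
    using has_derivative_gm_right[of 0] has_derivative_gm_left[of 0] by simp_all
  then show "L 0 v = v" "R 0 v = v"
    using has_derivative_unique[OF _ has_derivative_ident] by metis+
qed

lemma linear_R: "linear (R x)"
  using has_derivative_gm_left by (rule has_derivative_linear)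

lemma Dgm_L: "Dgm x y (0, L y v) = L (gm x y) v"
proof -
  have "((\<lambda>z. gm x (gm y z)) has_derivative (\<lambda>v. Dgm x y (0, L y v))) (at 0)"
    using has_derivative_gm[OF has_derivative_const[of x] has_derivative_gm_right[of y]] by simp
  moreover have "((\<lambda>z. gm x (gm y z)) has_derivative L (gm x y)) (at 0)"
    using has_derivative_gm_right[of "gm x y"] by (simp add: gm_assoc)
  ultimately show ?thesis using has_derivative_unique by metis
qed

lemma Dgm_R: "Dgm x y (R x v, 0) = R (gm x y) v"
proof -
  have "((\<lambda>z. gm (gm z x) y) has_derivative (\<lambda>v. Dgm x y (R x v, 0))) (at 0)"
    using has_derivative_gm[OF has_derivative_gm_left[of x] has_derivative_const[of y]] by simp
  moreover have "((\<lambda>z. gm (gm z x) y) has_derivative R (gm x y)) (at 0)"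
    using has_derivative_gm_left[of "gm x y"] by (simp add: gm_assoc)
  ultimately show ?thesis using has_derivative_unique by metis
qed

lemma inj_L: "inj (L x)"
  by (rule inj_on_inverseI[where g = "\<lambda>w. Dgm (- x) x (0, w)"]) (simp add: Dgm_L L_zero)

lemma inj_R: "inj (R x)"
  by (rule inj_on_inverseI[where g = "\<lambda>w. Dgm x (- x) (w, 0)"]) (simp add: Dgm_R R_zero)

lemma surj_L: "surj (L x)" and surj_R: "surj (R x)"
  using linear_injective_imp_surjective linear_L linear_R inj_L inj_R by blast+

lemma has_derivative_conj: "((\<lambda>z. gm (gm x z) (- x)) has_derivative Ad x) (at 0)"
  using has_derivative_gm[OF has_derivative_gm_right[of x] has_derivative_const[of "- x"]]
  unfolding Ad_def by simp

lemma linear_Ad: "linear (Ad x)"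
  using has_derivative_conj by (rule has_derivative_linear)

lemma R_Ad: "R x (Ad x v) = L x v"
proof -
  have "((\<lambda>z. gm (gm (gm x z) (- x)) x) has_derivative (\<lambda>v. Dgm 0 x (Ad x v, 0))) (at 0)"
    using has_derivative_gm[OF has_derivative_conj[of x] has_derivative_const[of x]] by simp
  moreover have "gm (gm (gm x z) (- x)) x = gm x z" for z by (simp add: gm_assoc)
  ultimately have "((\<lambda>z. gm x z) has_derivative (\<lambda>v. R x (Ad x v))) (at 0)" by (simp add: R_def)
  then show ?thesis using has_derivative_unique[OF _ has_derivative_gm_right] by metis
qed

lemma Ad_zero: "Ad 0 v = v"
  unfolding Ad_def L_zero using R_zero[of v] unfolding R_def by simp

text \<open>Reduces differentiating \<open>Ad\<close> along a one-parameter subgroup to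
  differentiating it at the identity.\<close>

lemma Ad_add_same_line: "Ad ((s + t) *\<^sub>R x) v = Ad (t *\<^sub>R x) (Ad (s *\<^sub>R x) v)"
proof -
  have eq: "gm (gm ((s + t) *\<^sub>R x) z) (- ((s + t) *\<^sub>R x)) = gm (gm (t *\<^sub>R x) (gm (gm (s *\<^sub>R x) z) (- (s *\<^sub>R x)))) (- (t *\<^sub>R x))" for z
  proof -
    have "(s + t) *\<^sub>R x = gm (t *\<^sub>R x) (s *\<^sub>R x)" "- ((s + t) *\<^sub>R x) = gm (- (s *\<^sub>R x)) (- (t *\<^sub>R x))"
      using gm_same_line[of t x s] gm_same_line[of "- s" x "- t"] by (simp_all add: algebra_simps)
    then show ?thesis by (simp only: gm_assoc)
  qed
  have "((\<lambda>z. gm (gm (t *\<^sub>R x) z) (- (t *\<^sub>R x))) has_derivative Ad (t *\<^sub>R x)) (at (gm (gm (s *\<^sub>R x) 0) (- (s *\<^sub>R x))))"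
    using has_derivative_conj by simp
  from diff_chain_at[OF has_derivative_conj[of "s *\<^sub>R x"] this]
  have "((\<lambda>z. gm (gm ((s + t) *\<^sub>R x) z) (- ((s + t) *\<^sub>R x))) has_derivative (\<lambda>v. Ad (t *\<^sub>R x) (Ad (s *\<^sub>R x) v))) (at 0)"
    unfolding eq by (simp add: o_def)
  then show ?thesis using has_derivative_unique[OF has_derivative_conj] by metis
qed

text \<open>The commutator of s x and t w is trivial on both axes, so its component along
  \<open>a\<close> is s t E (s, t). Its t-derivative at t = 0 shows that the increment of
  \<open>Ad\<close> is s E (s, 0), and on the diagonal s = t the commutator limit identifies E (0,
  0) with the bracket.\<close>

lemma Ad_derivative_bracket:
  obtains E where "continuous_on UNIV E" "\<And>s. a \<bullet> Ad (s *\<^sub>R x) w - a \<bullet> w = s * E s" "E 0 = a \<bullet> br x w"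
proof -
  define C where "C z = a \<bullet> gm (gm (gm (fst z *\<^sub>R x) (snd z *\<^sub>R w)) (- (fst z *\<^sub>R x))) (- (snd z *\<^sub>R w))" for z :: "real \<times> real"
  have "fst \<in> (polyfun :: (real \<times> real \<Rightarrow> real) set)" "snd \<in> (polyfun :: (real \<times> real \<Rightarrow> real) set)"
    using polymap_fst polymap_snd polymap_real by blast+
  then have "C \<in> polyfun"
    unfolding C_def by (intro polyfun_inner polymap_const polymap_gm polymap_scaleR polymap_uminus)
  then obtain c \<alpha> \<beta> E where E: "continuous_on UNIV E"
    and dec: "\<And>s t. C (s, t) = c + s * \<alpha> s + t * \<beta> t + s * t * E (s, t)"
    by (rule polyfun_real_prod_decomposition) blast
  have C0: "C (s, 0) = 0" "C (0, t) = 0" for s t unfolding C_def by simp_all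
  have "c = 0" using dec[of 0 0] C0[of 0] by simp
  then have ab: "s * \<alpha> s = 0" "t * \<beta> t = 0" for s t using dec[of s 0] dec[of 0 t] C0 by simp_all
  then have C: "C (s, t) = s * t * E (s, t)" for s t unfolding dec ab \<open>c = 0\<close> by simp
  have E2: "continuous_on UNIV (\<lambda>t. E (s, t))" "continuous_on UNIV (\<lambda>t. E (t, t))" "continuous_on UNIV (\<lambda>t. E (t, s))" for s
    by (intro continuous_on_compose2[OF E] continuous_intros; simp)+
  show thesis
  proof
    show "continuous_on UNIV (\<lambda>s. E (s, 0))" by (rule E2)
    fix s
    have "((\<lambda>t. - (t *\<^sub>R w)) has_derivative (\<lambda>t. - (t *\<^sub>R w))) (at 0)" "((\<lambda>t. t *\<^sub>R w) has_derivative (\<lambda>t. t *\<^sub>R w)) (at 0)"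
      by (auto intro!: derivative_eq_intros)
    from this(1) diff_chain_at[OF this(2), of "\<lambda>z. gm (gm (s *\<^sub>R x) z) (- (s *\<^sub>R x))" "Ad (s *\<^sub>R x)"] has_derivative_conj[of "s *\<^sub>R x"]
    have d: "((\<lambda>t. - (t *\<^sub>R w)) has_derivative (\<lambda>t. - (t *\<^sub>R w))) (at 0)"
      "((\<lambda>t. gm (gm (s *\<^sub>R x) (t *\<^sub>R w)) (- (s *\<^sub>R x))) has_derivative (\<lambda>t. Ad (s *\<^sub>R x) (t *\<^sub>R w))) (at 0)"
      by (simp_all add: o_def)
    \<comment> \<open>At the identity the differential of multiplication is addition.\<close>
    have D0: "Dgm 0 0 (u, v) = u + v" for u v
      using linear_add[OF linear_Dgm, of 0 0 "(u, 0)" "(0, v)"] L_zero[of v] R_zero[of u]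
      unfolding L_def R_def by simp
    from has_derivative_inner_right[OF has_derivative_gm[OF d(2,1)], of a]
    have "((\<lambda>t. C (s, t)) has_derivative (\<lambda>t. a \<bullet> (Ad (s *\<^sub>R x) (t *\<^sub>R w) - t *\<^sub>R w))) (at 0)"
      unfolding C_def by (simp add: D0)
    moreover have "a \<bullet> (Ad (s *\<^sub>R x) (t *\<^sub>R w) - t *\<^sub>R w) = (a \<bullet> Ad (s *\<^sub>R x) w - a \<bullet> w) * t" for t
      by (simp add: linear_scale[OF linear_Ad] inner_diff_right algebra_simps)
    ultimately have "((\<lambda>t. C (s, t)) has_field_derivative (a \<bullet> Ad (s *\<^sub>R x) w - a \<bullet> w)) (at 0)"
      unfolding has_field_derivative_def by simp
    then have "((\<lambda>t. C (s, t) / t) \<longlongrightarrow> a \<bullet> Ad (s *\<^sub>R x) w - a \<bullet> w) (at 0)"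
      by (simp add: DERIV_def C0)
    moreover have "((\<lambda>t. C (s, t) / t) \<longlongrightarrow> s * E (s, 0)) (at 0)"
    proof (rule Lim_transform_eventually)
      show "((\<lambda>t. s * E (s, t)) \<longlongrightarrow> s * E (s, 0)) (at 0)"
        using E2(1)[of s] by (intro tendsto_intros) (simp add: continuous_on_def)
      show "\<forall>\<^sub>F t in at 0. s * E (s, t) = C (s, t) / t"
        unfolding eventually_at_filter by (intro always_eventually allI impI) (simp add: C)
    qed
    ultimately show "a \<bullet> Ad (s *\<^sub>R x) w - a \<bullet> w = s * E (s, 0)"
      by (rule tendsto_unique[rotated]) simp
  next
    have "((\<lambda>t. a \<bullet> ((1 / t\<^sup>2) *\<^sub>R gm (gm (gm (t *\<^sub>R x) (t *\<^sub>R w)) (- (t *\<^sub>R x))) (- (t *\<^sub>R w)))) \<longlongrightarrow> a \<bullet> br x w) (at 0)"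
      using G unfolding carnot_group_def by (intro tendsto_inner tendsto_const) blast
    moreover have "((\<lambda>t. a \<bullet> ((1 / t\<^sup>2) *\<^sub>R gm (gm (gm (t *\<^sub>R x) (t *\<^sub>R w)) (- (t *\<^sub>R x))) (- (t *\<^sub>R w)))) \<longlongrightarrow> E (0, 0)) (at 0)"
    proof (rule Lim_transform_eventually)
      show "((\<lambda>t. E (t, t)) \<longlongrightarrow> E (0, 0)) (at 0)"
        using E2(2) by (simp add: continuous_on_def)
      have "a \<bullet> ((1 / t\<^sup>2) *\<^sub>R gm (gm (gm (t *\<^sub>R x) (t *\<^sub>R w)) (- (t *\<^sub>R x))) (- (t *\<^sub>R w))) = C (t, t) / t\<^sup>2" for t
        unfolding C_def by simp
      then show "\<forall>\<^sub>F t in at 0. E (t, t) = a \<bullet> ((1 / t\<^sup>2) *\<^sub>R gm (gm (gm (t *\<^sub>R x) (t *\<^sub>R w)) (- (t *\<^sub>R x))) (- (t *\<^sub>R w)))"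
        unfolding eventually_at_filter by (intro always_eventually allI impI) (simp add: C power2_eq_square)
    qed
    ultimately show "E (0, 0) = a \<bullet> br x w"
      using tendsto_unique[of "at (0::real)"] by force
  qed
qed

text \<open>Along the one-parameter subgroup of \<open>x\<close> the derivative at \<open>s\<close>
  is the component along \<open>a\<close> of the bracket of \<open>x\<close> with
  \<open>Ad (s *\<^sub>R x) w\<close>, which vanishes; so the component is constant.\<close>

lemma Ad_inner_invariant:
  assumes "a \<in> V 1" shows "a \<bullet> Ad x w = a \<bullet> w"
proof -
  have br0: "a \<bullet> br x y = 0" for x y
    using stratified_bracket_orthogonal[of br V r a] G assms unfolding carnot_group_def by blast
  define f where "f s = a \<bullet> Ad (s *\<^sub>R x) w" for s
  have "(f has_field_derivative 0) (at s)" for s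
  proof -
    obtain E where E: "continuous_on UNIV E" "\<And>h. a \<bullet> Ad (h *\<^sub>R x) (Ad (s *\<^sub>R x) w) - a \<bullet> Ad (s *\<^sub>R x) w = h * E h" "E 0 = a \<bullet> br x (Ad (s *\<^sub>R x) w)"
      using Ad_derivative_bracket[of a x "Ad (s *\<^sub>R x) w"] by blast
    have eq: "f (s + h) - f s = h * E h" for h unfolding f_def Ad_add_same_line by (rule E(2))
    have "(E \<longlongrightarrow> E 0) (at 0)" using E(1) unfolding continuous_on_def by blast
    then have "(E \<longlongrightarrow> 0) (at 0)" using E(3) br0 by simp
    then have "((\<lambda>h. (f (s + h) - f s) / h) \<longlongrightarrow> 0) (at 0)"
      by (rule Lim_transform_eventually)
        (use eq in \<open>auto simp: eventually_at_filter intro!: always_eventually\<close>)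
    then show ?thesis unfolding DERIV_def .
  qed
  then have "f 1 = f 0" using DERIV_isconst_all by blast
  then show ?thesis unfolding f_def by (simp add: Ad_zero)
qed

text \<open>The covector \<open>\<mu>\<close> with \<open>\<mu> \<bullet> L x v = a \<bullet> v\<close> does not change when \<open>x\<close> is replaced by \<open>x / 2\<close>:
  differentiate \<open>x = (x / 2) \<cdot> (x / 2)\<close>.  Letting the point tend to the identity gives \<open>\<mu> = a\<close>.\<close>

lemma L_inner_invariant:
  assumes a: "a \<in> V 1" shows "a \<bullet> L x v = a \<bullet> v"
proof -
  have ex: "\<exists>\<mu>. \<forall>v. \<mu> \<bullet> L x v = a \<bullet> v" for x
  proof -
    obtain M where M: "linear M" "\<And>v. M (L x v) = v"
      using linear_surjective_isomorphism[OF linear_L surj_L, of x] by blast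
    have "adjoint M a \<bullet> L x v = a \<bullet> v" for v
      using adjoint_works[OF M(1), of "L x v" a] M(2) by (simp add: inner_commute)
    then show ?thesis by blast
  qed
  \<comment> \<open>Left and right translation differ by \<open>Ad\<close>, which preserves the
    component along \<open>a\<close>; so \<mu> represents \<open>a\<close> through right translation
    as well.\<close>
  have R: "\<mu> \<bullet> R x w = a \<bullet> w" if "\<forall>v. \<mu> \<bullet> L x v = a \<bullet> v" for \<mu> x w
  proof -
    obtain v where v: "L x v = R x w" using surj_L[of x] by (metis surjD)
    then have "Ad x v = w" using R_Ad[of x v] inj_R[of x] by (auto dest: injD)
    then show ?thesis using that v Ad_inner_invariant[OF a, of x v] by metis
  qed
  have half: "\<forall>v. \<mu> \<bullet> L ((1 / 2) *\<^sub>R x) v = a \<bullet> v" if \<mu>: "\<forall>v. \<mu> \<bullet> L x v = a \<bullet> v" for \<mu> x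
  proof -
    define y where "y = (1 / 2) *\<^sub>R x"
    obtain \<nu> where \<nu>: "\<forall>v. \<nu> \<bullet> L y v = a \<bullet> v" using ex by blast
    have yy: "gm y y = x" unfolding y_def using gm_same_line[of "1 / 2" x "1 / 2"] by simp
    have "\<mu> \<bullet> w = \<nu> \<bullet> w" for w
    proof -
      have "((\<lambda>z. (1 / 2) *\<^sub>R z) has_derivative (\<lambda>z. (1 / 2) *\<^sub>R z)) (at x)"
        by (auto intro!: derivative_eq_intros)
      from has_derivative_gm[OF this this]
      have "((\<lambda>z. gm ((1 / 2) *\<^sub>R z) ((1 / 2) *\<^sub>R z)) has_derivative (\<lambda>h. Dgm y y ((1 / 2) *\<^sub>R h, (1 / 2) *\<^sub>R h))) (at x)"
        unfolding y_def .
      moreover have "gm ((1 / 2) *\<^sub>R z) ((1 / 2) *\<^sub>R z) = z" for z using gm_same_line[of "1 / 2" z "1 / 2"] by simp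
      ultimately have "((\<lambda>z. z) has_derivative (\<lambda>h. Dgm y y ((1 / 2) *\<^sub>R h, (1 / 2) *\<^sub>R h))) (at x)" by simp
      then have "(\<lambda>h. Dgm y y ((1 / 2) *\<^sub>R h, (1 / 2) *\<^sub>R h)) = (\<lambda>h. h)"
        using has_derivative_unique[OF _ has_derivative_ident] by blast
      then have "Dgm y y (w, w) = 2 *\<^sub>R w"
        using fun_cong[of _ _ "2 *\<^sub>R w"] by fastforce
      then have "2 *\<^sub>R w = Dgm y y (w, 0) + Dgm y y (0, w)"
        using linear_add[OF linear_Dgm, of y y "(w, 0)" "(0, w)"] by simp
      then have "\<mu> \<bullet> (2 *\<^sub>R w) = \<mu> \<bullet> Dgm y y (w, 0) + \<mu> \<bullet> Dgm y y (0, w)" by (simp add: inner_add_right)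
      \<comment> \<open>Writing \<open>w\<close> once as a left and once as a right translate based
        at \<open>y\<close> evaluates both halves to \<nu> \<bullet> w.\<close>
      moreover have "\<mu> \<bullet> Dgm y y (0, w) = \<nu> \<bullet> w"
      proof -
        obtain v where v: "w = L y v" using surj_L[of y] by (metis surjD)
        show ?thesis unfolding v Dgm_L yy using \<mu> \<nu> by simp
      qed
      moreover have "\<mu> \<bullet> Dgm y y (w, 0) = \<nu> \<bullet> w"
      proof -
        obtain v where v: "w = R y v" using surj_R[of y] by (metis surjD)
        show ?thesis unfolding v Dgm_R yy using R[OF \<mu>] R[OF \<nu>] by simp
      qed
      ultimately show ?thesis by simp
    qed
    then show ?thesis using \<nu> unfolding y_def by simp
  qed
  obtain \<mu> where \<mu>: "\<forall>v. \<mu> \<bullet> L x v = a \<bullet> v" using ex by blast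
  have it: "\<forall>v. \<mu> \<bullet> L ((1 / 2) ^ n *\<^sub>R x) v = a \<bullet> v" for n
  proof (induction n)
    case (Suc n)
    have "(1 / 2) ^ Suc n *\<^sub>R x = (1 / 2) *\<^sub>R ((1 / 2) ^ n *\<^sub>R x)" by simp
    then show ?case using half[OF Suc] by metis
  qed (use \<mu> in simp)
  have "\<mu> \<bullet> v = a \<bullet> v" for v
  proof -
    have "(\<lambda>n. (1 / 2 :: real) ^ n *\<^sub>R x) \<longlonglongrightarrow> 0 *\<^sub>R x"
      by (intro tendsto_intros LIMSEQ_power_zero) simp
    then have "(\<lambda>n. L ((1 / 2) ^ n *\<^sub>R x) v) \<longlonglongrightarrow> L 0 v"
      using continuous_on_tendsto_compose[OF polymap_continuous_on[OF polymap_L, of UNIV v], of "\<lambda>n. (1 / 2) ^ n *\<^sub>R x" 0] by simp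
    then have "(\<lambda>n. \<mu> \<bullet> L ((1 / 2) ^ n *\<^sub>R x) v) \<longlonglongrightarrow> \<mu> \<bullet> L 0 v"
      by (intro tendsto_intros)
    then show ?thesis using it by (simp add: L_zero LIMSEQ_const_iff)
  qed
  then show ?thesis using \<mu> by metis
qed

text \<open>The coordinate z \<mapsto> a \<bullet> z has the constant derivative a \<bullet> v along
  the field, so its powers differentiate as on the line.\<close>

lemma Xfield_horizontal_power:
  assumes a: "a \<in> V 1"
  shows "Xfield gm v (\<lambda>z. c * (a \<bullet> z + k) ^ n) x = c * n * (a \<bullet> v) * (a \<bullet> x + k) ^ (n - 1)"
proof -
  have pf: "(\<lambda>z. c * (a \<bullet> z + k) ^ n) \<in> polyfun"
    by (intro polyfun_cmult polyfun_power pf_add pf_const polyfun_inner polymap_const polymap_ident)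
  have "((\<lambda>z. c * (a \<bullet> z + k) ^ n) has_derivative (\<lambda>h. c * (n * (a \<bullet> h) * (a \<bullet> x + k) ^ (n - 1)))) (at x)"
    by (auto intro!: derivative_eq_intros simp: fun_eq_iff)
  then have "frechet_derivative (\<lambda>z. c * (a \<bullet> z + k) ^ n) (at x) = (\<lambda>h. c * (n * (a \<bullet> h) * (a \<bullet> x + k) ^ (n - 1)))"
    using frechet_derivative_at by metis
  then show ?thesis by (simp add: Xfield_eq[OF pf] L_inner_invariant[OF a])
qed

end

section \<open>Test functions and sup-convolutions\<close>

text \<open>For e > 0 the last term lifts an expansion above the expanded function near
  \<open>x\<close>, at the price of 2 e times the identity in the Hessian.\<close>

lemma quadratic_polyfun_second_order:
  assumes "linear A" and \<phi>: "\<And>y. \<phi> y = c + q \<bullet> (y - x) + A (y - x) \<bullet> (y - x) / 2 + e * (norm (y - x))\<^sup>2"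
  shows "\<phi> \<in> polyfun" and "second_order_at \<phi> x q (\<lambda>h. A h + (2 * e) *\<^sub>R h)"
proof -
  have d: "polymap (\<lambda>y. y - x)" by (intro polymap_diff polymap_ident polymap_const)
  have "(\<lambda>y. c + q \<bullet> (y - x) + 1 / 2 * (A (y - x) \<bullet> (y - x)) + e * (norm (y - x))\<^sup>2) \<in> polyfun"
    using d polymap_compose[OF polymap_linear[OF assms(1)] d]
    by (intro pf_add pf_const polyfun_inner polymap_const polyfun_cmult polyfun_norm_power2)
  then show "\<phi> \<in> polyfun" by (simp add: \<phi>[abs_def])
  have "linear (\<lambda>h. A h + (2 * e) *\<^sub>R h)"
    using assms(1) by (intro linear_compose_add linear_scaleR)
  moreover have "\<phi> y - \<phi> x - q \<bullet> (y - x) - (A (y - x) + (2 * e) *\<^sub>R (y - x)) \<bullet> (y - x) / 2 = 0" for y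
    unfolding \<phi> by (simp add: linear_0[OF assms(1)] inner_add_left add_divide_distrib dot_square_norm)
  ultimately show "second_order_at \<phi> x q (\<lambda>h. A h + (2 * e) *\<^sub>R h)"
    unfolding second_order_at_def by (simp del: eq_divide_eq_numeral1; meson zero_less_one)
qed

section \<open>Horizontal jets of polynomials and translated test functions\<close>

context carnot
begin

lemma Xfield_uminus:
  assumes "\<phi> \<in> polyfun" shows "Xfield gm v (\<lambda>x. - \<phi> x) = (\<lambda>x. - Xfield gm v \<phi> x)"
proof
  fix x
  have "(\<phi> has_derivative frechet_derivative \<phi> (at x)) (at x)"
    using polymap_derivative(1)[of \<phi> x] assms by (simp add: polymap_real)
  from has_derivative_minus[OF this]
  have "frechet_derivative (\<lambda>x. - \<phi> x) (at x) = (\<lambda>h. - frechet_derivative \<phi> (at x) h)"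
    using frechet_derivative_at by metis
  then show "Xfield gm v (\<lambda>x. - \<phi> x) x = - Xfield gm v \<phi> x"
    using assms by (simp add: Xfield_eq polyfun_uminus)
qed

lemma Xfield_cmult:
  assumes "\<phi> \<in> polyfun" shows "Xfield gm v (\<lambda>x. c * \<phi> x) = (\<lambda>x. c * Xfield gm v \<phi> x)"
proof
  fix x
  have "(\<phi> has_derivative frechet_derivative \<phi> (at x)) (at x)"
    using polymap_derivative(1)[of \<phi> x] assms by (simp add: polymap_real)
  from has_derivative_mult_right[OF this, of c]
  have "frechet_derivative (\<lambda>x. c * \<phi> x) (at x) = (\<lambda>h. c * frechet_derivative \<phi> (at x) h)"
    using frechet_derivative_at by metis
  then show "Xfield gm v (\<lambda>x. c * \<phi> x) x = c * Xfield gm v \<phi> x"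
    using assms by (simp add: Xfield_eq polyfun_cmult)
qed

lemma hgrad_add:
  assumes "\<phi> \<in> polyfun" "\<omega> \<in> polyfun"
  shows "hgrad gm X (\<lambda>x. \<phi> x + \<omega> x) x = hgrad gm X \<phi> x + hgrad gm X \<omega> x"
  unfolding hgrad_def Xfield_add[OF assms] by (simp add: vec_eq_iff)

lemma hhess_add:
  assumes "\<phi> \<in> polyfun" "\<omega> \<in> polyfun"
  shows "hhess gm X (\<lambda>x. \<phi> x + \<omega> x) x = hhess gm X \<phi> x + hhess gm X \<omega> x"
  unfolding hhess_def Xfield_add[OF assms] Xfield_add[OF polyfun_Xfield[OF assms(1)] polyfun_Xfield[OF assms(2)]]
  by (simp add: vec_eq_iff add_divide_distrib)

lemma hgrad_uminus: "\<phi> \<in> polyfun \<Longrightarrow> hgrad gm X (\<lambda>x. - \<phi> x) x = - hgrad gm X \<phi> x"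
  unfolding hgrad_def by (simp add: Xfield_uminus vec_eq_iff)

lemma hhess_uminus:
  assumes "\<phi> \<in> polyfun" shows "hhess gm X (\<lambda>x. - \<phi> x) x = - hhess gm X \<phi> x"
proof -
  have "hhess gm X (\<lambda>x. - \<phi> x) x $ i $ j = - hhess gm X \<phi> x $ i $ j" for i j
    unfolding hhess_def Xfield_uminus[OF assms] Xfield_uminus[OF polyfun_Xfield[OF assms]]
    by (simp add: field_simps)
  then show ?thesis by (simp add: vec_eq_iff)
qed

text \<open>Gradient and Hessian form vanish in every direction; polarisation then kills the
  matrix.\<close>

lemma hgrad_hhess_eq_0:
  assumes "\<phi> \<in> polyfun" "second_order_at \<phi> x 0 (\<lambda>h. 0)"
  shows "hgrad gm X \<phi> x = 0" "hhess gm X \<phi> x = 0"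
proof -
  have "hgrad gm X \<phi> x \<bullet> \<xi> = 0" for \<xi>
    unfolding hgrad_inner[OF assms(1)] Xfield_second_order(1)[OF assms] by simp
  then show "hgrad gm X \<phi> x = 0" by (metis inner_eq_zero_iff)
  have "\<xi> \<bullet> (hhess gm X \<phi> x *v \<xi>) = 0" for \<xi>
    unfolding hhess_form[OF assms(1)] Xfield_second_order(2)[OF assms] by simp
  then have "norm (hhess gm X \<phi> x) \<le> 0"
    using norm_symmat_le[OF hhess_symmats, of X \<phi> x 0] by simp
  then show "hhess gm X \<phi> x = 0" by simp
qed

text \<open>A quartic term turns a local test polynomial into a global one without changing its second order jet.\<close>

lemma globalize_test:
  assumes "\<phi> \<in> polyfun" "bounded \<Omega>" "\<And>x. x \<in> \<Omega> \<Longrightarrow> \<bar>w x\<bar> \<le> S" "x0 \<in> \<Omega>" "\<rho> > 0"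
    and loc: "\<And>x. x \<in> \<Omega> \<Longrightarrow> norm (x - x0) < \<rho> \<Longrightarrow> w x - \<phi> x \<le> w x0 - \<phi> x0"
  shows "\<exists>\<phi>'\<in>polyfun. hgrad gm X \<phi>' x0 = hgrad gm X \<phi> x0 \<and> hhess gm X \<phi>' x0 = hhess gm X \<phi> x0 \<and>
    (\<forall>x\<in>\<Omega>. w x - \<phi>' x \<le> w x0 - \<phi>' x0)"
proof -
  obtain M where M: "\<And>x. x \<in> \<Omega> \<Longrightarrow> \<bar>\<phi> x\<bar> \<le> M"
    using polymap_bounded_on[of \<phi> \<Omega>] assms(1,2) by (auto simp: polymap_real)
  \<comment> \<open>Makes the quartic at least 2 S + 2 M outside the ball of radius \<rho>, a bound
    for the variation of w - \<phi> on \<Omega>.\<close>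
  define k where "k = (2 * S + 2 * M) / \<rho> ^ 4"
  have "S \<ge> 0" "M \<ge> 0" using assms(3)[OF assms(4)] M[OF assms(4)] by linarith+
  then have k: "k \<ge> 0" unfolding k_def using \<open>\<rho> > 0\<close> by simp
  define \<omega> where "\<omega> x = k * ((norm (x - x0))\<^sup>2)\<^sup>2" for x
  have \<omega>: "\<omega> \<in> polyfun"
    unfolding \<omega>_def by (intro polyfun_cmult polyfun_power polyfun_norm_power2 polymap_diff polymap_ident polymap_const)
  have so: "second_order_at \<omega> x0 0 (\<lambda>h. 0)"
    unfolding second_order_at_def
  proof (intro conjI allI impI)
    show "linear (\<lambda>h::'a. 0::'a)" by (rule linear_zero)
    fix e :: real assume "e > 0"
    show "\<exists>d>0. \<forall>y. norm (y - x0) < d \<longrightarrow> \<bar>\<omega> y - \<omega> x0 - 0 \<bullet> (y - x0) - 0 \<bullet> (y - x0) / 2\<bar> \<le> e * (norm (y - x0))\<^sup>2"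
    proof (intro exI[of _ "min 1 (e / (k + 1))"] conjI allI impI)
      show "min 1 (e / (k + 1)) > 0" using \<open>e > 0\<close> k by simp
      fix y assume y: "norm (y - x0) < min 1 (e / (k + 1))"
      have "(norm (y - x0))\<^sup>2 \<le> norm (y - x0)"
        unfolding power2_eq_square using y by (intro mult_left_le) auto
      then have "k * (norm (y - x0))\<^sup>2 \<le> (k + 1) * norm (y - x0)"
        using k by (intro mult_mono) auto
      also have "\<dots> \<le> e" using y k by (simp add: field_simps)
      finally have "k * (norm (y - x0))\<^sup>2 * (norm (y - x0))\<^sup>2 \<le> e * (norm (y - x0))\<^sup>2"
        by (rule mult_right_mono) simp
      then show "\<bar>\<omega> y - \<omega> x0 - 0 \<bullet> (y - x0) - 0 \<bullet> (y - x0) / 2\<bar> \<le> e * (norm (y - x0))\<^sup>2"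
        unfolding \<omega>_def using k by (simp add: power2_eq_square[of "(norm (y - x0))\<^sup>2"] mult.assoc)
    qed
  qed
  show ?thesis
  proof (intro bexI[of _ "\<lambda>x. \<phi> x + \<omega> x"] conjI ballI)
    show "(\<lambda>x. \<phi> x + \<omega> x) \<in> polyfun" using assms(1) \<omega> by (rule pf_add)
    show "hgrad gm X (\<lambda>x. \<phi> x + \<omega> x) x0 = hgrad gm X \<phi> x0" "hhess gm X (\<lambda>x. \<phi> x + \<omega> x) x0 = hhess gm X \<phi> x0"
      using hgrad_hhess_eq_0[OF \<omega> so] by (simp_all add: hgrad_add[OF assms(1) \<omega>] hhess_add[OF assms(1) \<omega>])
    fix x assume x: "x \<in> \<Omega>"
    have \<omega>0: "\<omega> x0 = 0" and \<omega>p: "\<omega> x \<ge> 0" unfolding \<omega>_def using k by simp_all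
    show "w x - (\<phi> x + \<omega> x) \<le> w x0 - (\<phi> x0 + \<omega> x0)"
    proof (cases "norm (x - x0) < \<rho>")
      case True
      then show ?thesis using loc[OF x] \<omega>0 \<omega>p by simp
    next
      case False
      then have "\<rho> ^ 4 \<le> norm (x - x0) ^ 4" using \<open>\<rho> > 0\<close> by (intro power_mono) auto
      then have "k * \<rho> ^ 4 \<le> \<omega> x" unfolding \<omega>_def using k by (simp add: mult_left_mono flip: power_mult)
      then have "2 * S + 2 * M \<le> \<omega> x" unfolding k_def using \<open>\<rho> > 0\<close> by simp
      then show ?thesis
        using assms(3)[OF x] assms(3)[OF assms(4)] M[OF x] M[OF assms(4)] \<omega>0 unfolding abs_le_iff by linarith
    qed
  qed
qed

lemma Xfield_left_translate: "Xfield gm v (\<lambda>y. \<phi> (gm p y)) = (\<lambda>y. Xfield gm v \<phi> (gm p y))"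
  unfolding Xfield_def by (simp add: gm_assoc)

lemma hgrad_left_translate: "hgrad gm X (\<lambda>y. \<phi> (gm p y)) y = hgrad gm X \<phi> (gm p y)"
  unfolding hgrad_def Xfield_left_translate ..

lemma hhess_left_translate: "hhess gm X (\<lambda>y. \<phi> (gm p y)) y = hhess gm X \<phi> (gm p y)"
  unfolding hhess_def Xfield_left_translate ..

text \<open>Left translations commute with the fields, so a test function may be moved from \<open>x\<close> to \<open>p \<cdot> x\<close>.\<close>

lemma translated_test:
  assumes "\<phi> \<in> polyfun" "bounded \<Omega>" "\<And>x. x \<in> \<Omega> \<Longrightarrow> \<bar>w x\<bar> \<le> S" "gm p x \<in> \<Omega>" "\<rho> > 0"
    and loc: "\<And>x'. gm p x' \<in> \<Omega> \<Longrightarrow> norm (x' - x) < \<rho> \<Longrightarrow> w (gm p x') - \<phi> x' \<le> w (gm p x) - \<phi> x"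
  shows "\<exists>\<phi>'\<in>polyfun. hgrad gm X \<phi>' (gm p x) = hgrad gm X \<phi> x \<and> hhess gm X \<phi>' (gm p x) = hhess gm X \<phi> x \<and>
    (\<forall>y\<in>\<Omega>. w y - \<phi>' y \<le> w (gm p x) - \<phi>' (gm p x))"
proof -
  define \<omega> where "\<omega> y = \<phi> (gm (- p) y)" for y
  have \<omega>: "\<omega> \<in> polyfun"
    unfolding \<omega>_def by (intro polyfun_compose[OF assms(1)] polymap_gm polymap_const polymap_ident)
  have "continuous_on UNIV (gm (- p))"
    by (intro polymap_continuous_on polymap_gm polymap_const polymap_ident)
  then obtain d where d: "d > 0" "\<And>y. norm (y - gm p x) < d \<Longrightarrow> norm (gm (- p) y - gm (- p) (gm p x)) < \<rho>"
    unfolding continuous_on_iff dist_norm using \<open>\<rho> > 0\<close> by (metis UNIV_I)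
  have "w y - \<omega> y \<le> w (gm p x) - \<omega> (gm p x)" if "y \<in> \<Omega>" "norm (y - gm p x) < d" for y
    using loc[of "gm (- p) y"] d(2)[OF that(2)] that(1) by (simp add: \<omega>_def)
  then have "\<exists>\<phi>'\<in>polyfun. hgrad gm X \<phi>' (gm p x) = hgrad gm X \<omega> (gm p x) \<and> hhess gm X \<phi>' (gm p x) = hhess gm X \<omega> (gm p x) \<and>
    (\<forall>y\<in>\<Omega>. w y - \<phi>' y \<le> w (gm p x) - \<phi>' (gm p x))"
    by (intro globalize_test[OF \<omega> assms(2,3,4) d(1)])
  moreover have "\<omega> = (\<lambda>y. \<phi> (gm (- p) y))" unfolding \<omega>_def ..
  then have "hgrad gm X \<omega> (gm p x) = hgrad gm X \<phi> x" "hhess gm X \<omega> (gm p x) = hhess gm X \<phi> x"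
    by (simp_all add: hgrad_left_translate hhess_left_translate)
  ultimately show ?thesis by simp
qed

lemma visc_sub_translated_test:
  assumes "visc_sub gm X F \<Omega> w" and asm: "\<phi> \<in> polyfun" "bounded \<Omega>" "\<And>x. x \<in> \<Omega> \<Longrightarrow> \<bar>w x\<bar> \<le> S" "gm p x \<in> \<Omega>" "\<rho> > 0"
    "\<And>x'. gm p x' \<in> \<Omega> \<Longrightarrow> norm (x' - x) < \<rho> \<Longrightarrow> w (gm p x') - \<phi> x' \<le> w (gm p x) - \<phi> x"
  shows "F (w (gm p x)) (hgrad gm X \<phi> x) (hhess gm X \<phi> x) \<ge> 0"
proof -
  have "\<exists>\<phi>'\<in>polyfun. hgrad gm X \<phi>' (gm p x) = hgrad gm X \<phi> x \<and> hhess gm X \<phi>' (gm p x) = hhess gm X \<phi> x \<and>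
    (\<forall>y\<in>\<Omega>. w y - \<phi>' y \<le> w (gm p x) - \<phi>' (gm p x))"
    by (rule translated_test[OF asm])
  then obtain \<phi>' where *: "\<phi>' \<in> polyfun" "hgrad gm X \<phi>' (gm p x) = hgrad gm X \<phi> x" "hhess gm X \<phi>' (gm p x) = hhess gm X \<phi> x"
    "\<forall>y\<in>\<Omega>. w y - \<phi>' y \<le> w (gm p x) - \<phi>' (gm p x)"
    by (elim bexE conjE)
  then have "F (w (gm p x)) (hgrad gm X \<phi>' (gm p x)) (hhess gm X \<phi>' (gm p x)) \<ge> 0"
    using assms(1) asm(4) polyfun_C2_on[OF *(1), of \<Omega>] unfolding visc_sub_def by blast
  then show ?thesis using * by simp
qed

text \<open>\<open>translated_test\<close> applied to \<open>- w\<close> and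
  \<open>- \<phi>\<close>; negation passes through the jets.\<close>

lemma visc_super_translated_test:
  assumes "visc_super gm X F \<Omega> w" and asm: "\<phi> \<in> polyfun" "bounded \<Omega>" "\<And>x. x \<in> \<Omega> \<Longrightarrow> \<bar>w x\<bar> \<le> S" "gm p x \<in> \<Omega>" "\<rho> > 0"
    "\<And>x'. gm p x' \<in> \<Omega> \<Longrightarrow> norm (x' - x) < \<rho> \<Longrightarrow> w (gm p x') - \<phi> x' \<ge> w (gm p x) - \<phi> x"
  shows "F (w (gm p x)) (hgrad gm X \<phi> x) (hhess gm X \<phi> x) \<le> 0"
proof -
  have "\<exists>\<phi>'\<in>polyfun. hgrad gm X \<phi>' (gm p x) = hgrad gm X (\<lambda>x. - \<phi> x) x \<and> hhess gm X \<phi>' (gm p x) = hhess gm X (\<lambda>x. - \<phi> x) x \<and>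
    (\<forall>y\<in>\<Omega>. - w y - \<phi>' y \<le> - w (gm p x) - \<phi>' (gm p x))"
  proof (rule translated_test[OF polyfun_uminus[OF asm(1)] asm(2) _ asm(4,5), of "\<lambda>x. - w x" S X])
    show "- w (gm p x') - - \<phi> x' \<le> - w (gm p x) - - \<phi> x" if "gm p x' \<in> \<Omega>" "norm (x' - x) < \<rho>" for x'
      using asm(6)[OF that] by simp
  qed (use asm(3) in auto)
  then obtain \<phi>' where *: "\<phi>' \<in> polyfun" "hgrad gm X \<phi>' (gm p x) = hgrad gm X (\<lambda>x. - \<phi> x) x"
    "hhess gm X \<phi>' (gm p x) = hhess gm X (\<lambda>x. - \<phi> x) x"
    "\<forall>y\<in>\<Omega>. - w y - \<phi>' y \<le> - w (gm p x) - \<phi>' (gm p x)"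
    by (elim bexE conjE)
  have "w y - - \<phi>' y \<ge> w (gm p x) - - \<phi>' (gm p x)" if "y \<in> \<Omega>" for y
    using *(4) that by force
  then have "F (w (gm p x)) (hgrad gm X (\<lambda>x. - \<phi>' x) (gm p x)) (hhess gm X (\<lambda>x. - \<phi>' x) (gm p x)) \<le> 0"
    using assms(1) asm(4) polyfun_C2_on[OF polyfun_uminus[OF *(1)], of \<Omega>] unfolding visc_super_def by blast
  then show ?thesis
    using * asm(1) by (simp add: hgrad_uminus hhess_uminus)
qed

text \<open>Keeping the maximiser \<open>Y x\<close> as competitor at another point \<open>y\<close>
  gives W y - W x \<ge> Q (x, Y x) - Q (y, Y x). So \<open>W\<close> inherits from -Q, as a function
  of its first argument, a semiconvexity constant and a gradient bound, whatever the modulus of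
  continuity of \<open>w\<close>.\<close>

lemma sup_convolution:
  assumes "compact K" "K \<noteq> {}" "continuous_on K w" "\<epsilon> > 0"
  obtains W Y C M where "\<And>x. Y x \<in> K" "\<And>x. W x = w (Y x) - (norm (gm (Y x) (- x)))\<^sup>2 / \<epsilon>"
    "\<And>x y. y \<in> K \<Longrightarrow> w y - (norm (gm y (- x)))\<^sup>2 / \<epsilon> \<le> W x" "C \<ge> 0"
    "\<And>x. x \<in> K \<Longrightarrow> \<exists>g. norm g \<le> M \<and> semi_subgrad C K W x g"
proof -
  define Q where "Q z = 1 / \<epsilon> * (norm (gm (snd z) (- fst z)))\<^sup>2" for z :: "'a \<times> 'a"
  have Q: "Q \<in> polyfun"
    unfolding Q_def by (intro polyfun_cmult polyfun_norm_power2 polymap_gm polymap_uminus polymap_fst polymap_snd)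
  have "\<exists>y\<in>K. \<forall>y'\<in>K. w y' - Q (x, y') \<le> w y - Q (x, y)" for x
  proof (rule continuous_attains_sup[OF assms(1,2)])
    have "continuous_on K (\<lambda>y. Q (x, y))"
      by (intro polyfun_continuous_on polyfun_compose[OF Q] polymap_Pair polymap_const polymap_ident)
    then show "continuous_on K (\<lambda>y. w y - Q (x, y))" using assms(3) by (intro continuous_intros)
  qed
  then obtain Y where Y: "\<And>x. Y x \<in> K" "\<And>x y. y \<in> K \<Longrightarrow> w y - Q (x, y) \<le> w (Y x) - Q (x, Y x)" by metis
  define W where "W x = w (Y x) - Q (x, Y x)" for x
  have bK: "bounded (K \<times> K)" using assms(1) by (intro bounded_Times compact_imp_bounded)
  obtain g where g: "polymap g"
    "\<And>K. bounded K \<Longrightarrow> \<exists>C\<ge>0. \<forall>x\<in>K. \<forall>y\<in>K. \<bar>Q y - Q x - g x \<bullet> (y - x)\<bar> \<le> C * (norm (y - x))\<^sup>2"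
    using polyfun_gradient[OF Q] by metis
  obtain C where C: "C \<ge> 0" "\<And>z z'. z \<in> K \<times> K \<Longrightarrow> z' \<in> K \<times> K \<Longrightarrow> \<bar>Q z' - Q z - g z \<bullet> (z' - z)\<bar> \<le> C * (norm (z' - z))\<^sup>2"
    using g(2)[OF bK] by blast
  obtain M where M: "\<And>z. z \<in> K \<times> K \<Longrightarrow> norm (g z) \<le> M" using polymap_bounded_on[OF g(1) bK] by blast
  show thesis
  proof (rule that[of Y W C M])
    show "Y x \<in> K" for x by (rule Y)
    show "W x = w (Y x) - (norm (gm (Y x) (- x)))\<^sup>2 / \<epsilon>" for x unfolding W_def Q_def by simp
    show "w y - (norm (gm y (- x)))\<^sup>2 / \<epsilon> \<le> W x" if "y \<in> K" for x y
      using Y(2)[OF that, of x] unfolding W_def Q_def by simp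
    show "C \<ge> 0" by fact
    fix x assume x: "x \<in> K"
    have "semi_subgrad C K W x (- fst (g (x, Y x)))"
      unfolding semi_subgrad_def
    proof
      fix y assume y: "y \<in> K"
      have "w (Y x) - Q (y, Y x) \<le> W y" using Y(2)[OF Y(1)] unfolding W_def .
      moreover have "\<bar>Q (y, Y x) - Q (x, Y x) - g (x, Y x) \<bullet> ((y, Y x) - (x, Y x))\<bar> \<le> C * (norm ((y, Y x) - (x, Y x)))\<^sup>2"
        using x y Y(1) by (intro C) auto
      moreover have "g (x, Y x) \<bullet> ((y, Y x) - (x, Y x)) = fst (g (x, Y x)) \<bullet> (y - x)"
        by (simp add: inner_prod_def)
      moreover have "norm ((y, Y x) - (x, Y x)) = norm (y - x)" by (simp add: norm_Pair)
      ultimately show "W x + - fst (g (x, Y x)) \<bullet> (y - x) - C * (norm (y - x))\<^sup>2 \<le> W y"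
        unfolding W_def by (simp add: abs_le_iff)
    qed
    moreover have "norm (- fst (g (x, Y x))) \<le> M"
      using order_trans[OF norm_fst_le[of "fst (g (x, Y x))" "snd (g (x, Y x))"]] M[of "(x, Y x)"] x Y(1) by simp
    ultimately show "\<exists>g. norm g \<le> M \<and> semi_subgrad C K W x g" by blast
  qed
qed

text \<open>Converts a small group displacement \<open>gm y (- x)\<close> into a small Euclidean
  distance, uniformly for \<open>x\<close> in a compact set.\<close>

lemma gm_uniformly_near_identity:
  assumes "compact K" "\<rho> > 0"
  obtains \<eta> where "\<eta> > 0" "\<And>p x. norm p < \<eta> \<Longrightarrow> x \<in> K \<Longrightarrow> norm (gm p x - x) < \<rho>"
proof -
  have "uniformly_continuous_on (cball 0 1 \<times> K) (\<lambda>z. gm (fst z) (snd z))"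
    using assms(1) by (intro compact_uniformly_continuous polymap_continuous_on polymap_gm_pair compact_Times) auto
  then obtain d where d: "d > 0" "\<And>z z'. z \<in> cball 0 1 \<times> K \<Longrightarrow> z' \<in> cball 0 1 \<times> K \<Longrightarrow> dist z' z < d \<Longrightarrow>
      dist (gm (fst z') (snd z')) (gm (fst z) (snd z)) < \<rho>"
    unfolding uniformly_continuous_on_def using assms(2) by metis
  show thesis
  proof
    show "min 1 d > 0" using d by simp
    fix p x :: 'a assume "norm p < min 1 d" "x \<in> K"
    then show "norm (gm p x - x) < \<rho>"
      using d(2)[of "(0, x)" "(p, x)"] by (simp add: dist_norm norm_Pair)
  qed
qed

end

section \<open>The doubling argument\<close>

lemma norm_le_of_inner_le:
  fixes w :: "'a::real_inner"
  assumes "\<And>\<xi>. \<bar>w \<bullet> \<xi>\<bar> \<le> B * norm \<xi>" "B \<ge> 0" shows "norm w \<le> B"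
proof (cases "w = 0")
  case False
  have "norm w * norm w \<le> B * norm w" using assms(1)[of w] by (simp add: dot_square_norm power2_eq_square)
  then show ?thesis using False by simp
qed (use assms in simp)

lemma semi_subgrad_mono:
  "semi_subgrad C S f x q \<Longrightarrow> T \<subseteq> S \<Longrightarrow> C \<le> C' \<Longrightarrow> semi_subgrad C' T f x q"
proof -
  assume sg: "semi_subgrad C S f x q" and "T \<subseteq> S" "C \<le> C'"
  show ?thesis
    unfolding semi_subgrad_def
  proof
    fix y assume "y \<in> T"
    then have "f x + q \<bullet> (y - x) - C * (norm (y - x))\<^sup>2 \<le> f y"
      using sg \<open>T \<subseteq> S\<close> unfolding semi_subgrad_def by blast
    moreover have "C * (norm (y - x))\<^sup>2 \<le> C' * (norm (y - x))\<^sup>2"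
      using \<open>C \<le> C'\<close> by (rule mult_right_mono) simp
    ultimately show "f x + q \<bullet> (y - x) - C' * (norm (y - x))\<^sup>2 \<le> f y" by linarith
  qed
qed

lemma semi_subgrad_add:
  assumes "semi_subgrad C S f x p" "semi_subgrad C' S g x q"
  shows "semi_subgrad (C + C') S (\<lambda>y. f y + g y) x (p + q)"
  unfolding semi_subgrad_def
proof
  fix y assume "y \<in> S"
  then have "f x + p \<bullet> (y - x) - C * (norm (y - x))\<^sup>2 \<le> f y" "g x + q \<bullet> (y - x) - C' * (norm (y - x))\<^sup>2 \<le> g y"
    using assms unfolding semi_subgrad_def by auto
  then show "f x + g x + (p + q) \<bullet> (y - x) - (C + C') * (norm (y - x))\<^sup>2 \<le> f y + g y"
    by (simp add: inner_add_left distrib_right)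
qed

lemma semi_subgrad_neg_square:
  assumes "\<kappa> \<le> C" shows "semi_subgrad C S (\<lambda>y. - \<kappa> * (norm (y - x0))\<^sup>2) x (- (2 * \<kappa>) *\<^sub>R (x - x0))"
  unfolding semi_subgrad_def
proof
  fix y
  have "(norm (y - x0))\<^sup>2 = (norm (x - x0))\<^sup>2 + 2 * ((x - x0) \<bullet> (y - x)) + (norm (y - x))\<^sup>2"
    by (simp add: power2_norm_eq_inner inner_simps inner_commute)
  then have "\<kappa> * (norm (y - x0))\<^sup>2 = \<kappa> * (norm (x - x0))\<^sup>2 + 2 * \<kappa> * ((x - x0) \<bullet> (y - x)) + \<kappa> * (norm (y - x))\<^sup>2"
    by (simp only: distrib_left mult.left_commute mult.commute)
  then have "- \<kappa> * (norm (y - x0))\<^sup>2 = - \<kappa> * (norm (x - x0))\<^sup>2 + (- (2 * \<kappa>) *\<^sub>R (x - x0)) \<bullet> (y - x) - \<kappa> * (norm (y - x))\<^sup>2"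
    by (simp add: inner_scaleR_left)
  moreover have "\<kappa> * (norm (y - x))\<^sup>2 \<le> C * (norm (y - x))\<^sup>2" using assms by (intro mult_right_mono) auto
  ultimately show "- \<kappa> * (norm (x - x0))\<^sup>2 + (- (2 * \<kappa>) *\<^sub>R (x - x0)) \<bullet> (y - x) - C * (norm (y - x))\<^sup>2 \<le> - \<kappa> * (norm (y - x0))\<^sup>2"
    by linarith
qed

text \<open>The maximum of the tilted sum makes the sum of the two forms nonpositive. Semiconvexity
  bounds each form from below, hence each from above through the other.\<close>

lemma contact_hessian_bounds:
  assumes so: "second_order_at f x q1 A1" "second_order_at g x q2 A2"
    and sub: "semi_subgrad C B f x q1" "semi_subgrad C B g x q2" and B: "ball x \<rho> \<subseteq> B" "\<rho> > 0"
    and sum: "q1 + q2 + p = 0" and mx: "\<And>y. y \<in> B \<Longrightarrow> f y + g y + p \<bullet> y \<le> f x + g x + p \<bullet> x"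
  shows "A1 h \<bullet> h + A2 h \<bullet> h \<le> 0" "\<bar>A1 h \<bullet> h\<bar> \<le> 2 * C * (norm h)\<^sup>2" "\<bar>A2 h \<bullet> h\<bar> \<le> 2 * C * (norm h)\<^sup>2"
proof -
  have mem: "y \<in> B" if "norm (y - x) < \<rho>" for y using that B by (auto simp: subset_eq dist_norm norm_minus_commute)
  have q: "q1 + q2 = - p" using sum by (simp add: add_eq_0_iff2)
  have "(A1 h + A2 h) \<bullet> h \<le> 2 * 0 * (norm h)\<^sup>2"
  proof (rule second_order_at_le[OF second_order_at_add[OF so] B(2)])
    fix y assume "norm (y - x) < \<rho>"
    from mx[OF mem[OF this]] show "f y + g y \<le> f x + g x + (q1 + q2) \<bullet> (y - x) + 0 * (norm (y - x))\<^sup>2"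
      unfolding q by (simp add: inner_diff_right)
  qed
  then show 1: "A1 h \<bullet> h + A2 h \<bullet> h \<le> 0" by (simp add: inner_add_left)
  have low: "- A h \<bullet> h \<le> 2 * C * (norm h)\<^sup>2" if "second_order_at k x q A" "semi_subgrad C B k x q" for k q A
  proof (rule second_order_at_le[OF second_order_at_uminus[OF that(1)] B(2)])
    fix y assume "norm (y - x) < \<rho>"
    then show "- k y \<le> - k x + - q \<bullet> (y - x) + C * (norm (y - x))\<^sup>2"
      using that(2) mem unfolding semi_subgrad_def by fastforce
  qed
  show "\<bar>A1 h \<bullet> h\<bar> \<le> 2 * C * (norm h)\<^sup>2" "\<bar>A2 h \<bullet> h\<bar> \<le> 2 * C * (norm h)\<^sup>2"
    using 1 low[OF so(1) sub(1)] low[OF so(2) sub(2)] by (simp_all add: abs_le_iff)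
qed

context carnot
begin

text \<open>\<open>B\<close> is chosen before \<tau>: it comes from the fixed regularisation, while
  \<tau> governs only the tilt, the localising penalty and the correction of the expansions. This
  order of quantifiers keeps all jets in one compact set. The numbers \<open>r\<close> and
  \<open>s\<close> are the values of \<open>u\<close> and \<open>v\<close> at the two maximisers,
  and \<psi> is room for a barrier.\<close>

lemma doubling_contact:
  fixes X :: "'m::finite \<Rightarrow> 'a" and F :: "real \<Rightarrow> real^'m \<Rightarrow> real^'m^'m \<Rightarrow> real"
  assumes \<Omega>: "open \<Omega>" "bounded \<Omega>"
    and u: "continuous_on (closure \<Omega>) u" "visc_sub gm X F \<Omega> u"
    and v: "continuous_on (closure \<Omega>) v" "visc_super gm X F \<Omega> v"
    and "b \<ge> 0" "\<theta> > 0" and bd: "\<And>x. x \<in> frontier \<Omega> \<Longrightarrow> u x - v x \<le> b"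
    and xh: "xh \<in> \<Omega>" "u xh - v xh \<ge> b + 4 * \<theta>"
    and \<psi>: "\<psi> \<in> polyfun" "\<And>x. x \<in> closure \<Omega> \<Longrightarrow> 0 \<le> \<psi> x" "\<And>x. x \<in> closure \<Omega> \<Longrightarrow> \<psi> x \<le> \<theta>"
  shows "\<exists>B. \<forall>\<tau>>0. \<exists>r s p1 p2 M1 M2 x. x \<in> \<Omega> \<and> r \<ge> s + 2 * \<theta> \<and> \<bar>r\<bar> \<le> B \<and> \<bar>s\<bar> \<le> B \<and>
     norm p1 \<le> B \<and> norm p2 \<le> B \<and> norm M1 \<le> B \<and> norm M2 \<le> B \<and> M1 \<in> symmats \<and> M2 \<in> symmats \<and>
     F r p1 M1 \<ge> 0 \<and> F s p2 M2 \<le> 0 \<and> norm (p2 - p1 - hgrad gm X \<psi> x) \<le> \<tau> \<and>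
     (\<forall>\<xi>. \<xi> \<bullet> (M1 *v \<xi>) + \<xi> \<bullet> (hhess gm X \<psi> x *v \<xi>) \<le> \<xi> \<bullet> (M2 *v \<xi>) + \<tau> * (norm \<xi>)\<^sup>2)"
proof -
  define K where "K = closure \<Omega>"
  have K: "compact K" "K \<noteq> {}" "\<Omega> \<subseteq> K" unfolding K_def using \<Omega> xh closure_subset by auto
  have bK: "bounded K" using K(1) by (rule compact_imp_bounded)
  have in\<Omega>: "x \<in> \<Omega>" if "x \<in> K" "u x - v x > b" for x
    using that bd[of x] \<Omega>(1) unfolding K_def frontier_def by (auto simp: interior_open)
  obtain S where S: "\<And>x. x \<in> K \<Longrightarrow> \<bar>u x\<bar> \<le> S" "\<And>x. x \<in> K \<Longrightarrow> \<bar>v x\<bar> \<le> S" "S \<ge> 0"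
  proof -
    have "bounded (u ` K)" "bounded (v ` K)"
      using K(1) u(1) v(1) unfolding K_def by (auto intro!: compact_imp_bounded compact_continuous_image)
    then obtain S1 S2 where "\<forall>y\<in>u ` K. norm y \<le> S1" "\<forall>y\<in>v ` K. norm y \<le> S2" unfolding bounded_iff by blast
    then show thesis by (intro that[of "max 0 (max S1 S2)"]) (auto simp: le_max_iff_disj)
  qed
  obtain \<eta> where \<eta>: "\<eta> > 0" "\<And>x y. x \<in> K \<Longrightarrow> y \<in> K \<Longrightarrow> norm (gm y (- x)) < \<eta> \<Longrightarrow> \<bar>u y - u x\<bar> < \<theta> / 2 \<and> \<bar>v y - v x\<bar> < \<theta> / 2"
  proof -
    have "uniformly_continuous_on K u" "uniformly_continuous_on K v"
      using K(1) u(1) v(1) unfolding K_def by (auto intro: compact_uniformly_continuous)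
    then obtain d1 d2 where d: "d1 > 0" "d2 > 0"
      "\<And>x y. x \<in> K \<Longrightarrow> y \<in> K \<Longrightarrow> dist y x < d1 \<Longrightarrow> dist (u y) (u x) < \<theta> / 2"
      "\<And>x y. x \<in> K \<Longrightarrow> y \<in> K \<Longrightarrow> dist y x < d2 \<Longrightarrow> dist (v y) (v x) < \<theta> / 2"
      unfolding uniformly_continuous_on_def using \<open>\<theta> > 0\<close> by (metis half_gt_zero)
    obtain \<eta> where \<eta>: "\<eta> > 0" "\<And>p x. norm p < \<eta> \<Longrightarrow> x \<in> K \<Longrightarrow> norm (gm p x - x) < min d1 d2"
      using gm_uniformly_near_identity[OF K(1), of "min d1 d2"] d by (metis min_less_iff_conj)
    show thesis
    proof (rule that[OF \<eta>(1)])
      fix x y assume xy: "x \<in> K" "y \<in> K" "norm (gm y (- x)) < \<eta>"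
      then have "norm (gm (gm y (- x)) x - x) < min d1 d2" using \<eta>(2) by blast
      then have "dist y x < min d1 d2" by (simp add: gm_assoc dist_norm)
      then show "\<bar>u y - u x\<bar> < \<theta> / 2 \<and> \<bar>v y - v x\<bar> < \<theta> / 2" using d xy by (simp add: dist_real_def)
    qed
  qed
  \<comment> \<open>At relevant points the penalty is at most 2 S, so squared displacements are at
    most 2 S \<epsilon>, less than \<eta> squared.\<close>
  define \<epsilon> where "\<epsilon> = \<eta>\<^sup>2 / (2 * S + 1)"
  have \<epsilon>: "\<epsilon> > 0" unfolding \<epsilon>_def using \<eta> S by simp
  obtain U Y1 C1 L1 where Y1: "\<And>x. Y1 x \<in> K" and U: "\<And>x. U x = u (Y1 x) - (norm (gm (Y1 x) (- x)))\<^sup>2 / \<epsilon>"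
    and U_ge: "\<And>x y. y \<in> K \<Longrightarrow> u y - (norm (gm y (- x)))\<^sup>2 / \<epsilon> \<le> U x"
    and C1: "C1 \<ge> 0" and U_sg: "\<And>x. x \<in> K \<Longrightarrow> \<exists>g. norm g \<le> L1 \<and> semi_subgrad C1 K U x g"
    using sup_convolution[OF K(1,2) _ \<epsilon>, of u] u(1) unfolding K_def by metis
  have "continuous_on K (\<lambda>x. - v x)" using v(1) unfolding K_def by (intro continuous_intros)
  then obtain W Y2 C2 L2 where Y2: "\<And>x. Y2 x \<in> K" and W: "\<And>x. W x = - v (Y2 x) - (norm (gm (Y2 x) (- x)))\<^sup>2 / \<epsilon>"
    and W_ge: "\<And>x y. y \<in> K \<Longrightarrow> - v y - (norm (gm y (- x)))\<^sup>2 / \<epsilon> \<le> W x"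
    and C2: "C2 \<ge> 0" and W_sg: "\<And>x. x \<in> K \<Longrightarrow> \<exists>g. norm g \<le> L2 \<and> semi_subgrad C2 K W x g"
    using sup_convolution[OF K(1,2) _ \<epsilon>, of "\<lambda>x. - v x"] by metis
  \<comment> \<open>Where U + W is large, \<open>x\<close> and both maximisers are so close that u -
    v exceeds \<open>b\<close> at each of them, which excludes the boundary.\<close>
  have near: "x \<in> \<Omega> \<and> Y1 x \<in> \<Omega> \<and> Y2 x \<in> \<Omega>" if x: "x \<in> K" "U x + W x \<ge> b + 2 * \<theta>" for x
  proof -
    let ?n1 = "(norm (gm (Y1 x) (- x)))\<^sup>2" and ?n2 = "(norm (gm (Y2 x) (- x)))\<^sup>2"
    have sum: "u (Y1 x) - v (Y2 x) - ?n1 / \<epsilon> - ?n2 / \<epsilon> \<ge> b + 2 * \<theta>" using x(2) U W by simp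
    have "0 \<le> ?n1 / \<epsilon>" "0 \<le> ?n2 / \<epsilon>" using \<epsilon> by simp_all
    then have "?n1 / \<epsilon> \<le> 2 * S" "?n2 / \<epsilon> \<le> 2 * S" and uv: "u (Y1 x) - v (Y2 x) \<ge> b + 2 * \<theta>"
      using sum S(1)[OF Y1[of x]] S(2)[OF Y2[of x]] \<open>b \<ge> 0\<close> \<open>\<theta> > 0\<close> unfolding abs_le_iff by linarith+
    then have "?n1 \<le> 2 * S * \<epsilon>" "?n2 \<le> 2 * S * \<epsilon>" using \<epsilon> by (simp_all add: pos_divide_le_eq)
    moreover have "2 * S * \<epsilon> < \<eta>\<^sup>2"
    proof -
      have "2 * S * \<epsilon> < (2 * S + 1) * \<epsilon>" using \<epsilon> by simp
      also have "\<dots> = \<eta>\<^sup>2" unfolding \<epsilon>_def using S(3) by simp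
      finally show ?thesis .
    qed
    ultimately have "norm (gm (Y1 x) (- x)) < \<eta>" "norm (gm (Y2 x) (- x)) < \<eta>"
      using \<eta>(1) by (auto intro!: power2_less_imp_less[of _ \<eta>])
    then have "\<bar>u (Y1 x) - u x\<bar> < \<theta> / 2" "\<bar>v (Y1 x) - v x\<bar> < \<theta> / 2" "\<bar>u (Y2 x) - u x\<bar> < \<theta> / 2" "\<bar>v (Y2 x) - v x\<bar> < \<theta> / 2"
      using \<eta>(2)[OF x(1) Y1] \<eta>(2)[OF x(1) Y2] by blast+
    then have "u x - v x > b" "u (Y1 x) - v (Y1 x) > b" "u (Y2 x) - v (Y2 x) > b"
      using uv \<open>\<theta> > 0\<close> unfolding abs_less_iff by linarith+
    then show ?thesis using in\<Omega> x(1) Y1 Y2 by blast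
  qed
  have cont: "continuous_on K (\<lambda>x. U x + W x + \<psi> x)"
    using semi_subgrad_continuous_on[OF C1 U_sg] semi_subgrad_continuous_on[OF C2 W_sg] polyfun_continuous_on[OF \<psi>(1)]
    by (intro continuous_intros)
  obtain x0 where x0: "x0 \<in> K" "\<And>y. y \<in> K \<Longrightarrow> U y + W y + \<psi> y \<le> U x0 + W x0 + \<psi> x0"
    using continuous_attains_sup[OF K(1,2) cont] by (elim bexE) blast
  \<comment> \<open>Zero displacement is admissible, so U \<ge> u and W \<ge> - v at
    \<open>xh\<close>.\<close>
  have x0b: "U x0 + W x0 + \<psi> x0 \<ge> b + 4 * \<theta>"
  proof -
    have xhK: "xh \<in> K" using xh K by blast
    have "u xh \<le> U xh" "- v xh \<le> W xh" using U_ge[OF xhK, of xh] W_ge[OF xhK, of xh] by simp_all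
    moreover have "0 \<le> \<psi> xh" using \<psi>(2) xhK K_def by blast
    ultimately show ?thesis using x0(2)[OF xhK] xh(2) by linarith
  qed
  have "\<psi> x0 \<le> \<theta>" using \<psi>(3) x0(1) K_def by blast
  then have "U x0 + W x0 \<ge> b + 2 * \<theta>" using x0b \<open>\<theta> > 0\<close> by linarith
  then have "x0 \<in> \<Omega>" using near x0(1) by blast
  then obtain R where R: "R > 0" "cball x0 R \<subseteq> \<Omega>" using \<Omega>(1) open_contains_cball by blast
  have RK: "cball x0 R \<subseteq> K" using R K by blast
  obtain g\<psi> where g\<psi>: "polymap g\<psi>"
    "\<And>K. bounded K \<Longrightarrow> \<exists>C\<ge>0. \<forall>x\<in>K. \<forall>y\<in>K. \<bar>\<psi> y - \<psi> x - g\<psi> x \<bullet> (y - x)\<bar> \<le> C * (norm (y - x))\<^sup>2"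
    using polyfun_gradient[OF \<psi>(1)] by metis
  obtain C3 where C3: "C3 \<ge> 0" "\<And>x y. x \<in> K \<Longrightarrow> y \<in> K \<Longrightarrow> \<bar>\<psi> y - \<psi> x - g\<psi> x \<bullet> (y - x)\<bar> \<le> C3 * (norm (y - x))\<^sup>2"
    using g\<psi>(2)[OF bK] by blast
  obtain L3 where L3: "\<And>x. x \<in> K \<Longrightarrow> norm (g\<psi> x) \<le> L3" using polymap_bounded_on[OF g\<psi>(1) bK] by blast
  have \<psi>_sg: "semi_subgrad C3 K \<psi> x (g\<psi> x)" if "x \<in> K" for x
    unfolding semi_subgrad_def using C3(2)[OF that] by (auto simp: abs_le_iff) (smt (verit))
  \<comment> \<open>The summand 1 covers the penalty -t |y - x0|^2, whose weight will satisfy t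
    \<le> 1.\<close>
  define C where "C = C1 + C2 + C3 + 1"
  have C: "C \<ge> 0" unfolding C_def using C1 C2 C3 by simp
  have L_nonneg: "L1 \<ge> 0" "L2 \<ge> 0" "L3 \<ge> 0"
    using U_sg[OF x0(1)] W_sg[OF x0(1)] L3[OF x0(1)] by (meson norm_ge_zero order_trans)+
  define Lc where "Lc = L1 + L2 + L3 + 2 * R"
  have Lc: "Lc \<ge> 0" unfolding Lc_def using L_nonneg R by simp
  define \<nu> where "\<nu> y = (norm (y - x0))\<^sup>2" for y :: 'a
  have \<nu>: "\<nu> \<in> polyfun" unfolding \<nu>_def by (intro polyfun_norm_power2 polymap_diff polymap_ident polymap_const)
  obtain \<Gamma> where \<Gamma>: "\<Gamma> \<ge> 0" "\<And>x \<xi>. x \<in> K \<Longrightarrow> norm (curve1 x (horizontal_vec X \<xi>)) \<le> \<Gamma> * norm \<xi>"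
    "\<And>x \<xi>. x \<in> K \<Longrightarrow> norm (curve2 x (horizontal_vec X \<xi>)) \<le> \<Gamma> * (norm \<xi>)\<^sup>2"
    using curve_bounds[OF bK, of X] by metis
  have jet_bd: "\<exists>N\<ge>0. \<forall>x\<in>K. \<forall>\<xi>. \<bar>hgrad gm X \<omega> x \<bullet> \<xi>\<bar> \<le> N * norm \<xi> \<and> \<bar>\<xi> \<bullet> (hhess gm X \<omega> x *v \<xi>)\<bar> \<le> N * (norm \<xi>)\<^sup>2"
    if \<omega>: "\<omega> \<in> polyfun" for \<omega>
  proof -
    obtain N1 where N1: "\<And>x. x \<in> K \<Longrightarrow> norm (hgrad gm X \<omega> x) \<le> N1" "N1 \<ge> 0"
      using polymap_bounded_on[OF polymap_hgrad[OF \<omega>] bK] by metis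
    obtain N2 where N2: "\<And>x. x \<in> K \<Longrightarrow> norm (hhess gm X \<omega> x) \<le> N2" "N2 \<ge> 0"
      using polymap_bounded_on[OF polymap_hhess[OF \<omega>] bK] by metis
    show ?thesis
    proof (intro exI[of _ "N1 + N2"] conjI ballI allI)
      fix x \<xi> assume x: "x \<in> K"
      have "\<bar>hgrad gm X \<omega> x \<bullet> \<xi>\<bar> \<le> norm (hgrad gm X \<omega> x) * norm \<xi>" by (rule Cauchy_Schwarz_ineq2)
      also have "\<dots> \<le> (N1 + N2) * norm \<xi>" using N1(1)[OF x] N2(2) by (intro mult_right_mono) auto
      finally show "\<bar>hgrad gm X \<omega> x \<bullet> \<xi>\<bar> \<le> (N1 + N2) * norm \<xi>" .
      have "\<bar>\<xi> \<bullet> (hhess gm X \<omega> x *v \<xi>)\<bar> \<le> norm (hhess gm X \<omega> x) * (norm \<xi>)\<^sup>2" by (rule abs_matrix_form_le)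
      also have "\<dots> \<le> (N1 + N2) * (norm \<xi>)\<^sup>2" using N2(1)[OF x] N1(2) by (intro mult_right_mono) auto
      finally show "\<bar>\<xi> \<bullet> (hhess gm X \<omega> x *v \<xi>)\<bar> \<le> (N1 + N2) * (norm \<xi>)\<^sup>2" .
    qed (use N1 N2 in simp)
  qed
  obtain N\<psi> where N\<psi>: "N\<psi> \<ge> 0" "\<And>x \<xi>. x \<in> K \<Longrightarrow> \<bar>hgrad gm X \<psi> x \<bullet> \<xi>\<bar> \<le> N\<psi> * norm \<xi>"
    "\<And>x \<xi>. x \<in> K \<Longrightarrow> \<bar>\<xi> \<bullet> (hhess gm X \<psi> x *v \<xi>)\<bar> \<le> N\<psi> * (norm \<xi>)\<^sup>2" using jet_bd[OF \<psi>(1)] by metis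
  obtain N where N: "N \<ge> 0" "\<And>x \<xi>. x \<in> K \<Longrightarrow> \<bar>hgrad gm X \<nu> x \<bullet> \<xi>\<bar> \<le> N * norm \<xi>"
    "\<And>x \<xi>. x \<in> K \<Longrightarrow> \<bar>\<xi> \<bullet> (hhess gm X \<nu> x *v \<xi>)\<bar> \<le> N * (norm \<xi>)\<^sup>2" using jet_bd[OF \<nu>] by metis
  \<comment> \<open>Errors per unit of \<open>t\<close> in the final matrix inequality: 2 \<Gamma>
    from the tilt acting on \<open>curve2\<close>, 4 \<Gamma>^2 from the two corrections t |y -
    x|^2, and N from the penalty. The 1 ensures positivity.\<close>
  define D where "D = 2 * \<Gamma> + 4 * \<Gamma>\<^sup>2 + N + 1"
  have D: "D > 0" unfolding D_def using \<Gamma> N by (smt (verit) zero_le_power2)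
  define Kp where "Kp = Lc * \<Gamma> + N\<psi> + N"
  have Kp: "Kp \<ge> 0" unfolding Kp_def using Lc \<Gamma> N N\<psi> by simp
  define Km where "Km = 2 * Lc * \<Gamma> + (2 * C + 2) * \<Gamma>\<^sup>2 + N\<psi> + N"
  have Km: "Km \<ge> 0" unfolding Km_def using Lc \<Gamma> N N\<psi> C by simp
  define B where "B = S + Kp + real CARD('m) * real CARD('m) * Km"
  have B: "S \<le> B" "Kp \<le> B" "real CARD('m) * real CARD('m) * Km \<le> B" unfolding B_def using S Kp Km by simp_all
  show ?thesis
  proof (rule exI[of _ B], intro allI impI)
    fix \<tau> :: real assume "\<tau> > 0"
    \<comment> \<open>One small number serves as penalty weight, tilt bound and correction of the
      expansions; t R \<le> \<theta> keeps the effect of the tilt within its share.\<close>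
    define t where "t = min 1 (min (\<theta> / R) (\<tau> / D))"
    have t: "t > 0" "t \<le> 1" "t * R \<le> \<theta>" "t * D \<le> \<tau>"
    proof -
      show "t > 0" "t \<le> 1" unfolding t_def using \<open>\<theta> > 0\<close> \<open>\<tau> > 0\<close> R D by simp_all
      have "t \<le> \<theta> / R" "t \<le> \<tau> / D" unfolding t_def by simp_all
      then show "t * R \<le> \<theta>" "t * D \<le> \<tau>" using R D by (simp_all add: pos_le_divide_eq)
    qed
    \<comment> \<open>\<open>U\<close> takes the first slot of Jensen's lemma, and the barrier joins
      \<open>W\<close> in the second. The quadratic penalty makes \<open>x0\<close> a strict maximum
      on the ball.\<close>
    define g where "g y = W y + \<psi> y + - t * (norm (y - x0))\<^sup>2" for y
    have sgf: "\<exists>p. norm p \<le> Lc \<and> semi_subgrad C (cball x0 R) U y p" if y: "y \<in> cball x0 R" for y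
    proof -
      obtain p where p: "norm p \<le> L1" "semi_subgrad C1 K U y p" using U_sg y RK by blast
      then have "semi_subgrad C (cball x0 R) U y p"
        by (intro semi_subgrad_mono[OF p(2) RK]) (simp add: C_def C2 C3)
      moreover have "norm p \<le> Lc" using p(1) L_nonneg R unfolding Lc_def by simp
      ultimately show ?thesis by blast
    qed
    have sgg: "\<exists>p. norm p \<le> Lc \<and> semi_subgrad C (cball x0 R) g y p" if y: "y \<in> cball x0 R" for y
    proof -
      have yK: "y \<in> K" using y RK by blast
      obtain p where p: "norm p \<le> L2" "semi_subgrad C2 K W y p" using W_sg yK by blast
      let ?q = "p + g\<psi> y + - (2 * t) *\<^sub>R (y - x0)"
      have "semi_subgrad (C2 + C3 + 1) K g y ?q"
        unfolding g_def
        by (intro semi_subgrad_add p(2) \<psi>_sg yK semi_subgrad_neg_square t)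
      then have "semi_subgrad C (cball x0 R) g y ?q"
        by (rule semi_subgrad_mono[OF _ RK]) (simp add: C_def C1)
      moreover have "norm ?q \<le> Lc"
      proof -
        have "norm ?q \<le> norm p + norm (g\<psi> y) + norm (- (2 * t) *\<^sub>R (y - x0))"
          by (intro norm_triangle_le add_right_mono norm_triangle_ineq)
        also have "norm (- (2 * t) *\<^sub>R (y - x0)) \<le> 2 * R"
        proof -
          have "norm (y - x0) \<le> R" using y by (simp add: dist_norm norm_minus_commute)
          then have "2 * (t * norm (y - x0)) \<le> 2 * (1 * R)" using t R by (intro mult_left_mono mult_mono) auto
          then show ?thesis using t by simp
        qed
        finally show ?thesis using p(1) L3[OF yK] L_nonneg unfolding Lc_def by simp
      qed
      ultimately show ?thesis by blast
    qed
    have strict: "U y + g y \<le> U x0 + g x0 - t * (norm (y - x0))\<^sup>2" if "y \<in> cball x0 R" for y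
      using x0(2)[of y] that RK unfolding g_def by auto
    obtain x p q1 q2 A1 A2 where x: "x \<in> ball x0 R" and p: "norm p < t" and sum: "q1 + q2 + p = 0"
      and q: "norm q1 \<le> Lc" "norm q2 \<le> Lc"
      and mx: "\<forall>y\<in>cball x0 R. U y + g y + p \<bullet> y \<le> U x + g x + p \<bullet> x"
      and sg: "semi_subgrad C (cball x0 R) U x q1" "semi_subgrad C (cball x0 R) g x q2"
      and so: "second_order_at U x q1 A1" "second_order_at g x q2 A2"
      by (rule Jensen_contact[OF C R(1) t(1) t(1) sgf sgg strict]; (assumption | (rule that; assumption)))
    have linA: "linear A1" "linear A2" using so unfolding second_order_at_def by auto
    have x\<Omega>: "x \<in> \<Omega>" using x R ball_subset_cball by blast
    have xK: "x \<in> K" using x\<Omega> K by blast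
    have "U x + W x \<ge> b + 2 * \<theta>"
    proof -
      have "U x0 + W x0 + \<psi> x0 \<le> U x + W x + \<psi> x + p \<bullet> (x - x0)"
        using bspec[OF mx, of x0] R t unfolding g_def
        by (simp add: inner_diff_right) (smt (verit) mult_nonneg_nonneg zero_le_power2)
      moreover have "p \<bullet> (x - x0) \<le> \<theta>"
      proof -
        have "p \<bullet> (x - x0) \<le> norm p * norm (x - x0)" by (rule norm_cauchy_schwarz)
        also have "\<dots> \<le> t * R" using p x t by (intro mult_mono) (auto simp: dist_norm norm_minus_commute)
        finally show ?thesis using t by simp
      qed
      moreover have "\<psi> x \<le> \<theta>" using \<psi>(3) xK K_def by blast
      ultimately show ?thesis using x0b by linarith
    qed
    then have Y\<Omega>: "Y1 x \<in> \<Omega>" "Y2 x \<in> \<Omega>" using near[OF xK] by blast+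
    \<comment> \<open>The term t |y - x|^2 puts \<open>\<phi>1\<close> above \<open>U\<close> and
      \<open>\<phi>g\<close> above \<open>g\<close> near \<open>x\<close>. Stripping barrier and
      penalty off again, \<open>\<phi>2\<close> lies below \<open>- W\<close>, with equality at
      \<open>x\<close>.\<close>
    define \<phi>1 where "\<phi>1 y = U x + q1 \<bullet> (y - x) + A1 (y - x) \<bullet> (y - x) / 2 + t * (norm (y - x))\<^sup>2" for y
    define \<phi>g where "\<phi>g y = g x + q2 \<bullet> (y - x) + A2 (y - x) \<bullet> (y - x) / 2 + t * (norm (y - x))\<^sup>2" for y
    define \<phi>2 where "\<phi>2 y = (\<psi> y + - (t * \<nu> y)) + - \<phi>g y" for y
    note \<phi>1 = quadratic_polyfun_second_order[OF linA(1) \<phi>1_def]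
    note \<phi>g = quadratic_polyfun_second_order[OF linA(2) \<phi>g_def]
    have pf: "(\<lambda>y. t * \<nu> y) \<in> polyfun" "(\<lambda>y. - (t * \<nu> y)) \<in> polyfun" "(\<lambda>y. - \<phi>g y) \<in> polyfun"
      "(\<lambda>y. \<psi> y + - (t * \<nu> y)) \<in> polyfun"
      by (intro pf_add polyfun_uminus polyfun_cmult \<psi>(1) \<nu> \<phi>g(1))+
    have \<phi>2: "\<phi>2 \<in> polyfun" unfolding \<phi>2_def by (rule pf_add[OF pf(4,3)])
    obtain \<rho> where \<rho>: "\<rho> > 0" "ball x \<rho> \<subseteq> cball x0 R"
      "\<And>y. norm (y - x) < \<rho> \<Longrightarrow> U y \<le> \<phi>1 y" "\<And>y. norm (y - x) < \<rho> \<Longrightarrow> g y \<le> \<phi>g y"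
    proof -
      obtain d1 where d1: "d1 > 0" "\<And>y. norm (y - x) < d1 \<Longrightarrow>
          \<bar>U y - U x - q1 \<bullet> (y - x) - A1 (y - x) \<bullet> (y - x) / 2\<bar> \<le> t * (norm (y - x))\<^sup>2"
        using so(1) t(1) unfolding second_order_at_def by meson
      obtain d2 where d2: "d2 > 0" "\<And>y. norm (y - x) < d2 \<Longrightarrow>
          \<bar>g y - g x - q2 \<bullet> (y - x) - A2 (y - x) \<bullet> (y - x) / 2\<bar> \<le> t * (norm (y - x))\<^sup>2"
        using so(2) t(1) unfolding second_order_at_def by meson
      have "open (ball x0 R)" by simp
      then obtain d3 where d3: "d3 > 0" "ball x d3 \<subseteq> ball x0 R" using x open_contains_ball by blast
      show thesis
      proof (rule that[of "min d1 (min d2 d3)"])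
        show "0 < min d1 (min d2 d3)" using d1 d2 d3 by simp
        show "ball x (min d1 (min d2 d3)) \<subseteq> cball x0 R"
          using d3(2) ball_subset_cball[of x0 R] subset_ball[of "min d1 (min d2 d3)" d3 x] by auto
        fix y assume y: "norm (y - x) < min d1 (min d2 d3)"
        show "U y \<le> \<phi>1 y" using d1(2)[of y] y unfolding \<phi>1_def by (simp add: abs_le_iff)
        show "g y \<le> \<phi>g y" using d2(2)[of y] y unfolding \<phi>g_def by (simp add: abs_le_iff)
      qed
    qed
    have \<phi>1x: "\<phi>1 x = U x" and \<phi>gx: "\<phi>g x = g x"
      unfolding \<phi>1_def \<phi>g_def by (simp_all add: linear_0[OF linA(1)] linear_0[OF linA(2)])
    define p1 p2 M1 M2 where defs: "p1 = hgrad gm X \<phi>1 x" "p2 = hgrad gm X \<phi>2 x"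
      "M1 = hhess gm X \<phi>1 x" "M2 = hhess gm X \<phi>2 x"
    have F1: "F (u (Y1 x)) p1 M1 \<ge> 0"
    proof -
      \<comment> \<open>With the displacement frozen at \<open>z\<close>, U y \<ge> u (gm z y) -
        |z|^2 / \<epsilon> for the points \<open>y\<close> considered, with equality at y = x. So
        \<open>\<phi>1\<close> touches the left translate of \<open>u\<close> from above.\<close>
      define z where "z = gm (Y1 x) (- x)"
      have zx: "gm z x = Y1 x" unfolding z_def by (simp add: gm_assoc)
      have "F (u (gm z x)) (hgrad gm X \<phi>1 x) (hhess gm X \<phi>1 x) \<ge> 0"
      proof (rule visc_sub_translated_test[OF u(2) \<phi>1(1) \<Omega>(2) _ _ \<rho>(1)])
        show "\<bar>u y\<bar> \<le> S" if "y \<in> \<Omega>" for y using S(1) that K by blast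
        show "gm z x \<in> \<Omega>" using zx Y\<Omega> by simp
        fix y assume y: "gm z y \<in> \<Omega>" "norm (y - x) < \<rho>"
        have "u (gm z y) - (norm z)\<^sup>2 / \<epsilon> \<le> U y" using U_ge[of "gm z y" y] y K by (auto simp: gm_assoc)
        moreover have "U x = u (gm z x) - (norm z)\<^sup>2 / \<epsilon>" using U[of x] zx unfolding z_def by simp
        ultimately show "u (gm z y) - \<phi>1 y \<le> u (gm z x) - \<phi>1 x" using \<rho>(3)[OF y(2)] \<phi>1x by linarith
      qed
      then show ?thesis unfolding zx defs .
    qed
    have F2: "F (v (Y2 x)) p2 M2 \<le> 0"
    proof -
      define z where "z = gm (Y2 x) (- x)"
      have zx: "gm z x = Y2 x" unfolding z_def by (simp add: gm_assoc)
      have "F (v (gm z x)) (hgrad gm X \<phi>2 x) (hhess gm X \<phi>2 x) \<le> 0"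
      proof (rule visc_super_translated_test[OF v(2) \<phi>2 \<Omega>(2) _ _ \<rho>(1)])
        show "\<bar>v y\<bar> \<le> S" if "y \<in> \<Omega>" for y using S(2) that K by blast
        show "gm z x \<in> \<Omega>" using zx Y\<Omega> by simp
        fix y assume y: "gm z y \<in> \<Omega>" "norm (y - x) < \<rho>"
        have "- v (gm z y) - (norm z)\<^sup>2 / \<epsilon> \<le> W y" using W_ge[of "gm z y" y] y K by (auto simp: gm_assoc)
        moreover have "W x = - v (gm z x) - (norm z)\<^sup>2 / \<epsilon>" using W[of x] zx unfolding z_def by simp
        moreover have "W y - g y + \<psi> y - t * \<nu> y = 0" "W x - g x + \<psi> x - t * \<nu> x = 0"
          unfolding g_def \<nu>_def by simp_all
        ultimately show "v (gm z x) - \<phi>2 x \<le> v (gm z y) - \<phi>2 y"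
          using \<rho>(4)[OF y(2)] \<phi>gx unfolding \<phi>2_def by linarith
      qed
      then show ?thesis unfolding zx defs .
    qed
    define c1 where "c1 \<xi> = curve1 x (horizontal_vec X \<xi>)" for \<xi>
    define c2 where "c2 \<xi> = curve2 x (horizontal_vec X \<xi>)" for \<xi>
    have c1: "norm (c1 \<xi>) \<le> \<Gamma> * norm \<xi>" and c2: "norm (c2 \<xi>) \<le> \<Gamma> * (norm \<xi>)\<^sup>2" for \<xi>
      unfolding c1_def c2_def using \<Gamma> xK by blast+
    have p1\<xi>: "p1 \<bullet> \<xi> = q1 \<bullet> c1 \<xi>" for \<xi>
      unfolding defs hgrad_inner[OF \<phi>1(1)] Xfield_second_order(1)[OF \<phi>1] c1_def ..
    have M1\<xi>: "\<xi> \<bullet> (M1 *v \<xi>) = 2 * (q1 \<bullet> c2 \<xi>) + A1 (c1 \<xi>) \<bullet> c1 \<xi> + 2 * t * (norm (c1 \<xi>))\<^sup>2" for \<xi>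
      unfolding defs hhess_form[OF \<phi>1(1)] Xfield_second_order(2)[OF \<phi>1] c1_def c2_def
      by (simp add: inner_add_left dot_square_norm)
    have Xt\<nu>: "Xfield gm w (\<lambda>y. t * \<nu> y) = (\<lambda>y. t * Xfield gm w \<nu> y)" "Xfield gm w (\<lambda>y. t * Xfield gm w \<nu> y) = (\<lambda>y. t * Xfield gm w (Xfield gm w \<nu>) y)" for w
      using Xfield_cmult[OF \<nu>] Xfield_cmult[OF polyfun_Xfield[OF \<nu>]] by auto
    have p2\<xi>: "p2 \<bullet> \<xi> = hgrad gm X \<psi> x \<bullet> \<xi> - t * (hgrad gm X \<nu> x \<bullet> \<xi>) - q2 \<bullet> c1 \<xi>" for \<xi>
    proof -
      have "p2 = hgrad gm X \<psi> x + - hgrad gm X (\<lambda>y. t * \<nu> y) x + - hgrad gm X \<phi>g x"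
        unfolding defs \<phi>2_def[abs_def] hgrad_add[OF pf(4,3)] hgrad_add[OF \<psi>(1) pf(2)] hgrad_uminus[OF pf(1)] hgrad_uminus[OF \<phi>g(1)] ..
      moreover have "hgrad gm X (\<lambda>y. t * \<nu> y) x \<bullet> \<xi> = t * (hgrad gm X \<nu> x \<bullet> \<xi>)"
        unfolding hgrad_inner[OF pf(1)] hgrad_inner[OF \<nu>] Xt\<nu> ..
      moreover have "hgrad gm X \<phi>g x \<bullet> \<xi> = q2 \<bullet> c1 \<xi>"
        unfolding hgrad_inner[OF \<phi>g(1)] Xfield_second_order(1)[OF \<phi>g] c1_def ..
      ultimately show ?thesis by (simp add: inner_add_left inner_diff_left)
    qed
    have M2\<xi>: "\<xi> \<bullet> (M2 *v \<xi>) = \<xi> \<bullet> (hhess gm X \<psi> x *v \<xi>) - t * (\<xi> \<bullet> (hhess gm X \<nu> x *v \<xi>))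
       - (2 * (q2 \<bullet> c2 \<xi>) + A2 (c1 \<xi>) \<bullet> c1 \<xi> + 2 * t * (norm (c1 \<xi>))\<^sup>2)" for \<xi>
    proof -
      have "M2 = hhess gm X \<psi> x + - hhess gm X (\<lambda>y. t * \<nu> y) x + - hhess gm X \<phi>g x"
        unfolding defs \<phi>2_def[abs_def] hhess_add[OF pf(4,3)] hhess_add[OF \<psi>(1) pf(2)] hhess_uminus[OF pf(1)] hhess_uminus[OF \<phi>g(1)] ..
      then have "\<xi> \<bullet> (M2 *v \<xi>) = \<xi> \<bullet> (hhess gm X \<psi> x *v \<xi>) - \<xi> \<bullet> (hhess gm X (\<lambda>y. t * \<nu> y) x *v \<xi>) - \<xi> \<bullet> (hhess gm X \<phi>g x *v \<xi>)"
        by (simp add: matrix_vector_mult_diff_rdistrib inner_diff_right)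
      moreover have "\<xi> \<bullet> (hhess gm X (\<lambda>y. t * \<nu> y) x *v \<xi>) = t * (\<xi> \<bullet> (hhess gm X \<nu> x *v \<xi>))"
        unfolding hhess_form[OF pf(1)] hhess_form[OF \<nu>] Xt\<nu> ..
      moreover have "\<xi> \<bullet> (hhess gm X \<phi>g x *v \<xi>) = 2 * (q2 \<bullet> c2 \<xi>) + A2 (c1 \<xi>) \<bullet> c1 \<xi> + 2 * t * (norm (c1 \<xi>))\<^sup>2"
        unfolding hhess_form[OF \<phi>g(1)] Xfield_second_order(2)[OF \<phi>g] c1_def c2_def
        by (simp add: inner_add_left dot_square_norm)
      ultimately show ?thesis by simp
    qed
    note Abd = contact_hessian_bounds[OF so sg \<rho>(2,1) sum bspec[OF mx]]
    have ip: "\<bar>w \<bullet> c1 \<xi>\<bar> \<le> l * \<Gamma> * norm \<xi>" "\<bar>w \<bullet> c2 \<xi>\<bar> \<le> l * \<Gamma> * (norm \<xi>)\<^sup>2" if "norm w \<le> l" for w l \<xi>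
    proof -
      have l: "l \<ge> 0" using that norm_ge_zero order_trans by blast
      show "\<bar>w \<bullet> c1 \<xi>\<bar> \<le> l * \<Gamma> * norm \<xi>"
        using order_trans[OF Cauchy_Schwarz_ineq2 mult_mono[OF that c1 l norm_ge_zero]] by (simp add: mult.assoc)
      show "\<bar>w \<bullet> c2 \<xi>\<bar> \<le> l * \<Gamma> * (norm \<xi>)\<^sup>2"
        using order_trans[OF Cauchy_Schwarz_ineq2 mult_mono[OF that c2 l norm_ge_zero]] by (simp add: mult.assoc)
    qed
    have c1sq: "(norm (c1 \<xi>))\<^sup>2 \<le> \<Gamma>\<^sup>2 * (norm \<xi>)\<^sup>2" for \<xi>
      using power_mono[OF c1, of \<xi> 2] by (simp add: power_mult_distrib)
    have Ac: "\<bar>A1 (c1 \<xi>) \<bullet> c1 \<xi>\<bar> \<le> 2 * C * (\<Gamma>\<^sup>2 * (norm \<xi>)\<^sup>2)" "\<bar>A2 (c1 \<xi>) \<bullet> c1 \<xi>\<bar> \<le> 2 * C * (\<Gamma>\<^sup>2 * (norm \<xi>)\<^sup>2)" for \<xi>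
      using order_trans[OF Abd(2) mult_left_mono[OF c1sq]] order_trans[OF Abd(3) mult_left_mono[OF c1sq]] C by simp_all
    have tc: "2 * t * (norm (c1 \<xi>))\<^sup>2 \<le> 2 * (\<Gamma>\<^sup>2 * (norm \<xi>)\<^sup>2)" "0 \<le> 2 * t * (norm (c1 \<xi>))\<^sup>2" for \<xi>
      using mult_mono[OF _ c1sq, of "2 * t" 2 \<xi>] t by simp_all
    have tN: "\<bar>t * (hgrad gm X \<nu> x \<bullet> \<xi>)\<bar> \<le> t * (N * norm \<xi>)" "\<bar>t * (\<xi> \<bullet> (hhess gm X \<nu> x *v \<xi>))\<bar> \<le> t * (N * (norm \<xi>)\<^sup>2)" for \<xi>
      unfolding abs_mult using N(2,3)[OF xK, of \<xi>] t by (auto intro!: mult_left_mono)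
    have tN': "t * (N * norm \<xi>) \<le> N * norm \<xi>" "t * (N * (norm \<xi>)\<^sup>2) \<le> N * (norm \<xi>)\<^sup>2" for \<xi>
      using t N(1) by (auto intro!: mult_left_le_one_le)
    have np1: "norm p1 \<le> Kp"
    proof (rule norm_le_of_inner_le[OF _ Kp])
      fix \<xi> :: "real^'m"
      have "\<bar>p1 \<bullet> \<xi>\<bar> \<le> Lc * \<Gamma> * norm \<xi>" unfolding p1\<xi> by (rule ip(1)[OF q(1)])
      moreover have "0 \<le> N\<psi> * norm \<xi>" "0 \<le> N * norm \<xi>" using N(1) N\<psi>(1) by simp_all
      ultimately show "\<bar>p1 \<bullet> \<xi>\<bar> \<le> Kp * norm \<xi>" unfolding Kp_def distrib_right by linarith
    qed
    have np2: "norm p2 \<le> Kp"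
    proof (rule norm_le_of_inner_le[OF _ Kp])
      fix \<xi> :: "real^'m"
      show "\<bar>p2 \<bullet> \<xi>\<bar> \<le> Kp * norm \<xi>"
        using N\<psi>(2)[OF xK, of \<xi>] tN(1)[of \<xi>] tN'(1)[of \<xi>] ip(1)[OF q(2), of \<xi>]
        unfolding p2\<xi> Kp_def distrib_right by linarith
    qed
    have nM1: "norm M1 \<le> real CARD('m) * real CARD('m) * Km"
    proof (rule norm_symmat_le)
      show "M1 \<in> symmats" unfolding defs by (rule hhess_symmats)
      fix \<xi> :: "real^'m"
      have "0 \<le> N\<psi> * (norm \<xi>)\<^sup>2" "0 \<le> N * (norm \<xi>)\<^sup>2" using N(1) N\<psi>(1) by simp_all
      moreover have "Km * (norm \<xi>)\<^sup>2 = 2 * (Lc * \<Gamma> * (norm \<xi>)\<^sup>2) + 2 * C * (\<Gamma>\<^sup>2 * (norm \<xi>)\<^sup>2) + 2 * (\<Gamma>\<^sup>2 * (norm \<xi>)\<^sup>2) + N\<psi> * (norm \<xi>)\<^sup>2 + N * (norm \<xi>)\<^sup>2"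
        unfolding Km_def by (simp add: algebra_simps)
      ultimately show "\<bar>\<xi> \<bullet> (M1 *v \<xi>)\<bar> \<le> Km * (norm \<xi>)\<^sup>2"
        using ip(2)[OF q(1), of \<xi>] Ac(1)[of \<xi>] tc[of \<xi>] unfolding M1\<xi> by linarith
    qed
    have nM2: "norm M2 \<le> real CARD('m) * real CARD('m) * Km"
    proof (rule norm_symmat_le)
      show "M2 \<in> symmats" unfolding defs by (rule hhess_symmats)
      fix \<xi> :: "real^'m"
      have "Km * (norm \<xi>)\<^sup>2 = 2 * (Lc * \<Gamma> * (norm \<xi>)\<^sup>2) + 2 * C * (\<Gamma>\<^sup>2 * (norm \<xi>)\<^sup>2) + 2 * (\<Gamma>\<^sup>2 * (norm \<xi>)\<^sup>2) + N\<psi> * (norm \<xi>)\<^sup>2 + N * (norm \<xi>)\<^sup>2"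
        unfolding Km_def by (simp add: algebra_simps)
      then show "\<bar>\<xi> \<bullet> (M2 *v \<xi>)\<bar> \<le> Km * (norm \<xi>)\<^sup>2"
        using ip(2)[OF q(2), of \<xi>] Ac(2)[of \<xi>] tc[of \<xi>] N\<psi>(3)[OF xK, of \<xi>] tN(2)[of \<xi>] tN'(2)[of \<xi>]
        unfolding M2\<xi> by linarith
    qed
    have q12: "q1 \<bullet> w + q2 \<bullet> w = - (p \<bullet> w)" for w
    proof -
      have "(q1 + q2 + p) \<bullet> w = 0" unfolding sum by simp
      then show ?thesis unfolding inner_add_left by linarith
    qed
    have grad: "norm (p2 - p1 - hgrad gm X \<psi> x) \<le> \<tau>"
    proof (rule norm_le_of_inner_le)
      fix \<xi> :: "real^'m"
      have "(p2 - p1 - hgrad gm X \<psi> x) \<bullet> \<xi> = p \<bullet> c1 \<xi> - t * (hgrad gm X \<nu> x \<bullet> \<xi>)"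
        unfolding inner_diff_left p1\<xi> p2\<xi> using q12[of "c1 \<xi>"] by linarith
      moreover have "\<bar>p \<bullet> c1 \<xi>\<bar> \<le> t * \<Gamma> * norm \<xi>" using p by (intro ip) simp
      ultimately have "\<bar>(p2 - p1 - hgrad gm X \<psi> x) \<bullet> \<xi>\<bar> \<le> t * \<Gamma> * norm \<xi> + t * (N * norm \<xi>)"
        using tN(1)[of \<xi>] by linarith
      also have "\<dots> = (t * (\<Gamma> + N)) * norm \<xi>" by (simp add: algebra_simps)
      also have "\<dots> \<le> \<tau> * norm \<xi>"
      proof (rule mult_right_mono)
        have "t * (\<Gamma> + N) \<le> t * D" unfolding D_def using t \<Gamma>(1) by (intro mult_left_mono) auto
        then show "t * (\<Gamma> + N) \<le> \<tau>" using t(4) by linarith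
      qed simp
      finally show "\<bar>(p2 - p1 - hgrad gm X \<psi> x) \<bullet> \<xi>\<bar> \<le> \<tau> * norm \<xi>" .
    qed (use \<open>\<tau> > 0\<close> in simp)
    \<comment> \<open>The \<open>curve2\<close> terms combine to q1 + q2 = -p, of size
      \<open>t\<close>; the forms of \<open>A1\<close> and \<open>A2\<close> have a nonpositive sum.
      Apart from the Hessian of \<psi>, only terms of order \<open>t\<close> are left.\<close>
    have hess: "\<xi> \<bullet> (M1 *v \<xi>) + \<xi> \<bullet> (hhess gm X \<psi> x *v \<xi>) \<le> \<xi> \<bullet> (M2 *v \<xi>) + \<tau> * (norm \<xi>)\<^sup>2" for \<xi>
    proof -
      have "\<bar>p \<bullet> c2 \<xi>\<bar> \<le> t * \<Gamma> * (norm \<xi>)\<^sup>2" using p by (intro ip) simp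
      moreover have "t * (norm (c1 \<xi>))\<^sup>2 \<le> t * (\<Gamma>\<^sup>2 * (norm \<xi>)\<^sup>2)" using t by (intro mult_left_mono c1sq) simp
      moreover have "2 * (t * \<Gamma> * (norm \<xi>)\<^sup>2) + 4 * (t * (\<Gamma>\<^sup>2 * (norm \<xi>)\<^sup>2)) + t * (N * (norm \<xi>)\<^sup>2) \<le> \<tau> * (norm \<xi>)\<^sup>2"
      proof -
        have "2 * (t * \<Gamma> * (norm \<xi>)\<^sup>2) + 4 * (t * (\<Gamma>\<^sup>2 * (norm \<xi>)\<^sup>2)) + t * (N * (norm \<xi>)\<^sup>2) = (t * (2 * \<Gamma> + 4 * \<Gamma>\<^sup>2 + N)) * (norm \<xi>)\<^sup>2"
          by (simp add: algebra_simps)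
        also have "\<dots> \<le> \<tau> * (norm \<xi>)\<^sup>2"
        proof (rule mult_right_mono)
          have "t * (2 * \<Gamma> + 4 * \<Gamma>\<^sup>2 + N) \<le> t * D" unfolding D_def using t by (intro mult_left_mono) auto
          then show "t * (2 * \<Gamma> + 4 * \<Gamma>\<^sup>2 + N) \<le> \<tau>" using t(4) by linarith
        qed simp
        finally show ?thesis .
      qed
      ultimately show ?thesis
        using Abd(1)[of "c1 \<xi>"] q12[of "c2 \<xi>"] tN(2)[of \<xi>] unfolding M1\<xi> M2\<xi> by linarith
    qed
    have rs: "u (Y1 x) \<ge> v (Y2 x) + 2 * \<theta>"
    proof -
      have "0 \<le> (norm (gm (Y1 x) (- x)))\<^sup>2 / \<epsilon>" "0 \<le> (norm (gm (Y2 x) (- x)))\<^sup>2 / \<epsilon>" using \<epsilon> by simp_all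
      then show ?thesis using \<open>U x + W x \<ge> b + 2 * \<theta>\<close> \<open>b \<ge> 0\<close> unfolding U W by linarith
    qed
    have bds: "\<bar>u (Y1 x)\<bar> \<le> B" "\<bar>v (Y2 x)\<bar> \<le> B" "norm p1 \<le> B" "norm p2 \<le> B" "norm M1 \<le> B" "norm M2 \<le> B"
      using S(1)[OF Y1[of x]] S(2)[OF Y2[of x]] np1 np2 nM1 nM2 B by linarith+
    have syms: "M1 \<in> symmats" "M2 \<in> symmats" unfolding defs by (rule hhess_symmats)+
    show "\<exists>r s p1 p2 M1 M2 x. x \<in> \<Omega> \<and> r \<ge> s + 2 * \<theta> \<and> \<bar>r\<bar> \<le> B \<and> \<bar>s\<bar> \<le> B \<and>
     norm p1 \<le> B \<and> norm p2 \<le> B \<and> norm M1 \<le> B \<and> norm M2 \<le> B \<and> M1 \<in> symmats \<and> M2 \<in> symmats \<and>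
     F r p1 M1 \<ge> 0 \<and> F s p2 M2 \<le> 0 \<and> norm (p2 - p1 - hgrad gm X \<psi> x) \<le> \<tau> \<and>
     (\<forall>\<xi>. \<xi> \<bullet> (M1 *v \<xi>) + \<xi> \<bullet> (hhess gm X \<psi> x *v \<xi>) \<le> \<xi> \<bullet> (M2 *v \<xi>) + \<tau> * (norm \<xi>)\<^sup>2)"
      by (intro exI[of _ "u (Y1 x)"] exI[of _ "v (Y2 x)"] exI[of _ p1] exI[of _ p2] exI[of _ M1] exI[of _ M2] exI[of _ x]
          conjI allI x\<Omega> rs bds syms F1 F2 grad hess)
  qed
qed

end

section \<open>The comparison principle\<close>

lemma trace_mono:
  fixes A B :: "real^'n::finite^'n"
  assumes "\<And>\<xi>. \<xi> \<bullet> (A *v \<xi>) \<le> \<xi> \<bullet> (B *v \<xi>)" shows "trace A \<le> trace B"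
  unfolding trace_def
proof (rule sum_mono)
  fix i
  have "axis i 1 \<bullet> (M *v axis i 1) = M $ i $ i" for M :: "real^'n^'n"
    by (simp add: matrix_vector_mul_component inner_axis inner_commute[of _ "axis _ _"] inner_axis')
  then show "A $ i $ i \<le> B $ i $ i" using assms[of "axis i 1"] by simp
qed

lemma closed_symmats: "closed (symmats :: (real^'m::finite^'m) set)"
  unfolding symmats_def transpose_def
  by (intro closed_Collect_eq continuous_on_vec_lambda continuous_intros)

lemma uniformly_continuous_on_bounded_jets:
  fixes F :: "real \<Rightarrow> real^'m::finite \<Rightarrow> real^'m^'m \<Rightarrow> real"
  assumes "continuous_on (UNIV \<times> UNIV \<times> symmats) (\<lambda>(r, p, M). F r p M)" "e > 0"
  shows "\<exists>d>0. \<forall>s p p' M M'. \<bar>s\<bar> \<le> B \<and> norm p \<le> B \<and> norm p' \<le> B \<and> norm M \<le> B \<and> norm M' \<le> B \<and>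
    M \<in> symmats \<and> M' \<in> symmats \<and> norm (p - p') < d \<and> norm (M - M') < d \<longrightarrow> \<bar>F s p M - F s p' M'\<bar> < e"
proof -
  define Z :: "(real \<times> (real^'m) \<times> (real^'m^'m)) set" where "Z = cball 0 B \<times> cball 0 B \<times> (cball 0 B \<inter> symmats)"
  have "compact Z" unfolding Z_def by (intro compact_Times compact_cball compact_Int_closed closed_symmats)
  then have "uniformly_continuous_on Z (\<lambda>(r, p, M). F r p M)"
    by (intro compact_uniformly_continuous continuous_on_subset[OF assms(1)]) (auto simp: Z_def)
  then obtain d where d: "d > 0" "\<And>z z'. z \<in> Z \<Longrightarrow> z' \<in> Z \<Longrightarrow> dist z' z < d \<Longrightarrow>
      dist (case z' of (r, p, M) \<Rightarrow> F r p M) (case z of (r, p, M) \<Rightarrow> F r p M) < e"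
    unfolding uniformly_continuous_on_def using assms(2) by meson
  show ?thesis
  proof (intro exI[of _ "d / 2"] conjI allI impI)
    show "d / 2 > 0" using d by simp
    fix s :: real and p p' :: "real^'m" and M M' :: "real^'m^'m"
    assume *: "\<bar>s\<bar> \<le> B \<and> norm p \<le> B \<and> norm p' \<le> B \<and> norm M \<le> B \<and> norm M' \<le> B \<and>
      M \<in> symmats \<and> M' \<in> symmats \<and> norm (p - p') < d / 2 \<and> norm (M - M') < d / 2"
    have "norm ((s, p, M) - (s, p', M')) \<le> norm (p - p') + norm (M - M')"
      using norm_Pair_le[of "s - s" "(p - p', M - M')"] norm_Pair_le[of "p - p'" "M - M'"] by simp
    then have "dist (s, p, M) (s, p', M') < d" using * by (simp add: dist_norm)
    then show "\<bar>F s p M - F s p' M'\<bar> < e"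
      using d(2)[of "(s, p', M')" "(s, p, M)"] * by (simp add: Z_def dist_real_def)
  qed
qed

lemma scaled_identity_form:
  fixes M :: "real^'m::finite^'m"
  shows "\<xi> \<bullet> ((M + \<tau> *\<^sub>R mat 1) *v \<xi>) = \<xi> \<bullet> (M *v \<xi>) + \<tau> * (norm \<xi>)\<^sup>2"
  by (simp add: matrix_vector_mult_add_rdistrib inner_add_right dot_square_norm flip: scaleR_matrix_vector_assoc)

lemma symmats_add_scaled_identity:
  assumes "M \<in> symmats" shows "M + \<tau> *\<^sub>R mat 1 \<in> symmats"
proof -
  have "transpose (M + \<tau> *\<^sub>R mat 1) = transpose M + \<tau> *\<^sub>R mat 1"
    by (simp add: transpose_def vec_eq_iff mat_def eq_commute)
  then show ?thesis using assms unfolding symmats_def by simp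
qed

text \<open>One horizontal coordinate suffices. With t = a \<bullet> x + k the Hessian of a power
  has rank at most one, and the ratio of its trace to the length of the gradient is (n - 1) / t,
  which a large exponent makes large on a bounded set.\<close>

lemma (in carnot) horizontal_barrier:
  fixes X :: "'m::finite \<Rightarrow> 'a" and K :: "'a set"
  assumes HX: "horizontal_basis V X" and "bounded K" "\<alpha>1 > 0" "\<alpha>2 > 0" "\<theta> > 0"
  shows "\<exists>\<psi>\<in>polyfun. \<exists>\<kappa>>0. \<forall>x\<in>K. 0 \<le> \<psi> x \<and> \<psi> x \<le> \<theta> \<and> (\<forall>\<xi>. 0 \<le> \<xi> \<bullet> (hhess gm X \<psi> x *v \<xi>)) \<and>
     \<alpha>1 * trace (hhess gm X \<psi> x) - \<alpha>2 * norm (hgrad gm X \<psi> x) \<ge> \<kappa>"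
proof -
  \<comment> \<open>Index types are inhabited, so at least one horizontal direction exists.\<close>
  obtain i0 :: 'm where True by blast
  define a where "a = X i0"
  have a: "a \<in> V 1" and aX: "a \<bullet> X i = (if i = i0 then 1 else 0)" for i
    using HX span_base[of "X i0" "range X"] unfolding horizontal_basis_def a_def by auto
  obtain m0 where m0: "\<And>x. x \<in> K \<Longrightarrow> norm x \<le> m0" using \<open>bounded K\<close> unfolding bounded_iff by blast
  define m where "m = norm a * \<bar>m0\<bar>"
  have m: "\<bar>a \<bullet> x\<bar> \<le> m" if "x \<in> K" for x
  proof -
    have "norm x \<le> \<bar>m0\<bar>" using m0[OF that] by simp
    then show ?thesis unfolding m_def by (intro order_trans[OF Cauchy_Schwarz_ineq2] mult_left_mono) auto
  qed
  have "m \<ge> 0" unfolding m_def by simp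
  \<comment> \<open>The shift makes the base of the power at least 1 on \<open>K\<close>;
    \<open>S\<close> will bound it from above.\<close>
  define k where "k = m + 1"
  define S where "S = 2 * m + 1"
  have S: "S \<ge> 1" unfolding S_def using \<open>m \<ge> 0\<close> by simp
  have s: "1 \<le> a \<bullet> x + k" "a \<bullet> x + k \<le> S" if "x \<in> K" for x
    using m[OF that] unfolding k_def S_def by linarith+
  obtain n0 where n0: "(\<alpha>2 * S + 1) / \<alpha>1 \<le> real n0" using real_arch_simple by blast
  \<comment> \<open>Yields \<alpha>1 (n - 1) - \<alpha>2 t \<ge> 1; the summand 2 keeps the exponent
    n - 2 clear of truncated subtraction.\<close>
  define n where "n = n0 + 2"
  have n: "\<alpha>2 * S + 1 \<le> \<alpha>1 * real (n - 1)"
  proof -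
    have "\<alpha>2 * S + 1 \<le> \<alpha>1 * real n0" using n0 \<open>\<alpha>1 > 0\<close> by (simp add: pos_divide_le_eq mult.commute)
    also have "\<dots> \<le> \<alpha>1 * real (n - 1)" using \<open>\<alpha>1 > 0\<close> unfolding n_def by simp
    finally show ?thesis .
  qed
  \<comment> \<open>Normalises \<psi> \<le> \<theta>; the strictness constant is then c n.\<close>
  define c where "c = \<theta> / S ^ n"
  have c: "c > 0" unfolding c_def using \<open>\<theta> > 0\<close> S by simp
  define \<psi> where "\<psi> z = c * (a \<bullet> z + k) ^ n" for z
  have \<psi>: "\<psi> \<in> polyfun"
    unfolding \<psi>_def by (intro polyfun_cmult polyfun_power pf_add pf_const polyfun_inner polymap_const polymap_ident)
  have X1: "Xfield gm v \<psi> = (\<lambda>x. (c * real n * (a \<bullet> v)) * (a \<bullet> x + k) ^ (n - 1))" for v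
    unfolding \<psi>_def[abs_def] using Xfield_horizontal_power[OF a] by blast
  have X2: "Xfield gm v (Xfield gm w \<psi>) x = c * real n * (a \<bullet> w) * real (n - 1) * (a \<bullet> v) * (a \<bullet> x + k) ^ (n - 2)" for v w x
    unfolding X1 Xfield_horizontal_power[OF a] by (simp add: n_def)
  show ?thesis
  proof (intro bexI[OF _ \<psi>] exI[of _ "c * real n"] conjI ballI)
    show "c * real n > 0" using c unfolding n_def by simp
    fix x assume x: "x \<in> K"
    define t where "t = a \<bullet> x + k"
    have t: "1 \<le> t" "t \<le> S" unfolding t_def using s[OF x] by auto
    show "0 \<le> \<psi> x" unfolding \<psi>_def t_def[symmetric] using c t by simp
    have "c * t ^ n \<le> c * S ^ n" using c t by (intro mult_left_mono power_mono) auto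
    then show "\<psi> x \<le> \<theta>" unfolding \<psi>_def t_def[symmetric] c_def using S by simp
    show "\<forall>\<xi>. 0 \<le> \<xi> \<bullet> (hhess gm X \<psi> x *v \<xi>)"
    proof
      fix \<xi> :: "real^'m"
      have "\<xi> \<bullet> (hhess gm X \<psi> x *v \<xi>) = c * real n * real (n - 1) * (a \<bullet> horizontal_vec X \<xi>)\<^sup>2 * t ^ (n - 2)"
        unfolding hhess_form[OF \<psi>] X2 t_def by (simp add: power2_eq_square)
      then show "0 \<le> \<xi> \<bullet> (hhess gm X \<psi> x *v \<xi>)" using c t by simp
    qed
    have "hgrad gm X \<psi> x = (c * real n * t ^ (n - 1)) *\<^sub>R axis i0 1"
      unfolding hgrad_def X1 t_def by (simp add: vec_eq_iff aX axis_def)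
    then have grad: "norm (hgrad gm X \<psi> x) = c * real n * t ^ (n - 1)" using c t by (simp add: norm_axis_1)
    have tr: "trace (hhess gm X \<psi> x) = c * real n * real (n - 1) * t ^ (n - 2)"
    proof -
      have "hhess gm X \<psi> x $ i $ i = (if i = i0 then c * real n * real (n - 1) * t ^ (n - 2) else 0)" for i
        unfolding hhess_def X2 t_def by (simp add: aX)
      then show ?thesis unfolding trace_def by simp
    qed
    have "t ^ (n - 1) = t * t ^ (n - 2)" unfolding n_def by simp
    then have "\<alpha>1 * trace (hhess gm X \<psi> x) - \<alpha>2 * norm (hgrad gm X \<psi> x) = c * real n * (t ^ (n - 2) * (\<alpha>1 * real (n - 1) - \<alpha>2 * t))"
      unfolding tr grad by (simp add: algebra_simps)
    also have "\<dots> \<ge> c * real n * (1 * 1)"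
    proof -
      have "\<alpha>2 * t \<le> \<alpha>2 * S" using t \<open>\<alpha>2 > 0\<close> by simp
      then have "1 \<le> \<alpha>1 * real (n - 1) - \<alpha>2 * t" using n by linarith
      moreover have "1 \<le> t ^ (n - 2)" using t by (intro one_le_power) auto
      ultimately show ?thesis using c by (intro mult_left_mono mult_mono) auto
    qed
    finally show "\<alpha>1 * trace (hhess gm X \<psi> x) - \<alpha>2 * norm (hgrad gm X \<psi> x) \<ge> c * real n" by simp
  qed
qed

theorem theoremA:
  fixes gm br :: "'a::euclidean_space \<Rightarrow> 'a \<Rightarrow> 'a"
    and V :: "nat \<Rightarrow> 'a set" and r :: nat
    and X :: "'m::finite \<Rightarrow> 'a"
    and F :: "real \<Rightarrow> real^'m \<Rightarrow> real^'m^'m \<Rightarrow> real"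
    and \<Omega> :: "'a set" and u v :: "'a \<Rightarrow> real"
  assumes G: "carnot_group gm br V r"
    and HX: "horizontal_basis V X"
    and dom: "open \<Omega>" "connected \<Omega>" "\<Omega> \<noteq> {}" "bounded \<Omega>"
    and Fcont: "continuous_on (UNIV \<times> UNIV \<times> symmats) (\<lambda>(r, p, M). F r p M)"
    and u: "continuous_on (closure \<Omega>) u" "visc_sub gm X F \<Omega> u"
    and v: "continuous_on (closure \<Omega>) v" "visc_super gm X F \<Omega> v"
    and cases: "(degenerate_subelliptic F \<and> decreasing_F F) \<or>
                (uniformly_subelliptic F \<and> nonincreasing_F F)"
  shows "(SUP x\<in>\<Omega>. max (u x - v x) 0) \<le> (SUP x\<in>frontier \<Omega>. max (u x - v x) 0)"
proof (rule ccontr)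
  interpret carnot gm br V r by unfold_locales (rule G)
  define b where "b = (SUP x\<in>frontier \<Omega>. max (u x - v x) 0)"
  assume "\<not> ?thesis"
  then have "\<not> (\<forall>x\<in>\<Omega>. max (u x - v x) 0 \<le> b)"
    unfolding b_def[symmetric] using cSUP_least[OF dom(3), of "\<lambda>x. max (u x - v x) 0" b] by blast
  then obtain xh where xh: "xh \<in> \<Omega>" "max (u xh - v xh) 0 > b" by force
  have fr: "frontier \<Omega> \<subseteq> closure \<Omega>" "compact (frontier \<Omega>)"
    using compact_frontier_bounded[OF dom(4)] by (auto simp: frontier_def)
  have "continuous_on (frontier \<Omega>) (\<lambda>x. max (u x - v x) 0)"
    using u(1) v(1) fr(1) by (intro continuous_intros) (auto intro: continuous_on_subset)
  then have "bounded ((\<lambda>x. max (u x - v x) 0) ` frontier \<Omega>)"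
    using fr(2) by (intro compact_imp_bounded compact_continuous_image)
  then have bdd: "bdd_above ((\<lambda>x. max (u x - v x) 0) ` frontier \<Omega>)" by (rule bounded_imp_bdd_above)
  have le_b: "max (u x - v x) 0 \<le> b" if "x \<in> frontier \<Omega>" for x
    unfolding b_def using bdd that by (rule cSUP_upper2[OF _ _ order_refl])
  \<comment> \<open>A bounded nonempty set is not the whole space, so it has a boundary;
    \<open>b\<close> is then a genuine supremum of nonnegative numbers.\<close>
  have "frontier \<Omega> \<noteq> {}"
    using dom frontier_eq_empty[of \<Omega>] not_bounded_UNIV by blast
  then have "b \<ge> 0" using le_b by (metis ex_in_conv max.bounded_iff)
  define \<theta> where "\<theta> = (u xh - v xh - b) / 4"
  have \<theta>: "\<theta> > 0" and xh4: "u xh - v xh \<ge> b + 4 * \<theta>"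
    using xh(2) \<open>b \<ge> 0\<close> unfolding \<theta>_def by (auto simp: max_def field_simps split: if_splits)
  have bd: "u x - v x \<le> b" if "x \<in> frontier \<Omega>" for x using le_b[OF that] by simp
  note contact = doubling_contact[OF dom(1,4) u v \<open>b \<ge> 0\<close> \<theta> bd xh(1) xh4]
  let ?I = "mat 1 :: real^'m^'m"
  from cases show False
  proof
    assume deg: "degenerate_subelliptic F \<and> decreasing_F F"
    then obtain \<alpha>3 where \<alpha>3: "\<alpha>3 > 0" "\<And>r s p M. M \<in> symmats \<Longrightarrow> r \<ge> s \<Longrightarrow> F r p M - F s p M \<le> \<alpha>3 * (s - r)"
      unfolding decreasing_F_def by blast
    \<comment> \<open>In the degenerate case the barrier is zero, with zero jet.\<close>
    have X0: "hgrad gm X (\<lambda>_. 0) x = 0" "hhess gm X (\<lambda>_. 0) x = 0" for x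
    proof -
      have "Xfield gm w (\<lambda>_. 0) = (\<lambda>_. 0)" for w by (simp add: Xfield_def fun_eq_iff)
      then show "hgrad gm X (\<lambda>_. 0) x = 0" "hhess gm X (\<lambda>_. 0) x = 0"
        unfolding hgrad_def hhess_def by (simp_all add: vec_eq_iff)
    qed
    obtain B where B: "\<And>\<tau>. \<tau> > 0 \<Longrightarrow> \<exists>r s p1 p2 M1 M2 x. x \<in> \<Omega> \<and> r \<ge> s + 2 * \<theta> \<and> \<bar>r\<bar> \<le> B \<and> \<bar>s\<bar> \<le> B \<and>
     norm p1 \<le> B \<and> norm p2 \<le> B \<and> norm M1 \<le> B \<and> norm M2 \<le> B \<and> M1 \<in> symmats \<and> M2 \<in> symmats \<and>
     F r p1 M1 \<ge> 0 \<and> F s p2 M2 \<le> 0 \<and> norm (p2 - p1) \<le> \<tau> \<and>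
     (\<forall>\<xi>. \<xi> \<bullet> (M1 *v \<xi>) \<le> \<xi> \<bullet> (M2 *v \<xi>) + \<tau> * (norm \<xi>)\<^sup>2)"
      using contact[of "\<lambda>_. 0"] \<theta> by (auto simp: X0 pf_const)
    \<comment> \<open>Leaves room for shifting a Hessian by \<tau> \<le> 1 times the
      identity.\<close>
    define B' where "B' = B + norm ?I"
    have "\<alpha>3 * \<theta> > 0" using \<alpha>3 \<theta> by simp
    from uniformly_continuous_on_bounded_jets[OF Fcont this, of B'] obtain d where d: "d > 0"
      "\<forall>s p p' M M'. \<bar>s\<bar> \<le> B' \<and> norm p \<le> B' \<and> norm p' \<le> B' \<and> norm M \<le> B' \<and> norm M' \<le> B' \<and>
        M \<in> symmats \<and> M' \<in> symmats \<and> norm (p - p') < d \<and> norm (M - M') < d \<longrightarrow> \<bar>F s p M - F s p' M'\<bar> < \<alpha>3 * \<theta>"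
      by (elim exE conjE)
    define \<tau> where "\<tau> = min 1 (d / (2 * (1 + norm ?I)))"
    have nI: "1 + norm ?I > 0" by (smt (verit) norm_ge_zero)
    have \<tau>: "\<tau> > 0" "\<tau> \<le> 1" "\<tau> * (1 + norm ?I) < d"
    proof -
      show "\<tau> > 0" "\<tau> \<le> 1" unfolding \<tau>_def using d nI by simp_all
      have "\<tau> * (1 + norm ?I) \<le> d / (2 * (1 + norm ?I)) * (1 + norm ?I)" unfolding \<tau>_def using nI by (intro mult_right_mono) auto
      also have "\<dots> = d / 2"
      proof -
        have "d / (2 * c) * c = d / 2" if "c > 0" for c :: real using that by (simp add: field_simps)
        then show ?thesis using nI by blast
      qed
      also have "\<dots> < d" using d(1) by simp
      finally show "\<tau> * (1 + norm ?I) < d" .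
    qed
    have \<tau>d: "\<tau> < d" "\<tau> * norm ?I < d" "\<tau> * norm ?I \<le> norm ?I"
    proof -
      have "0 \<le> \<tau> * norm ?I" "\<tau> + \<tau> * norm ?I < d" using \<tau>(1,3) by (simp_all add: distrib_left)
      then show "\<tau> < d" "\<tau> * norm ?I < d" using \<tau>(1) by linarith+
      show "\<tau> * norm ?I \<le> norm ?I" using \<tau>(1,2) by (intro mult_left_le_one_le) auto
    qed
    from B[OF \<tau>(1)] obtain r s p1 p2 M1 M2 where c: "r \<ge> s + 2 * \<theta>" "\<bar>s\<bar> \<le> B"
      "norm p1 \<le> B" "norm p2 \<le> B" "norm M2 \<le> B" "M1 \<in> symmats" "M2 \<in> symmats"
      "F r p1 M1 \<ge> 0" "F s p2 M2 \<le> 0" "norm (p2 - p1) \<le> \<tau>"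
      "\<forall>\<xi>. \<xi> \<bullet> (M1 *v \<xi>) \<le> \<xi> \<bullet> (M2 *v \<xi>) + \<tau> * (norm \<xi>)\<^sup>2"
      by (elim exE conjE)
    \<comment> \<open>The forms are ordered only up to \<tau>. Adding \<tau> times the identity to
      \<open>M2\<close> yields a true matrix inequality, and uniform continuity pays for the
      shift.\<close>
    define N where "N = M2 + \<tau> *\<^sub>R ?I"
    have N: "N \<in> symmats" unfolding N_def using c(7) by (rule symmats_add_scaled_identity)
    have "mat_le M1 N"
      unfolding mat_le_def matrix_vector_mult_diff_rdistrib inner_diff_right N_def scaled_identity_form using c(11) by simp
    then have "F r p1 M1 \<le> F r p1 N" using deg c(6) N unfolding degenerate_subelliptic_def by blast
    moreover have "F r p1 N - F s p1 N \<le> \<alpha>3 * (s - r)" using \<alpha>3(2)[OF N] c(1) \<theta> by simp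
    moreover have "\<alpha>3 * (s - r) \<le> \<alpha>3 * (- 2 * \<theta>)" using c(1) \<alpha>3(1) by (intro mult_left_mono) auto
    \<comment> \<open>This closes the chain 0 \<le> F r p1 M1 \<le> F r p1 N \<le> F s p1 N - 2
      \<alpha>3 \<theta> < F s p2 M2 - \<alpha>3 \<theta> \<le> - \<alpha>3 \<theta>.\<close>
    moreover have "\<bar>F s p1 N - F s p2 M2\<bar> < \<alpha>3 * \<theta>"
    proof (rule d(2)[rule_format], intro conjI)
      have "norm N \<le> norm M2 + \<tau> * norm ?I" unfolding N_def using norm_triangle_ineq[of M2 "\<tau> *\<^sub>R ?I"] \<tau> by simp
      then show "norm N \<le> B'" using c(5) \<tau>d unfolding B'_def by linarith
      show "norm (N - M2) < d" unfolding N_def using \<tau> \<tau>d by simp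
      show "norm (p1 - p2) < d" using c(10) \<tau>d by (simp add: norm_minus_commute)
    qed (use c N in \<open>auto simp: B'_def intro: add_increasing2\<close>)
    ultimately show False using c(8,9) \<open>\<alpha>3 * \<theta> > 0\<close> by (simp add: abs_less_iff)
  next
    assume uni: "uniformly_subelliptic F \<and> nonincreasing_F F"
    then obtain \<alpha>1 \<alpha>2 where \<alpha>: "\<alpha>1 > 0" "\<alpha>2 > 0" and ell: "\<And>r p q M N. M \<in> symmats \<Longrightarrow> N \<in> symmats \<Longrightarrow> mat_le N M \<Longrightarrow>
          F r p M - F r q N \<ge> \<alpha>1 * trace (M - N) - \<alpha>2 * norm (p - q)"
      unfolding uniformly_subelliptic_def by blast
    have "bounded (closure \<Omega>)" using dom(4) by (rule bounded_closure)
    from horizontal_barrier[OF HX this \<alpha> \<theta>] obtain \<psi> \<kappa> where \<psi>: "\<psi> \<in> polyfun" and \<kappa>: "\<kappa> > 0"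
      and \<psi>K: "\<forall>x\<in>closure \<Omega>. 0 \<le> \<psi> x \<and> \<psi> x \<le> \<theta> \<and> (\<forall>\<xi>. 0 \<le> \<xi> \<bullet> (hhess gm X \<psi> x *v \<xi>)) \<and>
       \<alpha>1 * trace (hhess gm X \<psi> x) - \<alpha>2 * norm (hgrad gm X \<psi> x) \<ge> \<kappa>"
      by (elim bexE exE conjE)
    have "\<exists>B. \<forall>\<tau>>0. \<exists>r s p1 p2 M1 M2 x. x \<in> \<Omega> \<and> r \<ge> s + 2 * \<theta> \<and> \<bar>r\<bar> \<le> B \<and> \<bar>s\<bar> \<le> B \<and>
     norm p1 \<le> B \<and> norm p2 \<le> B \<and> norm M1 \<le> B \<and> norm M2 \<le> B \<and> M1 \<in> symmats \<and> M2 \<in> symmats \<and>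
     F r p1 M1 \<ge> 0 \<and> F s p2 M2 \<le> 0 \<and> norm (p2 - p1 - hgrad gm X \<psi> x) \<le> \<tau> \<and>
     (\<forall>\<xi>. \<xi> \<bullet> (M1 *v \<xi>) + \<xi> \<bullet> (hhess gm X \<psi> x *v \<xi>) \<le> \<xi> \<bullet> (M2 *v \<xi>) + \<tau> * (norm \<xi>)\<^sup>2)"
      by (rule contact[OF _ \<psi>]) (use \<psi>K in auto)
    then obtain B where B: "\<forall>\<tau>>0. \<exists>r s p1 p2 M1 M2 x. x \<in> \<Omega> \<and> r \<ge> s + 2 * \<theta> \<and> \<bar>r\<bar> \<le> B \<and> \<bar>s\<bar> \<le> B \<and>
     norm p1 \<le> B \<and> norm p2 \<le> B \<and> norm M1 \<le> B \<and> norm M2 \<le> B \<and> M1 \<in> symmats \<and> M2 \<in> symmats \<and>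
     F r p1 M1 \<ge> 0 \<and> F s p2 M2 \<le> 0 \<and> norm (p2 - p1 - hgrad gm X \<psi> x) \<le> \<tau> \<and>
     (\<forall>\<xi>. \<xi> \<bullet> (M1 *v \<xi>) + \<xi> \<bullet> (hhess gm X \<psi> x *v \<xi>) \<le> \<xi> \<bullet> (M2 *v \<xi>) + \<tau> * (norm \<xi>)\<^sup>2)"
      by (rule exE)
    define B' where "B' = B + norm ?I"
    have "\<kappa> / 2 > 0" using \<kappa> by simp
    from uniformly_continuous_on_bounded_jets[OF Fcont this, of B'] obtain d where d: "d > 0"
      "\<forall>s p p' M M'. \<bar>s\<bar> \<le> B' \<and> norm p \<le> B' \<and> norm p' \<le> B' \<and> norm M \<le> B' \<and> norm M' \<le> B' \<and>
        M \<in> symmats \<and> M' \<in> symmats \<and> norm (p - p') < d \<and> norm (M - M') < d \<longrightarrow> \<bar>F s p M - F s p' M'\<bar> < \<kappa> / 2"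
      by (elim exE conjE)
    \<comment> \<open>Half of \<kappa> pays for the gradient error \<alpha>2 \<tau>, the other half
      for the identity shift.\<close>
    define \<tau> where "\<tau> = min (min 1 (\<kappa> / (2 * \<alpha>2))) (d / (2 * (1 + norm ?I)))"
    have nI: "1 + norm ?I > 0" by (smt (verit) norm_ge_zero)
    have \<tau>: "\<tau> > 0" "\<tau> \<le> 1" "\<tau> * (1 + norm ?I) < d" "\<alpha>2 * \<tau> \<le> \<kappa> / 2"
    proof -
      show "\<tau> > 0" "\<tau> \<le> 1" unfolding \<tau>_def using d nI \<kappa> \<alpha> by simp_all
      have "\<tau> * (1 + norm ?I) \<le> d / (2 * (1 + norm ?I)) * (1 + norm ?I)" unfolding \<tau>_def using nI by (intro mult_right_mono) auto
      also have "\<dots> = d / 2"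
      proof -
        have "d / (2 * c) * c = d / 2" if "c > 0" for c :: real using that by (simp add: field_simps)
        then show ?thesis using nI by blast
      qed
      also have "\<dots> < d" using d(1) by simp
      finally show "\<tau> * (1 + norm ?I) < d" .
      have "\<alpha>2 * \<tau> \<le> \<alpha>2 * (\<kappa> / (2 * \<alpha>2))" unfolding \<tau>_def using \<alpha> by (intro mult_left_mono) auto
      then show "\<alpha>2 * \<tau> \<le> \<kappa> / 2" using \<alpha> by simp
    qed
    have \<tau>d: "\<tau> * norm ?I < d" "\<tau> * norm ?I \<le> norm ?I"
    proof -
      have "\<tau> + \<tau> * norm ?I < d" using \<tau>(3) by (simp add: distrib_left)
      then show "\<tau> * norm ?I < d" using \<tau>(1) by linarith
      show "\<tau> * norm ?I \<le> norm ?I" using \<tau>(1,2) by (intro mult_left_le_one_le) auto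
    qed
    from B \<tau>(1) obtain r s p1 p2 M1 M2 x where c: "x \<in> \<Omega>" "r \<ge> s + 2 * \<theta>" "\<bar>s\<bar> \<le> B"
      "norm p2 \<le> B" "norm M2 \<le> B" "M1 \<in> symmats" "M2 \<in> symmats"
      "F r p1 M1 \<ge> 0" "F s p2 M2 \<le> 0" "norm (p2 - p1 - hgrad gm X \<psi> x) \<le> \<tau>"
      "\<forall>\<xi>. \<xi> \<bullet> (M1 *v \<xi>) + \<xi> \<bullet> (hhess gm X \<psi> x *v \<xi>) \<le> \<xi> \<bullet> (M2 *v \<xi>) + \<tau> * (norm \<xi>)\<^sup>2"
      by (elim allE[of _ \<tau>] impE exE conjE)
    have "x \<in> closure \<Omega>" using c(1) closure_subset by blast
    then have hx: "\<And>\<xi>. 0 \<le> \<xi> \<bullet> (hhess gm X \<psi> x *v \<xi>)" "\<alpha>1 * trace (hhess gm X \<psi> x) - \<alpha>2 * norm (hgrad gm X \<psi> x) \<ge> \<kappa>"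
      using \<psi>K by auto
    define N where "N = M2 + \<tau> *\<^sub>R ?I"
    have N: "N \<in> symmats" unfolding N_def using c(7) by (rule symmats_add_scaled_identity)
    have form: "\<xi> \<bullet> (hhess gm X \<psi> x *v \<xi>) \<le> \<xi> \<bullet> ((N - M1) *v \<xi>)" for \<xi>
      unfolding matrix_vector_mult_diff_rdistrib inner_diff_right N_def scaled_identity_form
      using c(11)[rule_format, of \<xi>] by simp
    then have "mat_le M1 N" unfolding mat_le_def using hx(1) order_trans by blast
    \<comment> \<open>Ellipticity, the barrier and F s p1 M1 \<ge> F r p1 M1 \<ge> 0 give F s p2 N
      \<ge> \<kappa> / 2, whereas uniform continuity and F s p2 M2 \<le> 0 give F s p2 N < \<kappa>
      / 2.\<close>
    from ell[OF N c(6) this, where r = s and p = p2 and q = p1]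
    have "F s p2 N - F s p1 M1 \<ge> \<alpha>1 * trace (N - M1) - \<alpha>2 * norm (p2 - p1)" .
    moreover have "\<alpha>1 * trace (hhess gm X \<psi> x) \<le> \<alpha>1 * trace (N - M1)"
      using form \<alpha>(1) by (intro mult_left_mono trace_mono) auto
    moreover have "\<alpha>2 * norm (p2 - p1) \<le> \<alpha>2 * (norm (hgrad gm X \<psi> x) + \<tau>)"
      using \<alpha>(2) c(10) norm_triangle_ineq[of "p2 - p1 - hgrad gm X \<psi> x" "hgrad gm X \<psi> x"]
      by (intro mult_left_mono) auto
    moreover have "F r p1 M1 \<le> F s p1 M1"
      using uni c(2,6) \<theta> unfolding nonincreasing_F_def by auto
    moreover have "\<bar>F s p2 N - F s p2 M2\<bar> < \<kappa> / 2"
    proof (rule d(2)[rule_format], intro conjI)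
      have "norm N \<le> norm M2 + \<tau> * norm ?I" unfolding N_def using norm_triangle_ineq[of M2 "\<tau> *\<^sub>R ?I"] \<tau> by simp
      then show "norm N \<le> B'" using c(5) \<tau>d unfolding B'_def by linarith
      show "norm (N - M2) < d" unfolding N_def using \<tau> \<tau>d by simp
    qed (use c N d(1) in \<open>auto simp: B'_def intro: add_increasing2\<close>)
    ultimately show False
      using c(8,9) hx(2) \<tau>(4) unfolding distrib_left abs_less_iff by linarith
  qed
qed

end
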